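(* Let $K$ be a nonempty compact metric space and let $X=(X(t))_{t\in K}$ be a centred Gaussian process, regarded as a measurable $C(K)$-valued random element, with covariance kernel $R(s,t)=\mathbb E\{X(s)X(t)\}$. Let $M=\min_{t\in K}X(t)$, let $T$ be any measurable minimizer selection (a $K$-valued random variable with $T\in\operatorname{argmin}_{t\in K}X(t)$), and let $\sigma_*^2=\min_{\mu\in\mathcal M_1(K)}\mathcal E_R(\mu)$. Suppose that $\sigma_*^2>0$, and let $\nu$ be any optimal measure, i.e. $\nu\in\mathcal M_1(K)$ with $\mathcal E_R(\nu)=\sigma_*^2$. Then every weak subsequential limit $\mu\in\mathcal M_1(K)$ of the conditional laws $\mathcal L(T\mid M>u)$ along $u\to\infty$ (that is, every weak limit of $\mathcal L(T\mid M>u_n)$ for some sequence $u_n\to\infty$) satisfies \[ k_\mu=k_\nu \quad\text{on }K \] and is itself optimal, i.e. $\mathcal E_R(\mu)=\sigma_*^2$. Consequently, if the optimal measure $\nu$ is unique, then, as $u\to\infty$, weakly in $\mathcal M_1(K)$, \[ \mathcal L(T\mid M>u)\Longrightarrow\nu . \]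
   Context: $C(K)$ is the space of real continuous functions on $K$ with the supremum norm; in particular $X$ has continuous sample paths, and $R$ is continuous on $K^2$. $\mathcal M_1(K)$ denotes the set of Borel probability measures on $K$. For a finite signed Borel measure $\eta$ on $K$, the covariance energy and the potential are \[ \mathcal E_R(\eta)=\iint_{K^2}R(s,t)\,\eta(ds)\eta(dt),\qquad k_\eta(t)=\int_K R(s,t)\,\eta(ds),\quad t\in K . \] The minimum defining $\sigma_*^2$ is attained; any probability measure attaining it is called an optimal measure. Measurable minimizer selections exist (e.g. $T=S(X)$ for a Borel map $S:C(K)\to K$ with $S(x)\in\operatorname{argmin}_{t\in K}x(t)$ for every $x\in C(K)$). $\mathcal L(V\mid A)$ denotes the conditional law of $V$ given an event $A$ of positive probability, and $\Longrightarrow$ denotes weak convergence. When $\sigma_*^2>0$ one has $\mathbb P\{M>u\}>0$ for every $u\in\mathbb R$, so the conditional laws are well defined. *)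

theory Defs
  imports "HOL-Probability.Probability"
begin

(* The compact metric space K is a type 'k :: metric_space with compact (UNIV :: 'k set), so
   that the library type of bounded continuous functions, with its supremum metric, is C(K). *)

definition prob_measures :: "'k::topological_space measure set" where
  "prob_measures = {\<mu>. prob_space \<mu> \<and> sets \<mu> = sets borel}"

(* Gaussian laws on the line include the degenerate ones (point masses). *)
definition gaussian_rv :: "'w measure \<Rightarrow> ('w \<Rightarrow> real) \<Rightarrow> bool" where
  "gaussian_rv P Y \<longleftrightarrow> Y \<in> borel_measurable P \<and>
     ((\<exists>m. AE w in P. Y w = m) \<or>
      (\<exists>m s. s > 0 \<and> distributed P lborel Y (normal_density m s)))"

definition gaussian_process :: "'w measure \<Rightarrow> ('w \<Rightarrow> 'k \<Rightarrow> real) \<Rightarrow> bool" where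
  "gaussian_process P X \<longleftrightarrow>
     (\<forall>F c. finite F \<longrightarrow> gaussian_rv P (\<lambda>w. \<Sum>t\<in>F. c t * X w t))"

definition centred_gaussian_process :: "'w measure \<Rightarrow> ('w \<Rightarrow> 'k \<Rightarrow> real) \<Rightarrow> bool" where
  "centred_gaussian_process P X \<longleftrightarrow>
     gaussian_process P X \<and> (\<forall>t. (\<integral>w. X w t \<partial>P) = 0)"

definition cov_kernel :: "'w measure \<Rightarrow> ('w \<Rightarrow> 'k \<Rightarrow> real) \<Rightarrow> 'k \<Rightarrow> 'k \<Rightarrow> real" where
  "cov_kernel P X s t = (\<integral>w. X w s * X w t \<partial>P)"

definition energy :: "('k \<Rightarrow> 'k \<Rightarrow> real) \<Rightarrow> 'k measure \<Rightarrow> real" where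
  "energy R \<mu> = (\<integral>(s, t). R s t \<partial>(\<mu> \<Otimes>\<^sub>M \<mu>))"

definition potential :: "('k \<Rightarrow> 'k \<Rightarrow> real) \<Rightarrow> 'k measure \<Rightarrow> 'k \<Rightarrow> real" where
  "potential R \<mu> t = (\<integral>s. R s t \<partial>\<mu>)"

(* For the continuous covariance kernels considered here the infimum is attained. *)
definition min_energy :: "('k::topological_space \<Rightarrow> 'k \<Rightarrow> real) \<Rightarrow> real" where
  "min_energy R = (INF \<mu>\<in>prob_measures. energy R \<mu>)"

definition optimal_measure ::
    "('k::topological_space \<Rightarrow> 'k \<Rightarrow> real) \<Rightarrow> 'k measure \<Rightarrow> bool" where
  "optimal_measure R \<nu> \<longleftrightarrow> \<nu> \<in> prob_measures \<and> energy R \<nu> = min_energy R"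

definition path_min :: "('k::topological_space \<Rightarrow>\<^sub>C real) \<Rightarrow> real" where
  "path_min x = (INF t. apply_bcontfun x t)"

definition minimizer_selection ::
    "'w measure \<Rightarrow> ('w \<Rightarrow> 'k::topological_space \<Rightarrow>\<^sub>C real) \<Rightarrow> ('w \<Rightarrow> 'k) \<Rightarrow> bool" where
  "minimizer_selection P X T \<longleftrightarrow> T \<in> borel_measurable P \<and>
     (\<forall>w\<in>space P. is_arg_min (apply_bcontfun (X w)) (\<lambda>t. True) (T w))"

definition cond_law ::
    "'w measure \<Rightarrow> ('w \<Rightarrow> 'k::topological_space) \<Rightarrow> 'w set \<Rightarrow> 'k measure" where
  "cond_law P V A = distr (uniform_measure P A) borel V"

definition weak_conv_to ::
    "('i \<Rightarrow> 'k::topological_space measure) \<Rightarrow> 'k measure \<Rightarrow> 'i filter \<Rightarrow> bool" where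
  "weak_conv_to \<mu>s \<mu> F \<longleftrightarrow>
     (\<forall>f :: 'k \<Rightarrow>\<^sub>C real.
        ((\<lambda>i. \<integral>t. apply_bcontfun f t \<partial>(\<mu>s i)) \<longlongrightarrow> (\<integral>t. apply_bcontfun f t \<partial>\<mu>)) F)"

end

theory Submission
  imports Defs "HOL-Real_Asymp.Real_Asymp"
begin

text \<open>
  Write \<open>v\<close> for the minimal energy, \<open>k\<close> for the potential of \<open>\<nu>\<close> and \<open>Y = \<integral> X d\<nu>\<close>. Then \<open>Y\<close> is normal
  with variance \<open>v\<close>, \<open>X = (Y / v) k + Z\<close> with \<open>Z\<close> independent of \<open>Y\<close>, and optimality gives \<open>k \<ge> v\<close>.
  Differentiating the Cameron-Martin formula in the direction of a potential yields
  \<open>E [X(t) (M - u)\<^sup>+] = E [R(t, T); M > u]\<close> and \<open>E [Y (M - u)\<^sup>+] = E [k(T); M > u]\<close>. Hence, with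
  \<open>\<mu>\<^sub>u\<close> the law of \<open>T\<close> given \<open>M > u\<close>, the potential of \<open>\<mu>\<^sub>u\<close> at \<open>t\<close> differs from
  \<open>(k(t) / v) \<integral> k d\<mu>\<^sub>u\<close> by \<open>E [Z(t) (M - u) | M > u]\<close>. By Fernique's theorem and
  \<open>P(M > u) \<ge> p exp (- u\<^sup>2 / (2 v) - c u)\<close>, the event \<open>{\<parallel>Z\<parallel> > \<epsilon> u}\<close> is negligible given \<open>M > u\<close>. So
  this error vanishes; and since \<open>Y \<ge> M = X(T)\<close> forces \<open>k(T) / v - 1 \<le> \<parallel>Z\<parallel> / Y\<close>, also
  \<open>\<integral> k d\<mu>\<^sub>u\<close> tends to \<open>v\<close>. The potentials of \<open>\<mu>\<^sub>u\<close> therefore converge to \<open>k\<close> pointwise, which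
  identifies the weak limits; sequential compactness of the probability measures on \<open>K\<close> gives the
  convergence when \<open>\<nu>\<close> is unique.
\<close>

section \<open>Characteristic functionals\<close>

text \<open>The path minimum need not be differentiable along a shift, and a path may have several
  minimizers. Evaluating the shifted path at \<open>T\<close> still bounds its minimum from above;
  shifts of both signs give two opposite inequalities, hence an identity, for every selection
  \<open>T\<close>. The difference quotient of \<open>(M - u)\<^sup>+\<close> is controlled only off
  \<open>M = u\<close>, which is why the absence of positive atoms of \<open>M\<close> is proved.
  Laws of paths are compared on the sigma-algebra generated by the evaluations: finite-dimensional
  characteristic functions determine them there, and by continuity the norm and the minimum are
  measurable for it. What is used of Fernique's theorem is the finiteness of all exponential moments
  of the norm. A Cameron-Martin shift by \<open>u / v\<close> extracts the exact factor
  \<open>exp (- u\<^sup>2 / (2 v))\<close>, so the comparison with the lower bound for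
  \<open>P(M > u)\<close> leaves only \<open>exp (c u)\<close>; on
  \<open>\<parallel>Z\<parallel> > \<epsilon> u\<close> an exponential moment of high enough rate
  outweighs it.\<close>

lemma weighted_Levy_uniqueness:
  fixes D U :: "'a \<Rightarrow> real" and D' U' :: "'b \<Rightarrow> real"
  assumes D: "integrable P D" "\<And>w. 0 \<le> D w" and U: "U \<in> borel_measurable P"
    and D': "integrable P' D'" "\<And>w. 0 \<le> D' w" and U': "U' \<in> borel_measurable P'"
    and eq: "\<And>a. (CLINT w|P. D w *\<^sub>R iexp (a * U w)) = (CLINT w|P'. D' w *\<^sub>R iexp (a * U' w))"
    and A: "A \<in> sets borel"
  shows "(LINT w|P. D w * indicator A (U w)) = (LINT w|P'. D' w * indicator A (U' w))"
proof -
  have [measurable]: "D \<in> borel_measurable P" "D' \<in> borel_measurable P'"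
      "U \<in> borel_measurable P" "U' \<in> borel_measurable P'" "A \<in> sets borel"
    using assms by auto
  define m where "m = (LINT w|P. D w)"
  \<comment> \<open>Frequency zero compares the total masses of the two weights.\<close>
  have "complex_of_real m = complex_of_real (LINT w|P'. D' w)"
    using eq[of 0] by (simp add: m_def scaleR_conv_of_real del: of_real_eq_iff)
  then have m': "m = (LINT w|P'. D' w)" by (simp only: of_real_eq_iff)
  have m0: "m \<ge> 0" unfolding m_def using D by simp
  show ?thesis
  \<comment> \<open>A weight of total mass zero cannot be normalized to a density, but then both
    integrands vanish almost everywhere.\<close>
  proof (cases "m = 0")
    case True
    have 1: "AE w in P. D w = 0"
      using True D unfolding m_def by (subst (asm) integral_nonneg_eq_0_iff_AE) auto
    have 2: "AE w in P'. D' w = 0"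
      using True D' unfolding m' by (subst (asm) integral_nonneg_eq_0_iff_AE) auto
    have "(LINT w|P. D w * indicator A (U w)) = (LINT w|P. 0)"
      using 1 by (intro integral_cong_AE) auto
    moreover have "(LINT w|P'. D' w * indicator A (U' w)) = (LINT w|P'. 0)"
      using 2 by (intro integral_cong_AE) auto
    ultimately show ?thesis by simp
  next
    case False
    with m0 have mp: "m > 0" by simp
    \<comment> \<open>Stated for a generic space, since \<open>P\<close> and \<open>P'\<close> have
      different underlying types. Dividing by \<open>m\<close> turns the weight into a probability
      density, so that characteristic functions of laws become available.\<close>
    have law: "real_distribution (distr (density Q (\<lambda>w. ennreal (E w / m))) borel V)
        \<and> (\<forall>a. char (distr (density Q (\<lambda>w. ennreal (E w / m))) borel V) a
             = (CLINT w|Q. E w *\<^sub>R iexp (a * V w)) / m)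
        \<and> measure (distr (density Q (\<lambda>w. ennreal (E w / m))) borel V) A
             = (LINT w|Q. E w * indicator A (V w)) / m"
      if E: "integrable Q E" "\<And>w. 0 \<le> E w" and V[measurable]: "V \<in> borel_measurable Q"
        and tot: "(LINT w|Q. E w) = m"
      for Q :: "'c measure" and E V :: "'c \<Rightarrow> real"
    proof -
      let ?N = "distr (density Q (\<lambda>w. ennreal (E w / m))) borel V"
      have [measurable]: "E \<in> borel_measurable Q" using E by auto
      have "emeasure (density Q (\<lambda>w. ennreal (E w / m))) (space Q) = ennreal (LINT w|Q. E w / m)"
        using E mp by (simp add: emeasure_density nn_integral_eq_integral cong: nn_integral_cong)
      also have "\<dots> = 1" using tot mp by simp
      finally have pd: "prob_space (density Q (\<lambda>w. ennreal (E w / m)))"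
        by (intro prob_spaceI) simp
      have rd: "real_distribution ?N"
        by (intro prob_space.real_distribution_distr pd) simp
      have ch: "char ?N a = (CLINT w|Q. E w *\<^sub>R iexp (a * V w)) / m" for a
      proof -
        have "char ?N a = (CLINT w|density Q (\<lambda>w. ennreal (E w / m)). iexp (a * V w))"
          unfolding char_def by (subst integral_distr) auto
        also have "\<dots> = (CLINT w|Q. (E w / m) *\<^sub>R iexp (a * V w))"
          using E mp by (subst integral_density) auto
        also have "\<dots> = (CLINT w|Q. (1/m) *\<^sub>R (E w *\<^sub>R iexp (a * V w)))"
          by (simp add: divide_inverse mult.commute)
        also have "\<dots> = (CLINT w|Q. E w *\<^sub>R iexp (a * V w)) / m"
          by (subst integral_scaleR_right) (simp add: scaleR_conv_of_real divide_inverse mult.commute)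
        finally show ?thesis .
      qed
      have "measure ?N A = (LINT x|?N. indicator A x)" by simp
      also have "\<dots> = (LINT w|density Q (\<lambda>w. ennreal (E w / m)). indicator A (V w))"
        by (subst integral_distr) auto
      also have "\<dots> = (LINT w|Q. (E w / m) *\<^sub>R indicator A (V w))"
        using E mp by (subst integral_density) auto
      also have "\<dots> = (LINT w|Q. E w * indicator A (V w)) / m" by simp
      finally show ?thesis using rd ch by blast
    qed
    note l1 = law[OF D U m_def[symmetric]] and l2 = law[OF D' U' m'[symmetric]]
    have "distr (density P (\<lambda>w. ennreal (D w / m))) borel U
        = distr (density P' (\<lambda>w. ennreal (D' w / m))) borel U'"
      using l1 l2 eq by (intro Levy_uniqueness) auto
    then show ?thesis using l1 l2 mp by simp
  qed
qed

text \<open>One coordinate \<open>U\<close> of a characteristic functional is replaced by an indicator. The complex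
  density \<open>iexp S\<close> is split into the nonnegative densities \<open>1 + cos S\<close>, \<open>1 + sin S\<close> and \<open>1\<close>, so
  that one-dimensional uniqueness applies.\<close>

lemma char_replace_coordinate:
  fixes U S :: "'a \<Rightarrow> real" and U' S' :: "'b \<Rightarrow> real"
  assumes P: "finite_measure P" "finite_measure P'"
    and B[measurable]: "B \<in> sets P" "B' \<in> sets P'"
    and U[measurable]: "U \<in> borel_measurable P" "U' \<in> borel_measurable P'"
    and S[measurable]: "S \<in> borel_measurable P" "S' \<in> borel_measurable P'"
    and eq: "\<And>a b. (CLINT w|P. indicat_real B w *\<^sub>R iexp (a * U w + b * S w))
               = (CLINT w|P'. indicat_real B' w *\<^sub>R iexp (a * U' w + b * S' w))"
    and A[measurable]: "A \<in> sets borel"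
  shows "(CLINT w|P. (indicat_real B w * indicat_real A (U w)) *\<^sub>R iexp (S w))
       = (CLINT w|P'. (indicat_real B' w * indicat_real A (U' w)) *\<^sub>R iexp (S' w))"
proof -
  interpret P: finite_measure P by fact
  interpret P': finite_measure P' by fact
  have ab3: "\<bar>1 + cos x\<bar> \<le> 3" "\<bar>1 + sin x\<bar> \<le> 3" for x :: real
    using cos_le_one[of x] cos_ge_minus_one[of x] sin_le_one[of x] sin_ge_minus_one[of x] by linarith+
  have ab0: "0 \<le> 1 + cos x" "0 \<le> 1 + sin x" for x :: real
    using cos_ge_minus_one[of x] sin_ge_minus_one[of x] by linarith+
  have cosE: "complex_of_real (cos x) = iexp x / 2 + iexp (- x) / 2" for x
    by (simp add: cos_of_real[symmetric] cos_exp_eq add_divide_distrib)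
  have sinE: "complex_of_real (sin x) = iexp x / (2 * \<i>) - iexp (- x) / (2 * \<i>)" for x
    by (simp add: sin_of_real[symmetric] sin_exp_eq diff_divide_distrib right_diff_distrib)
  have ie: "iexp x * iexp y = iexp (x + y)" for x y by (simp add: exp_add distrib_left)
  have int: "integrable Q (\<lambda>w. indicat_real C w * (1 + cos (s w)))"
      "integrable Q (\<lambda>w. indicat_real C w * (1 + sin (s w)))"
      "integrable Q (indicat_real C)"
    if Q: "finite_measure Q" and [measurable]: "C \<in> sets Q" "s \<in> borel_measurable Q"
    for Q :: "'c measure" and C s
  proof -
    interpret Q: finite_measure Q by fact
    have ir: "integrable Q f" if "f \<in> borel_measurable Q" "\<And>w. \<bar>f w\<bar> \<le> 3" for f :: "'c \<Rightarrow> real"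
      using that by (intro Q.integrable_const_bound[of _ 3]) auto
    show "integrable Q (\<lambda>w. indicat_real C w * (1 + cos (s w)))"
      "integrable Q (\<lambda>w. indicat_real C w * (1 + sin (s w)))" "integrable Q (indicat_real C)"
      using ab3 by (auto intro!: ir simp: indicator_def)
  qed
  \<comment> \<open>The first two identities express the characteristic functions of the weights
    \<open>1 + cos S\<close> and \<open>1 + sin S\<close> through the given functional at
    \<open>b = 0, 1, -1\<close>; the third reassembles the complex integral from the three
    nonnegative weights.\<close>
  have gen: "(CLINT w|Q. (indicat_real C w * (1 + cos (s w))) *\<^sub>R iexp (a * u w))
        = (CLINT w|Q. indicat_real C w *\<^sub>R iexp (a * u w + 0 * s w))
          + (CLINT w|Q. indicat_real C w *\<^sub>R iexp (a * u w + 1 * s w)) / 2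
          + (CLINT w|Q. indicat_real C w *\<^sub>R iexp (a * u w + (-1) * s w)) / 2"
      "(CLINT w|Q. (indicat_real C w * (1 + sin (s w))) *\<^sub>R iexp (a * u w))
        = (CLINT w|Q. indicat_real C w *\<^sub>R iexp (a * u w + 0 * s w))
          + (CLINT w|Q. indicat_real C w *\<^sub>R iexp (a * u w + 1 * s w)) / (2 * \<i>)
          - (CLINT w|Q. indicat_real C w *\<^sub>R iexp (a * u w + (-1) * s w)) / (2 * \<i>)"
      "(CLINT w|Q. (indicat_real C w * indicat_real A (u w)) *\<^sub>R iexp (s w))
        = of_real (LINT w|Q. (indicat_real C w * (1 + cos (s w))) * indicat_real A (u w))
          + \<i> * of_real (LINT w|Q. (indicat_real C w * (1 + sin (s w))) * indicat_real A (u w))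
          - (1 + \<i>) * of_real (LINT w|Q. indicat_real C w * indicat_real A (u w))"
    if Q: "finite_measure Q" and [measurable]: "C \<in> sets Q" "u \<in> borel_measurable Q" "s \<in> borel_measurable Q"
    for Q :: "'c measure" and C u s a
  proof -
    interpret Q: finite_measure Q by fact
    have ic: "integrable Q f" if "f \<in> borel_measurable Q" "\<And>w. norm (f w) \<le> 3" for f :: "'c \<Rightarrow> complex"
      using that by (intro Q.integrable_const_bound[of _ 3]) auto
    have ir: "integrable Q f" if "f \<in> borel_measurable Q" "\<And>w. \<bar>f w\<bar> \<le> 3" for f :: "'c \<Rightarrow> real"
      using that by (intro Q.integrable_const_bound[of _ 3]) auto
    have i1: "integrable Q (\<lambda>w. indicat_real C w *\<^sub>R iexp (a * u w + b * s w))" for b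
      by (rule ic) (auto simp: indicator_def)
    have "(indicat_real C w * (1 + cos (s w))) *\<^sub>R iexp (a * u w)
       = indicat_real C w *\<^sub>R iexp (a * u w + 0 * s w) + (indicat_real C w *\<^sub>R iexp (a * u w + 1 * s w)) / 2
         + (indicat_real C w *\<^sub>R iexp (a * u w + (-1) * s w)) / 2" for w
      unfolding scaleR_conv_of_real ie[symmetric] unfolding of_real_mult of_real_add cosE mult_zero_left mult_1 mult_minus1
      by (simp add: field_simps del: mult_minus_right)
    then show "(CLINT w|Q. (indicat_real C w * (1 + cos (s w))) *\<^sub>R iexp (a * u w))
        = (CLINT w|Q. indicat_real C w *\<^sub>R iexp (a * u w + 0 * s w))
          + (CLINT w|Q. indicat_real C w *\<^sub>R iexp (a * u w + 1 * s w)) / 2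
          + (CLINT w|Q. indicat_real C w *\<^sub>R iexp (a * u w + (-1) * s w)) / 2"
      using i1[of 0] i1[of 1] i1[of "-1"] by (simp only: Bochner_Integration.integral_add
        integrable_divide integral_divide_zero Bochner_Integration.integrable_add)
    have "(indicat_real C w * (1 + sin (s w))) *\<^sub>R iexp (a * u w)
       = indicat_real C w *\<^sub>R iexp (a * u w + 0 * s w) + (indicat_real C w *\<^sub>R iexp (a * u w + 1 * s w)) / (2 * \<i>)
         - (indicat_real C w *\<^sub>R iexp (a * u w + (-1) * s w)) / (2 * \<i>)" for w
      unfolding scaleR_conv_of_real ie[symmetric] unfolding of_real_mult of_real_add sinE mult_zero_left mult_1 mult_minus1
      by (simp add: field_simps del: mult_minus_right)
    then show "(CLINT w|Q. (indicat_real C w * (1 + sin (s w))) *\<^sub>R iexp (a * u w))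
        = (CLINT w|Q. indicat_real C w *\<^sub>R iexp (a * u w + 0 * s w))
          + (CLINT w|Q. indicat_real C w *\<^sub>R iexp (a * u w + 1 * s w)) / (2 * \<i>)
          - (CLINT w|Q. indicat_real C w *\<^sub>R iexp (a * u w + (-1) * s w)) / (2 * \<i>)"
      using i1[of 0] i1[of 1] i1[of "-1"] by (simp only: Bochner_Integration.integral_add
        Bochner_Integration.integral_diff
        integrable_divide integral_divide_zero Bochner_Integration.integrable_add)
    have i2: "integrable Q (\<lambda>w. complex_of_real ((indicat_real C w * (1 + cos (s w))) * indicat_real A (u w)))"
      "integrable Q (\<lambda>w. complex_of_real ((indicat_real C w * (1 + sin (s w))) * indicat_real A (u w)))"
      "integrable Q (\<lambda>w. complex_of_real (indicat_real C w * indicat_real A (u w)))"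
      using ab3 by - (rule integrable_of_real, rule ir, measurable, simp add: indicator_def)+
    have "(indicat_real C w * indicat_real A (u w)) *\<^sub>R iexp (s w)
       = of_real ((indicat_real C w * (1 + cos (s w))) * indicat_real A (u w))
          + \<i> * of_real ((indicat_real C w * (1 + sin (s w))) * indicat_real A (u w))
          - (1 + \<i>) * of_real (indicat_real C w * indicat_real A (u w))" for w
      unfolding scaleR_conv_of_real exp_Euler[symmetric]
      by (simp add: indicator_def exp_Euler cos_of_real sin_of_real algebra_simps)
    then show "(CLINT w|Q. (indicat_real C w * indicat_real A (u w)) *\<^sub>R iexp (s w))
        = of_real (LINT w|Q. (indicat_real C w * (1 + cos (s w))) * indicat_real A (u w))
          + \<i> * of_real (LINT w|Q. (indicat_real C w * (1 + sin (s w))) * indicat_real A (u w))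
          - (1 + \<i>) * of_real (LINT w|Q. indicat_real C w * indicat_real A (u w))"
      using i2 by (simp only: Bochner_Integration.integral_add
        Bochner_Integration.integral_diff integrable_mult_right integral_mult_right_zero
        integral_complex_of_real Bochner_Integration.integrable_add)
  qed
  note g = gen[OF P(1) B(1) U(1) S(1)] and g' = gen[OF P(2) B(2) U(2) S(2)]
    and i = int[OF P(1) B(1) S(1)] and i' = int[OF P(2) B(2) S(2)]
  have "(LINT w|P. (indicat_real B w * (1 + cos (S w))) * indicat_real A (U w))
      = (LINT w|P'. (indicat_real B' w * (1 + cos (S' w))) * indicat_real A (U' w))"
    by (rule weighted_Levy_uniqueness[OF i(1) _ U(1) i'(1) _ U(2) _ A])
      (simp_all only: g(1) g'(1) eq, simp_all add: ab0)
  moreover have "(LINT w|P. (indicat_real B w * (1 + sin (S w))) * indicat_real A (U w))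
      = (LINT w|P'. (indicat_real B' w * (1 + sin (S' w))) * indicat_real A (U' w))"
    by (rule weighted_Levy_uniqueness[OF i(2) _ U(1) i'(2) _ U(2) _ A])
      (simp_all only: g(2) g'(2) eq, simp_all add: ab0)
  moreover have "(LINT w|P. indicat_real B w * indicat_real A (U w))
      = (LINT w|P'. indicat_real B' w * indicat_real A (U' w))"
    using eq[of _ 0] by (intro weighted_Levy_uniqueness[OF i(3) _ U(1) i'(3) _ U(2) _ A]) simp_all
  ultimately show ?thesis by (simp only: g(3) g'(3))
qed

text \<open>The initial sigma-algebra of the family \<open>e\<close>, whose index type may be
  uncountable. Written as a pull-back of the product sigma-algebra, it inherits uniqueness of
  measures from finite-dimensional rectangles.\<close>

definition coordinate_algebra :: "('i \<Rightarrow> 'a \<Rightarrow> real) \<Rightarrow> 'a measure" where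
  "coordinate_algebra e = vimage_algebra UNIV (\<lambda>x i. e i x) (\<Pi>\<^sub>M i\<in>UNIV. borel)"

lemma space_coordinate_algebra [simp]: "space (coordinate_algebra e) = UNIV"
  by (simp add: coordinate_algebra_def)

lemma measurable_to_coordinate_algebra:
  assumes "\<And>i. (\<lambda>w. e i (f w)) \<in> borel_measurable N"
  shows "f \<in> measurable N (coordinate_algebra e)"
  unfolding coordinate_algebra_def
  by (rule measurable_vimage_algebra2) (use assms in \<open>auto intro!: measurable_PiM_single'\<close>)

lemma measurable_coordinate: "e i \<in> borel_measurable (coordinate_algebra e)"
proof -
  have "(\<lambda>x i. e i x) \<in> measurable (coordinate_algebra e) (\<Pi>\<^sub>M i\<in>UNIV. borel)"
    unfolding coordinate_algebra_def by (rule measurable_vimage_algebra1) (auto simp: space_PiM)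
  from measurable_compose[OF this measurable_component_singleton[of i]] show ?thesis by simp
qed

text \<open>Induction over the coordinates turns exponential factors into indicators one at a time.
  This yields equal probabilities of finite-dimensional rectangles, which determine a finite measure
  on the product and hence on the pulled-back sigma-algebra.\<close>

lemma distr_coordinate_algebra_eqI:
  fixes e :: "'i \<Rightarrow> 'a \<Rightarrow> real"
  assumes P: "prob_space P" "prob_space P'"
    and f: "\<And>i. (\<lambda>w. e i (f w)) \<in> borel_measurable P"
    and f': "\<And>i. (\<lambda>w. e i (f' w)) \<in> borel_measurable P'"
    and eq: "\<And>J c. finite J \<Longrightarrow> (CLINT w|P. iexp (\<Sum>j\<in>J. c j * e j (f w)))
                = (CLINT w|P'. iexp (\<Sum>j\<in>J. c j * e j (f' w)))"
  shows "distr P (coordinate_algebra e) f = distr P' (coordinate_algebra e) f'"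
proof -
  interpret P: prob_space P by fact
  interpret P': prob_space P' by fact
  have [measurable]: "(\<lambda>w. e i (f w)) \<in> borel_measurable P" "(\<lambda>w. e i (f' w)) \<in> borel_measurable P'" for i
    using f f' by auto
  define V where "V i w = e i (f w)" for i w
  define V' where "V' i w = e i (f' w)" for i w
  have V[measurable]: "V i \<in> borel_measurable P" "V' i \<in> borel_measurable P'" for i
    unfolding V_def V'_def by auto
  define B where "B J A = {w\<in>space P. \<forall>j\<in>J. V j w \<in> A j}" for J A
  define B' where "B' J A = {w\<in>space P'. \<forall>j\<in>J. V' j w \<in> A j}" for J A
  \<comment> \<open>An arbitrary linear combination stays in the exponent, because the induction
    step spends the frequency of one coordinate on its indicator and must leave all the others
    free.\<close>
  have main: "\<forall>L c. finite L \<longrightarrow> (CLINT w|P. indicat_real (B J A) w *\<^sub>R iexp (\<Sum>l\<in>L. c l * V l w))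
       = (CLINT w|P'. indicat_real (B' J A) w *\<^sub>R iexp (\<Sum>l\<in>L. c l * V' l w))"
    if "finite J" and A[measurable]: "\<And>j. A j \<in> sets borel" for J and A :: "'i \<Rightarrow> real set"
    using \<open>finite J\<close>
  proof (induction J)
    case empty
    have "(CLINT w|P. indicat_real (B {} A) w *\<^sub>R iexp (\<Sum>l\<in>L. c l * V l w))
         = (CLINT w|P. iexp (\<Sum>l\<in>L. c l * V l w))" for L c
      by (intro Bochner_Integration.integral_cong) (auto simp: B_def)
    moreover have "(CLINT w|P'. indicat_real (B' {} A) w *\<^sub>R iexp (\<Sum>l\<in>L. c l * V' l w))
         = (CLINT w|P'. iexp (\<Sum>l\<in>L. c l * V' l w))" for L c
      by (intro Bochner_Integration.integral_cong) (auto simp: B'_def)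
    ultimately show ?case using eq unfolding V_def V'_def by simp
  next
    case (insert j J)
    show ?case
    proof (intro allI impI)
      fix L :: "'i set" and c assume L: "finite L"
      have BJ: "B J A \<in> sets P" "B' J A \<in> sets P'"
        unfolding B_def B'_def using \<open>finite J\<close> by measurable
      \<comment> \<open>\<open>j\<close> may already occur in \<open>L\<close>; its two coefficients
        are then added.\<close>
      have lin: "a * W j + b * (\<Sum>l\<in>L. c l * W l)
          = (\<Sum>l\<in>insert j L. ((if l = j then a else 0) + (if l \<in> L then b * c l else 0)) * W l)"
        for a b and W :: "'i \<Rightarrow> real"
      proof -
        have 1: "(\<Sum>l\<in>insert j L. (if l = j then a else 0) * W l) = (\<Sum>l\<in>{j}. a * W l)"
          using L by (intro sum.mono_neutral_cong_right) auto
        have 2: "(\<Sum>l\<in>insert j L. (if l \<in> L then b * c l else 0) * W l) = (\<Sum>l\<in>L. b * (c l * W l))"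
          using L by (intro sum.mono_neutral_cong_right) auto
        show ?thesis by (simp only: distrib_right sum.distrib 1 2 sum_distrib_left) simp
      qed
      have lV: "a * V j w + b * (\<Sum>l\<in>L. c l * V l w)
          = (\<Sum>l\<in>insert j L. ((if l = j then a else 0) + (if l \<in> L then b * c l else 0)) * V l w)" for a b w
        by (rule lin)
      have lV': "a * V' j w + b * (\<Sum>l\<in>L. c l * V' l w)
          = (\<Sum>l\<in>insert j L. ((if l = j then a else 0) + (if l \<in> L then b * c l else 0)) * V' l w)" for a b w
        by (rule lin)
      have "(CLINT w|P. (indicat_real (B J A) w * indicat_real (A j) (V j w)) *\<^sub>R iexp (\<Sum>l\<in>L. c l * V l w))
          = (CLINT w|P'. (indicat_real (B' J A) w * indicat_real (A j) (V' j w)) *\<^sub>R iexp (\<Sum>l\<in>L. c l * V' l w))"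
        by (intro char_replace_coordinate BJ V A P.finite_measure_axioms P'.finite_measure_axioms
              borel_measurable_sum borel_measurable_times borel_measurable_const)
          
            (unfold lV lV', rule insert.IH[rule_format], simp add: L)
      moreover have "indicat_real (B J A) w * indicat_real (A j) (V j w) = indicat_real (B (insert j J) A) w" for w
        by (auto simp: B_def indicator_def)
      moreover have "indicat_real (B' J A) w * indicat_real (A j) (V' j w) = indicat_real (B' (insert j J) A) w" for w
        by (auto simp: B'_def indicator_def)
      ultimately show "(CLINT w|P. indicat_real (B (insert j J) A) w *\<^sub>R iexp (\<Sum>l\<in>L. c l * V l w))
        = (CLINT w|P'. indicat_real (B' (insert j J) A) w *\<^sub>R iexp (\<Sum>l\<in>L. c l * V' l w))"
        by simp
    qed
  qed
  have rect: "emeasure P (B J A) = emeasure P' (B' J A)"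
    if J: "finite J" and A: "\<And>j. j \<in> J \<Longrightarrow> A j \<in> sets borel" for J and A :: "'i \<Rightarrow> real set"
  proof -
    \<comment> \<open>\<open>main\<close> asks for a Borel set at every index, whereas
      \<open>A\<close> is known to be Borel on \<open>J\<close> only; the empty set fills the other
      indices.\<close>
    define A' where "A' j = (if j \<in> J then A j else {})" for j
    have A'[measurable]: "A' j \<in> sets borel" for j using A by (auto simp: A'_def)
    have BB: "B J A = B J A'" "B' J A = B' J A'" by (auto simp: B_def B'_def A'_def)
    have s: "B J A' \<in> sets P" "B' J A' \<in> sets P'"
      unfolding B_def B'_def using J by measurable
    have "complex_of_real (LINT w|P. indicat_real (B J A') w) = of_real (LINT w|P'. indicat_real (B' J A') w)"
      using main[OF J A', rule_format, of "{}"] unfolding integral_complex_of_real[symmetric] scaleR_conv_of_real by simp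
    then have "measure P (B J A') = measure P' (B' J A')"
      using s by (simp only: of_real_eq_iff integral_indicator) (simp add: P.emeasure_eq_measure P'.emeasure_eq_measure)
    then show ?thesis by (simp add: BB P.emeasure_eq_measure P'.emeasure_eq_measure)
  qed
  have mP: "(\<lambda>w i. V i w) \<in> measurable P (\<Pi>\<^sub>M i\<in>UNIV. borel)" "(\<lambda>w i. V' i w) \<in> measurable P' (\<Pi>\<^sub>M i\<in>UNIV. borel)"
    by (auto intro!: measurable_PiM_single')
  have "distr P (\<Pi>\<^sub>M i\<in>UNIV. borel) (\<lambda>w i. V i w) = distr P' (\<Pi>\<^sub>M i\<in>UNIV. borel) (\<lambda>w i. V' i w)"
  proof (rule measure_eqI_PiM_infinite)
    show "finite_measure (distr P (\<Pi>\<^sub>M i\<in>UNIV. borel) (\<lambda>w i. V i w))"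
      by (rule P.finite_measure_distr[OF mP(1)])
    fix A :: "'i \<Rightarrow> real set" and J :: "'i set"
    assume J: "finite J" "J \<subseteq> UNIV" and A: "\<And>i. i \<in> J \<Longrightarrow> A i \<in> sets borel"
    have s: "prod_emb UNIV (\<lambda>i. borel) J (Pi\<^sub>E J A) \<in> sets (\<Pi>\<^sub>M i\<in>UNIV. borel)"
      using J A by (intro sets_PiM_I) auto
    have "(\<lambda>w i. V i w) -` prod_emb UNIV (\<lambda>i. borel) J (Pi\<^sub>E J A) \<inter> space P = B J A"
      "(\<lambda>w i. V' i w) -` prod_emb UNIV (\<lambda>i. borel) J (Pi\<^sub>E J A) \<inter> space P' = B' J A"
      by (auto simp: prod_emb_def B_def B'_def PiE_iff)
    then show "emeasure (distr P (\<Pi>\<^sub>M i\<in>UNIV. borel) (\<lambda>w i. V i w)) (prod_emb UNIV (\<lambda>i. borel) J (Pi\<^sub>E J A))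
       = emeasure (distr P' (\<Pi>\<^sub>M i\<in>UNIV. borel) (\<lambda>w i. V' i w)) (prod_emb UNIV (\<lambda>i. borel) J (Pi\<^sub>E J A))"
      using s mP rect[OF J(1) A] by (simp add: emeasure_distr)
  qed auto
  note law = this
  have fm: "f \<in> measurable P (coordinate_algebra e)" "f' \<in> measurable P' (coordinate_algebra e)"
    by (auto intro!: measurable_to_coordinate_algebra)
  show ?thesis
  proof (rule measure_eqI)
    fix S assume "S \<in> sets (distr P (coordinate_algebra e) f)"
    then have S: "S \<in> sets (coordinate_algebra e)" by simp
    then obtain C where C: "C \<in> sets (\<Pi>\<^sub>M i\<in>UNIV. borel)" "S = (\<lambda>x i. e i x) -` C"
      unfolding coordinate_algebra_def by (subst (asm) sets_vimage_algebra2) (auto simp: space_PiM)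
    have "emeasure (distr P (coordinate_algebra e) f) S = emeasure (distr P (\<Pi>\<^sub>M i\<in>UNIV. borel) (\<lambda>w i. V i w)) C"
      using fm S mP C by (simp add: emeasure_distr V_def vimage_def)
    also have "\<dots> = emeasure (distr P' (coordinate_algebra e) f') S"
      unfolding law using fm S mP C by (simp add: emeasure_distr V'_def vimage_def)
    finally show "emeasure (distr P (coordinate_algebra e) f) S = emeasure (distr P' (coordinate_algebra e) f') S" .
  qed simp
qed

section \<open>Continuous functions and measures on compact metric spaces\<close>

text \<open>Each point is sent to the first point of a finite net at distance below
  \<open>\<delta>\<close>. Taking the least index makes the choice measurable.\<close>

lemma compact_discretization:
  assumes K: "compact (UNIV :: 'k::metric_space set)" and "\<delta> > 0"
  shows "\<exists>p :: 'k \<Rightarrow> 'k. p \<in> measurable borel (count_space UNIV) \<and> finite (range p) \<and> (\<forall>t. dist (p t) t < \<delta>)"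
proof -
  obtain C :: "'k set" where C: "finite C" "UNIV \<subseteq> (\<Union>c\<in>C. ball c \<delta>)"
    by (rule compactE_image[OF K, of UNIV "\<lambda>c. ball c \<delta>"]) (use \<open>\<delta> > 0\<close> in auto)
  obtain xs where xs: "set xs = C" using finite_list[OF C(1)] by blast
  define p where "p t = xs ! (LEAST i. i < length xs \<and> dist (xs ! i) t < \<delta>)" for t
  have L: "(LEAST i. i < length xs \<and> dist (xs ! i) t < \<delta>) < length xs \<and> dist (xs ! (LEAST i. i < length xs \<and> dist (xs ! i) t < \<delta>)) t < \<delta>" for t
  proof (rule LeastI_ex)
    have "t \<in> (\<Union>c\<in>C. ball c \<delta>)" using C(2) by blast
    then obtain c where "c \<in> set xs" "dist c t < \<delta>" using xs by auto
    then show "\<exists>i<length xs. dist (xs ! i) t < \<delta>" by (auto simp: in_set_conv_nth)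
  qed
  have [measurable]: "(\<lambda>t. dist (xs ! i) t) \<in> borel_measurable borel" for i
    by (intro borel_measurable_continuous_onI continuous_intros)
  have "p \<in> measurable borel (count_space UNIV)"
    unfolding p_def by measurable
  moreover have "range p \<subseteq> set xs" using L by (auto simp: p_def)
  then have "finite (range p)" using finite_subset by blast
  ultimately show ?thesis using L by (auto simp: p_def)
qed

lemma compact_discretizations:
  assumes K: "compact (UNIV :: 'k::metric_space set)"
  obtains p :: "nat \<Rightarrow> 'k::metric_space \<Rightarrow> 'k" where
    "\<And>n. p n \<in> measurable borel (count_space UNIV)" "\<And>n. finite (range (p n))"
    "\<And>t. (\<lambda>n. p n t) \<longlonglongrightarrow> t"
proof -
  have "\<forall>n. \<exists>p :: 'k \<Rightarrow> 'k. p \<in> measurable borel (count_space UNIV) \<and> finite (range p) \<and> (\<forall>t. dist (p t) t < 1 / real (Suc n))"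
    using compact_discretization[OF K] by simp
  then obtain p :: "nat \<Rightarrow> 'k \<Rightarrow> 'k" where p: "\<And>n. p n \<in> measurable borel (count_space UNIV)"
      "\<And>n. finite (range (p n))" "\<And>n t. dist (p n t) t < 1 / real (Suc n)"
    by metis
  have "(\<lambda>n. p n t) \<longlonglongrightarrow> t" for t
  proof (rule metric_tendsto_imp_tendsto)
    show "(\<lambda>n. 1 / real (Suc n)) \<longlonglongrightarrow> 0" by real_asymp
    show "\<forall>\<^sub>F n in sequentially. dist (p n t) t \<le> dist (1 / real (Suc n)) 0"
      using p(3) by (auto simp: less_imp_le)
  qed
  with p that show ?thesis by blast
qed

lemma compact_countable_dense:
  assumes K: "compact (UNIV :: 'k::metric_space set)"
  obtains D :: "'k::metric_space set" where "countable D" "closure D = UNIV"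
proof -
  obtain p :: "nat \<Rightarrow> 'k \<Rightarrow> 'k" where p: "\<And>n. p n \<in> measurable borel (count_space UNIV)"
      "\<And>n. finite (range (p n))" "\<And>t. (\<lambda>n. p n t) \<longlonglongrightarrow> t"
    by (rule compact_discretizations[OF K]) blast
  show ?thesis
  proof
    show "countable (\<Union>n. range (p n))" using p(2) by (auto intro: countable_finite)
    have "t \<in> closure (\<Union>n. range (p n))" for t
      unfolding closure_sequential using p(3)[of t] by (intro exI[of _ "\<lambda>n. p n t"]) auto
    then show "closure (\<Union>n. range (p n)) = UNIV" by blast
  qed
qed

text \<open>After rounding \<open>t\<close> to finitely many values the function is patched together
  from finitely many measurable sections. Continuity in \<open>t\<close> makes it the pointwise
  limit of these roundings.\<close>

lemma caratheodory_measurable: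
  fixes f :: "'k::metric_space \<Rightarrow> 'w \<Rightarrow> real"
  assumes K: "compact (UNIV :: 'k set)"
    and cont: "\<And>w. w \<in> space N \<Longrightarrow> continuous_on UNIV (\<lambda>t. f t w)"
    and [measurable]: "\<And>t. f t \<in> borel_measurable N"
  shows "(\<lambda>(t, w). f t w) \<in> borel_measurable (borel \<Otimes>\<^sub>M N)"
proof -
  obtain p :: "nat \<Rightarrow> 'k \<Rightarrow> 'k" where p: "\<And>n. p n \<in> measurable borel (count_space UNIV)"
      "\<And>n. finite (range (p n))" "\<And>t. (\<lambda>n. p n t) \<longlonglongrightarrow> t"
    by (rule compact_discretizations[OF K]) blast
  have pr: "p n \<in> measurable borel (count_space (range (p n)))" for n
    using p(1)[of n] by (auto simp: measurable_def)
  show ?thesis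
  proof (rule borel_measurable_LIMSEQ_real)
    fix x assume "x \<in> space (borel \<Otimes>\<^sub>M N :: ('k \<times> 'w) measure)"
    then have "snd x \<in> space N" by (auto simp: space_pair_measure)
    from cont[OF this] have "(\<lambda>n. f (p n (fst x)) (snd x)) \<longlonglongrightarrow> f (fst x) (snd x)"
      using p(3)[of "fst x"] isCont_tendsto_compose[where g = "\<lambda>t. f t (snd x)"]
      by (auto simp: continuous_on_eq_continuous_at)
    then show "(\<lambda>n. (\<lambda>(t, w). f (p n t) w) x) \<longlonglongrightarrow> (\<lambda>(t, w). f t w) x" by (simp add: case_prod_beta)
  next
    fix n
    have "(\<lambda>x. f (p n (fst x)) (snd x)) \<in> borel_measurable (borel \<Otimes>\<^sub>M N)"
      using p(2) by (intro measurable_compose_countable'[where f = "\<lambda>i x. f i (snd x)"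
          and g = "\<lambda>x. p n (fst x)" and I = "range (p n)"] measurable_compose[OF measurable_fst pr] countable_finite) auto
    then show "(\<lambda>(t, w). f (p n t) w) \<in> borel_measurable (borel \<Otimes>\<^sub>M N)"
      by (simp add: case_prod_beta)
  qed
qed

section \<open>Norm and minimum of a path through countably many evaluations\<close>

lemma continuous_le_iff_dense:
  fixes f :: "'k::topological_space \<Rightarrow> real"
  assumes "closure D = UNIV" "continuous_on UNIV f"
  shows "(\<forall>t. f t \<le> a) \<longleftrightarrow> (\<forall>d\<in>D. f d \<le> a)"
  using continuous_le_on_closure[of D f _ a] assms by auto

lemma norm_bcontfun_le_iff:
  fixes x :: "'k::topological_space \<Rightarrow>\<^sub>C real"
  shows "norm x \<le> a \<longleftrightarrow> (\<forall>t. \<bar>apply_bcontfun x t\<bar> \<le> a)"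
  using norm_bound[of x a] norm_bounded[of x] by (auto intro: order_trans)

lemma bdd_below_bcontfun: "bdd_below (range (apply_bcontfun (x :: 'k::topological_space \<Rightarrow>\<^sub>C real)))"
  by (rule bounded_imp_bdd_below) simp

lemma path_min_ge_iff: "a \<le> path_min x \<longleftrightarrow> (\<forall>t. a \<le> apply_bcontfun x t)"
  unfolding path_min_def by (subst le_cINF_iff) (auto simp: bdd_below_bcontfun)

lemma path_min_le: "path_min x \<le> apply_bcontfun x t"
  using path_min_ge_iff by blast

lemma abs_path_min_le: "\<bar>path_min (x :: 'k::topological_space \<Rightarrow>\<^sub>C real)\<bar> \<le> norm x"
proof -
  have *: "- norm x \<le> apply_bcontfun x t \<and> apply_bcontfun x t \<le> norm x" for t
    using norm_bounded[of x t] by (auto simp: abs_le_iff)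
  then have "- norm x \<le> path_min x" unfolding path_min_ge_iff by blast
  moreover have "path_min x \<le> norm x" using path_min_le[of x undefined] *[of undefined] by linarith
  ultimately show ?thesis by auto
qed

lemma path_min_eq:
  assumes "is_arg_min (apply_bcontfun x) (\<lambda>t. True) t"
  shows "path_min x = apply_bcontfun x t"
  using assms path_min_le[of x t] path_min_ge_iff[of "apply_bcontfun x t" x]
  by (auto simp: is_arg_min_def not_less intro!: antisym)

text \<open>By continuity, \<open>norm (f w) \<le> a\<close> amounts to countably many conditions on
  evaluations. Measurable evaluations therefore suffice, which covers the coordinate sigma-algebra
  as well as the original probability space.\<close>

lemma norm_coordinate_measurable:
  assumes K: "compact (UNIV :: 'k::metric_space set)"
    and [measurable]: "\<And>t. (\<lambda>w. apply_bcontfun (f w) t) \<in> borel_measurable N"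
  shows "(\<lambda>w. norm (f w :: 'k \<Rightarrow>\<^sub>C real)) \<in> borel_measurable N"
proof -
  obtain D :: "'k set" where D: "countable D" "closure D = UNIV"
    using compact_countable_dense[OF K] .
  have "norm x \<le> a \<longleftrightarrow> (\<forall>d\<in>D. \<bar>apply_bcontfun x d\<bar> \<le> a)" for x :: "'k \<Rightarrow>\<^sub>C real" and a
    unfolding norm_bcontfun_le_iff
    by (intro continuous_le_iff_dense D continuous_intros) simp
  then show ?thesis unfolding borel_measurable_iff_le using D(1)
    by (simp add: sets.sets_Collect_countable_Ball)
qed

lemma path_min_coordinate_measurable:
  assumes K: "compact (UNIV :: 'k::metric_space set)"
    and [measurable]: "\<And>t. (\<lambda>w. apply_bcontfun (f w) t) \<in> borel_measurable N"
  shows "(\<lambda>w. path_min (f w :: 'k \<Rightarrow>\<^sub>C real)) \<in> borel_measurable N"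
proof -
  obtain D :: "'k set" where D: "countable D" "closure D = UNIV"
    using compact_countable_dense[OF K] .
  have "a \<le> path_min x \<longleftrightarrow> (\<forall>d\<in>D. a \<le> apply_bcontfun x d)" for x :: "'k \<Rightarrow>\<^sub>C real" and a
    using continuous_le_iff_dense[OF D(2), of "\<lambda>t. - apply_bcontfun x t" "- a"]
    unfolding path_min_ge_iff by (auto intro!: continuous_intros)
  then show ?thesis unfolding borel_measurable_iff_ge using D(1)
    by (simp add: sets.sets_Collect_countable_Ball)
qed

section \<open>Weak sequential compactness through a code into the real line\<close>

lemma measurable_suminf_indicator:
  assumes "\<And>i. U i \<in> sets N"
  shows "(\<lambda>t. \<Sum>i. (1/3 :: real) ^ i * indicator (U i) t) \<in> borel_measurable N"
  using assms by measurable

text \<open>If \<open>j \<le> n\<close> were the first nonzero digit, it would contribute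
  \<open>(1/3) ^ j\<close> in absolute value, while all later digits together contribute at most
  half of that. Base three suits digits in \<open>{-1, 0, 1}\<close>, the differences of zeros and
  ones: in base two the tail could cancel the leading digit.\<close>

lemma ternary_digits_agree:
  fixes a :: "nat \<Rightarrow> real"
  assumes a: "\<And>i. a i \<in> {-1, 0, 1}" and small: "\<bar>\<Sum>i. (1/3) ^ i * a i\<bar> < (1/3) ^ n / 2" and "i \<le> n"
  shows "a i = 0"
proof (rule ccontr)
  assume "a i \<noteq> 0"
  define j where "j = (LEAST i. a i \<noteq> 0)"
  have aj: "a j \<noteq> 0" unfolding j_def using \<open>a i \<noteq> 0\<close> by (rule LeastI)
  have jn: "j \<le> n" unfolding j_def using Least_le[of "\<lambda>i. a i \<noteq> 0", OF \<open>a i \<noteq> 0\<close>] \<open>i \<le> n\<close> by linarith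
  have less: "a m = 0" if "m < j" for m using not_less_Least[of m "\<lambda>i. a i \<noteq> 0"] that by (auto simp: j_def)
  have a1: "\<bar>a m\<bar> \<le> 1" for m using a[of m] by auto
  have sg: "summable (\<lambda>m. (1/3 :: real) ^ m)" by (simp add: summable_geometric)
  have s: "summable (\<lambda>m. (1/3) ^ m * a m)"
    by (rule summable_comparison_test'[OF sg, of 0]) (use a1 in \<open>auto simp: abs_mult intro!: mult_left_le\<close>)
  have "(\<Sum>m. (1/3) ^ m * a m) = (\<Sum>m. (1/3) ^ (m + Suc j) * a (m + Suc j)) + (\<Sum>m<Suc j. (1/3) ^ m * a m)"
    by (rule suminf_split_initial_segment[OF s])
  also have "(\<Sum>m<Suc j. (1/3) ^ m * a m) = (1/3) ^ j * a j"
    using less by simp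
  finally have eq: "(\<Sum>m. (1/3) ^ m * a m) = (\<Sum>m. (1/3) ^ (m + Suc j) * a (m + Suc j)) + (1/3) ^ j * a j" .
  have st: "summable (\<lambda>m. (1/3) ^ (m + Suc j) * a (m + Suc j))"
    using summable_iff_shift[of "\<lambda>m. (1/3) ^ m * a m" "Suc j"] s by blast
  have sb: "summable (\<lambda>m. (1/3 :: real) ^ (m + Suc j))"
    using summable_iff_shift[of "\<lambda>m. (1/3 :: real) ^ m" "Suc j"] sg by blast
  define t where "t = (\<Sum>m. (1/3) ^ (m + Suc j) * a (m + Suc j))"
  define q where "q = (1/3 :: real) ^ j"
  have "norm t \<le> (\<Sum>m. (1/3 :: real) ^ (m + Suc j))"
    unfolding t_def by (rule norm_suminf_le[OF _ sb]) (use a1 in \<open>auto simp: abs_mult intro!: mult_left_le\<close>)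
  also have "\<dots> = (\<Sum>m. (1/3 :: real) ^ m * (1/3) ^ Suc j)" by (simp only: power_add)
  also have "\<dots> = (\<Sum>m. (1/3 :: real) ^ m) * (1/3) ^ Suc j" by (rule suminf_mult2[symmetric, OF sg])
  also have "\<dots> = q / 2" by (simp add: suminf_geometric q_def)
  finally have "\<bar>t\<bar> \<le> q / 2" by simp
  moreover have "\<bar>q * a j\<bar> = q" using a[of j] aj by (auto simp: q_def abs_mult)
  moreover have "(1/3 :: real) ^ n \<le> q" unfolding q_def using jn by (intro power_decreasing) auto
  ultimately show False using small unfolding eq t_def[symmetric] q_def[symmetric] by linarith
qed

text \<open>The ternary digits of \<open>s t\<close> record in which of countably many sets
  \<open>t\<close> lies; these are the cells of finite partitions whose mesh tends to zero. Nearby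
  codes share their first digits, hence the cell of a fine partition, so the inverse of
  \<open>s\<close> is uniformly continuous although \<open>s\<close> itself is only claimed to be
  measurable.\<close>

lemma ternary_code:
  assumes K: "compact (UNIV :: 'k::metric_space set)"
  obtains s :: "'k::metric_space \<Rightarrow> real" where "s \<in> borel_measurable borel" "\<And>t. 0 \<le> s t" "\<And>t. s t \<le> 2"
    "\<And>\<delta>. \<delta> > 0 \<Longrightarrow> \<exists>\<gamma>>0. \<forall>t t'. \<bar>s t - s t'\<bar> < \<gamma> \<longrightarrow> dist t t' < \<delta>"
proof -
  have "\<forall>n. \<exists>p :: 'k \<Rightarrow> 'k. p \<in> measurable borel (count_space UNIV) \<and> finite (range p) \<and> (\<forall>t. dist (p t) t < 1 / real (Suc n))"
    using compact_discretization[OF K] by simp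
  then obtain p :: "nat \<Rightarrow> 'k \<Rightarrow> 'k" where p: "\<And>n. p n \<in> measurable borel (count_space UNIV)"
      "\<And>n. finite (range (p n))" "\<And>n t. dist (p n t) t < 1 / real (Suc n)"
    by metis
  define B where "B m = (\<lambda>x. p m -` {x}) ` range (p m)" for m
  define U where "U = from_nat_into (\<Union>m. B m)"
  have cB: "countable (\<Union>m. B m)" unfolding B_def using p(2) by (auto intro: countable_finite)
  have neB: "(\<Union>m. B m) \<noteq> {}" by (auto simp: B_def)
  have rU: "range U = (\<Union>m. B m)" unfolding U_def using neB cB by (rule range_from_nat_into)
  have Us[measurable]: "U i \<in> sets borel" for i
  proof -
    have "U i \<in> (\<Union>m. B m)" using rU by blast
    then obtain m x where "U i = p m -` {x}" by (auto simp: B_def)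
    then show ?thesis using measurable_sets[OF p(1)[of m], of "{x}"] by simp
  qed
  define s where "s t = (\<Sum>i. (1/3 :: real) ^ i * indicator (U i) t)" for t
  have sg: "summable (\<lambda>m. (1/3 :: real) ^ m)" by (simp add: summable_geometric)
  have ss: "summable (\<lambda>i. (1/3 :: real) ^ i * indicator (U i) t)" for t
    by (rule summable_comparison_test'[OF sg, of 0]) (auto simp: indicator_def)
  show ?thesis
  proof (rule that)
    show "s \<in> borel_measurable borel" unfolding s_def[abs_def] by (rule measurable_suminf_indicator) measurable
    show "0 \<le> s t" for t unfolding s_def by (rule suminf_nonneg[OF ss]) simp
    have "s t \<le> (\<Sum>i. (1/3) ^ i)" for t unfolding s_def by (rule suminf_le[OF _ ss sg]) (simp add: indicator_def)
    then show "s t \<le> 2" for t using order_trans[of "s t" "3/2" 2] by (simp add: suminf_geometric)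
    fix \<delta> :: real assume "\<delta> > 0"
    \<comment> \<open>Two points with the same value of \<open>p m\<close> are closer than
      \<open>2 / (m + 1)\<close>.\<close>
    then obtain m where m: "2 / real (Suc m) < \<delta>"
      using reals_Archimedean[of "\<delta> / 2"] by (auto simp: field_simps)
    have "finite (B m)" unfolding B_def using p(2) by simp
    moreover have "B m \<subseteq> range U" using rU by auto
    ultimately obtain I where I: "finite I" "B m = U ` I" by (metis finite_subset_image subset_UNIV)
    \<comment> \<open>All cells of partition \<open>m\<close> occur among the digits up to
      \<open>n\<close>; inserting \<open>0\<close> keeps the set under \<open>Max\<close>
      nonempty.\<close>
    define n where "n = Max (insert 0 I)"
    have In: "i \<le> n" if "i \<in> I" for i unfolding n_def using I(1) that by (intro Max_ge) auto
    have "dist t t' < \<delta>" if close: "\<bar>s t - s t'\<bar> < (1/3) ^ n / 2" for t t'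
    proof -
      define a where "a i = (indicator (U i) t - indicator (U i) t' :: real)" for i
      have "s t - s t' = (\<Sum>i. (1/3) ^ i * a i)"
        unfolding s_def a_def right_diff_distrib by (rule suminf_diff[OF ss ss])
      then have a0: "a i = 0" if "i \<le> n" for i
        using close that by (intro ternary_digits_agree[of a n]) (auto simp: a_def indicator_def)
      have "p m -` {p m t} \<in> B m" by (auto simp: B_def)
      then obtain i where i: "i \<in> I" "U i = p m -` {p m t}" using I(2) by auto
      then have "t' \<in> U i" using a0[OF In[OF i(1)]] by (auto simp: a_def indicator_def split: if_splits)
      then have "p m t' = p m t" using i by simp
      then have "dist t t' < 1 / real (Suc m) + 1 / real (Suc m)"
        using p(3)[of m t] p(3)[of m t'] dist_triangle[of t t' "p m t"] by (simp add: dist_commute del: of_nat_Suc)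
      then show ?thesis using m by (simp del: of_nat_Suc)
    qed
    then show "\<exists>\<gamma>>0. \<forall>t t'. \<bar>s t - s t'\<bar> < \<gamma> \<longrightarrow> dist t t' < \<delta>"
      by (intro exI[of _ "(1/3) ^ n / 2"]) auto
  qed
qed

text \<open>Helly's selection theorem on the line, transported along a measurable code \<open>s\<close> of \<open>K\<close> whose inverse
  is uniformly continuous and therefore extends to the closure of the range of \<open>s\<close>.\<close>

lemma prob_measures_convergent_subsequence:
  fixes \<mu>s :: "nat \<Rightarrow> 'k::metric_space measure"
  assumes K: "compact (UNIV :: 'k set)" and \<mu>s: "\<And>n. \<mu>s n \<in> prob_measures"
  obtains r \<mu> where "strict_mono (r :: nat \<Rightarrow> nat)" "\<mu> \<in> prob_measures" "weak_conv_to (\<mu>s \<circ> r) \<mu> sequentially"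
proof -
  obtain s :: "'k \<Rightarrow> real" where s[measurable]: "s \<in> borel_measurable borel" and s01: "\<And>t. 0 \<le> s t" "\<And>t. s t \<le> 2"
    and uc: "\<And>\<delta>. \<delta> > 0 \<Longrightarrow> \<exists>\<gamma>>0. \<forall>t t'. \<bar>s t - s t'\<bar> < \<gamma> \<longrightarrow> dist t t' < \<delta>"
    by (rule ternary_code[OF K]) blast
  have ps: "prob_space (\<mu>s n)" and sets_\<mu>s[measurable_cong]: "sets (\<mu>s n) = sets borel" for n
    using \<mu>s[of n] by (auto simp: prob_measures_def)
  define S where "S = closure (range s)"
  have closedS: "closed S" and neS: "S \<noteq> {}" by (auto simp: S_def)
  \<comment> \<open>By compactness of \<open>K\<close>, every point of \<open>S\<close> is a limit
    of codes of a convergent sequence of points; the limit of that sequence becomes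
    \<open>\<phi> c\<close>.\<close>
  have "\<exists>t x. (\<lambda>n. s (x n)) \<longlonglongrightarrow> c \<and> x \<longlonglongrightarrow> t" if "c \<in> S" for c
  proof -
    have "\<exists>y. (\<forall>n. y n \<in> range s) \<and> y \<longlonglongrightarrow> c"
      using that unfolding S_def closure_sequential .
    then obtain y where y: "\<forall>n. y n \<in> range s" "y \<longlonglongrightarrow> c" by (elim exE conjE)
    have "\<forall>n. \<exists>t. y n = s t" using y(1) by auto
    then obtain x where x: "\<And>n. y n = s (x n)" unfolding choice_iff by (elim exE) (rule, rule spec)
    have "seq_compact (UNIV :: 'k set)" using K by (simp add: compact_eq_seq_compact_metric)
    then obtain t r where r: "strict_mono r" "(x \<circ> r) \<longlonglongrightarrow> t"
      by (rule seq_compactE[of UNIV x]) auto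
    have "(\<lambda>n. s ((x \<circ> r) n)) \<longlonglongrightarrow> c"
      using LIMSEQ_subseq_LIMSEQ[OF y(2) r(1)] by (simp add: o_def x)
    then show ?thesis using r(2) by blast
  qed
  then obtain \<phi> x where \<phi>: "\<And>c. c \<in> S \<Longrightarrow> (\<lambda>n. s (x c n)) \<longlonglongrightarrow> c" "\<And>c. c \<in> S \<Longrightarrow> x c \<longlonglongrightarrow> \<phi> c"
    by metis
  \<comment> \<open>The uniform continuity of the inverse code passes to limits. This is used twice:
    for the continuity of \<open>\<phi>\<close> and, with a constant sequence, for
    \<open>\<phi> (s t) = t\<close>.\<close>
  have close: "dist t t' \<le> \<delta>"
    if \<gamma>: "\<forall>t t'. \<bar>s t - s t'\<bar> < \<gamma> \<longrightarrow> dist t t' < \<delta>" and c: "\<bar>c - c'\<bar> < \<gamma>"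
      and x: "(\<lambda>n. s (x n)) \<longlonglongrightarrow> c" "x \<longlonglongrightarrow> t" and x': "(\<lambda>n. s (x' n)) \<longlonglongrightarrow> c'" "x' \<longlonglongrightarrow> t'"
    for \<gamma> \<delta> c c' x x' t t'
  proof -
    have "(\<lambda>n. \<bar>s (x n) - s (x' n)\<bar>) \<longlonglongrightarrow> \<bar>c - c'\<bar>" by (intro tendsto_intros x x')
    then have "\<forall>\<^sub>F n in sequentially. \<bar>s (x n) - s (x' n)\<bar> < \<gamma>" using c by (rule order_tendstoD)
    then have "\<forall>\<^sub>F n in sequentially. dist (x n) (x' n) \<le> \<delta>"
      by eventually_elim (use \<gamma> in \<open>auto intro: less_imp_le\<close>)
    moreover have "(\<lambda>n. dist (x n) (x' n)) \<longlonglongrightarrow> dist t t'" by (intro tendsto_intros x x')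
    ultimately show ?thesis by (intro tendsto_upperbound) auto
  qed
  have cont: "continuous_on S \<phi>"
  proof (rule uniformly_continuous_imp_continuous, unfold uniformly_continuous_on_def, intro allI impI)
    fix \<delta> :: real assume "\<delta> > 0"
    then obtain \<gamma> where \<gamma>: "\<gamma> > 0" "\<forall>t t'. \<bar>s t - s t'\<bar> < \<gamma> \<longrightarrow> dist t t' < \<delta> / 2" using uc[of "\<delta> / 2"] by auto
    have "dist (\<phi> c') (\<phi> c) < \<delta>" if "c \<in> S" "c' \<in> S" "dist c' c < \<gamma>" for c c'
      using close[OF \<gamma>(2), of c' c "x c'" "\<phi> c'" "x c" "\<phi> c"] \<phi> that \<open>\<delta> > 0\<close> by (simp add: dist_real_def)
    then show "\<exists>d>0. \<forall>c\<in>S. \<forall>c'\<in>S. dist c' c < d \<longrightarrow> dist (\<phi> c') (\<phi> c) < \<delta>" using \<gamma>(1) by blast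
  qed
  have sS: "s t \<in> S" for t unfolding S_def by (rule subsetD[OF closure_subset]) simp
  have \<phi>s: "\<phi> (s t) = t" for t
  proof (rule ccontr)
    assume "\<phi> (s t) \<noteq> t"
    then have d: "dist (\<phi> (s t)) t / 2 > 0" by simp
    then obtain \<gamma> where \<gamma>: "\<gamma> > 0" "\<forall>t' t''. \<bar>s t' - s t''\<bar> < \<gamma> \<longrightarrow> dist t' t'' < dist (\<phi> (s t)) t / 2" using uc by blast
    have "dist (\<phi> (s t)) t \<le> dist (\<phi> (s t)) t / 2"
      by (rule close[OF \<gamma>(2), of "s t" "s t" "x (s t)" _ "\<lambda>_. t"]) (use \<phi>[OF sS[of t]] \<gamma>(1) in auto)
    then show False using d by simp
  qed
  \<comment> \<open>The value off \<open>S\<close> is arbitrary: the limit law will be shown to be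
    carried by \<open>S\<close>.\<close>
  define \<phi>' where "\<phi>' c = (if c \<in> S then \<phi> c else undefined)" for c
  have \<phi>'m[measurable]: "\<phi>' \<in> borel_measurable borel"
    unfolding \<phi>'_def[abs_def] by (intro borel_measurable_continuous_on_if cont borel_closed closedS) auto
  define \<Lambda> where "\<Lambda> n = distr (\<mu>s n) borel s" for n
  have rd: "real_distribution (\<Lambda> n)" for n
    unfolding \<Lambda>_def by (intro prob_space.real_distribution_distr ps) measurable
  have "tight \<Lambda>"
    unfolding tight_def
  proof (intro conjI allI impI rd)
    fix e :: real assume "e > 0"
    \<comment> \<open>The interval is open on the left and \<open>s\<close> may vanish, hence the
      endpoint \<open>-1\<close> rather than \<open>0\<close>.\<close>
    have "measure (\<Lambda> n) {-1<..2} = 1" for n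
    proof -
      interpret prob_space "\<mu>s n" by (rule ps)
      have "s -` {-1<..2} \<inter> space (\<mu>s n) = space (\<mu>s n)" using s01 by (auto intro!: less_le_trans[OF _ s01(1)])
      then show ?thesis unfolding \<Lambda>_def by (subst measure_distr) (auto simp: prob_space)
    qed
    then show "\<exists>a b. a < b \<and> (\<forall>n. 1 - e < measure (\<Lambda> n) {a<..b})"
      using \<open>e > 0\<close> by (intro exI[of _ "-1"] exI[of _ 2]) auto
  qed
  from tight_imp_convergent_subsubsequence[OF this strict_mono_id]
  obtain r L where r: "strict_mono (r :: nat \<Rightarrow> nat)" and L: "real_distribution L" and wc: "weak_conv_m (\<Lambda> \<circ> r) L"
    by auto
  interpret L: real_distribution L by (rule L)
  have lim: "(\<lambda>n. \<integral>t. g (s t) \<partial>\<mu>s (r n)) \<longlonglongrightarrow> (\<integral>c. g c \<partial>L)"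
    if g: "continuous_on UNIV g" "\<And>c. \<bar>g c\<bar> \<le> b" for g :: "real \<Rightarrow> real" and b
  proof -
    have [measurable]: "g \<in> borel_measurable borel" by (rule borel_measurable_continuous_onI[OF g(1)])
    have "(\<lambda>n. \<integral>c. g c \<partial>(\<Lambda> \<circ> r) n) \<longlonglongrightarrow> (\<integral>c. g c \<partial>L)"
      by (rule weak_conv_imp_integral_bdd_continuous_conv[OF _ L wc, where B = b])
        (use g rd in \<open>auto simp: continuous_on_eq_continuous_at\<close>)
    moreover have "(\<integral>c. g c \<partial>(\<Lambda> \<circ> r) n) = (\<integral>t. g (s t) \<partial>\<mu>s (r n))" for n
      unfolding \<Lambda>_def o_def by (rule integral_distr) measurable
    ultimately show ?thesis by simp
  qed
  \<comment> \<open>The truncated distance to \<open>S\<close> is a bounded continuous test function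
    that vanishes at all codes, so its integral under the limit law is zero.\<close>
  have AES: "AE c in L. c \<in> S"
  proof -
    let ?g = "\<lambda>c. min 1 (infdist c S)"
    have gc: "continuous_on UNIV ?g" by (intro continuous_intros)
    have "(\<lambda>n. \<integral>t. ?g (s t) \<partial>\<mu>s (r n)) \<longlonglongrightarrow> (\<integral>c. ?g c \<partial>L)"
      by (rule lim[OF gc, of 1]) (auto simp: infdist_nonneg)
    moreover have "(\<integral>t. ?g (s t) \<partial>\<mu>s (r n)) = 0" for n using sS by simp
    ultimately have "(\<integral>c. ?g c \<partial>L) = 0" by (simp add: LIMSEQ_const_iff)
    moreover have "?g \<in> borel_measurable L"
      unfolding measurable_cong_sets[OF L.events_eq_borel refl] by (rule borel_measurable_continuous_onI[OF gc])
    then have "integrable L ?g"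
      by (rule L.integrable_const_bound[of _ 1, rotated]) (auto simp: infdist_nonneg)
    ultimately have "AE c in L. ?g c = 0"
      by (subst (asm) integral_nonneg_eq_0_iff_AE) (auto simp: infdist_nonneg)
    then show ?thesis
      by eventually_elim (use in_closed_iff_infdist_zero[OF closedS neS] in \<open>auto simp: min_def split: if_splits\<close>)
  qed
  show ?thesis
  proof (rule that)
    show "strict_mono r" by (rule r)
    show "distr L borel \<phi>' \<in> prob_measures"
      unfolding prob_measures_def by (auto intro!: L.prob_space_distr simp: measurable_cong_sets[OF L.events_eq_borel refl])
    show "weak_conv_to (\<mu>s \<circ> r) (distr L borel \<phi>') sequentially"
      unfolding weak_conv_to_def
    proof
      fix f :: "'k \<Rightarrow>\<^sub>C real"
      have [measurable]: "apply_bcontfun f \<in> borel_measurable borel" by (intro borel_measurable_continuous_onI) simp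
      have cf: "continuous_on S (\<lambda>c. apply_bcontfun f (\<phi> c))"
        by (rule continuous_on_compose2[OF continuous_on_apply_bcontfun[of UNIV] cont]) auto
      have cl: "closedin (top_of_set UNIV) S" using closedS by simp
      have nb: "norm (apply_bcontfun f (\<phi> c)) \<le> norm f" for c by (rule norm_bounded)
      \<comment> \<open>The composition of \<open>f\<close> with \<open>\<phi>\<close> is continuous
        on \<open>S\<close> only; weak convergence on the line calls for a bounded continuous
        function on the whole line.\<close>
      obtain g where g: "continuous_on UNIV g" "\<And>c. c \<in> S \<Longrightarrow> g c = apply_bcontfun f (\<phi> c)"
          "\<And>c. c \<in> UNIV \<Longrightarrow> norm (g c) \<le> norm f"
        by (rule Tietze[OF cf cl norm_ge_zero nb]) blast
      have [measurable]: "g \<in> borel_measurable borel" by (rule borel_measurable_continuous_onI[OF g(1)])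
      have "(\<integral>t. apply_bcontfun f t \<partial>distr L borel \<phi>') = (\<integral>c. apply_bcontfun f (\<phi>' c) \<partial>L)"
        by (rule integral_distr) measurable
      also have "\<dots> = (\<integral>c. g c \<partial>L)"
      proof (rule integral_cong_AE)
        show "AE c in L. apply_bcontfun f (\<phi>' c) = g c"
          using AES by eventually_elim (simp add: \<phi>'_def g(2))
      qed measurable
      finally have "(\<integral>t. apply_bcontfun f t \<partial>distr L borel \<phi>') = (\<integral>c. g c \<partial>L)" .
      moreover have "(\<lambda>n. \<integral>t. g (s t) \<partial>\<mu>s (r n)) \<longlonglongrightarrow> (\<integral>c. g c \<partial>L)"
        using lim[OF g(1)] g(3) by auto
      moreover have "(\<integral>t. g (s t) \<partial>\<mu>s (r n)) = (\<integral>t. apply_bcontfun f t \<partial>(\<mu>s \<circ> r) n)" for n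
        using g(2)[OF sS] by (simp add: \<phi>s)
      ultimately show "(\<lambda>n. \<integral>t. apply_bcontfun f t \<partial>(\<mu>s \<circ> r) n) \<longlonglongrightarrow> (\<integral>t. apply_bcontfun f t \<partial>distr L borel \<phi>')"
        by simp
    qed
  qed
qed

section \<open>Fernique's theorem\<close>

context prob_space
begin

lemma gaussian_rv_integrable:
  assumes "gaussian_rv M Y"
  shows "integrable M Y" "integrable M (\<lambda>w. (Y w)\<^sup>2)"
proof -
  have [measurable]: "Y \<in> borel_measurable M" using assms by (simp add: gaussian_rv_def)
  have "integrable M Y \<and> integrable M (\<lambda>w. (Y w)\<^sup>2)"
    using assms unfolding gaussian_rv_def
  proof (elim conjE disjE exE)
    fix m assume AE: "AE w in M. Y w = m"
    have "integrable M Y \<longleftrightarrow> integrable M (\<lambda>_. m)" "integrable M (\<lambda>w. (Y w)\<^sup>2) \<longleftrightarrow> integrable M (\<lambda>_. m\<^sup>2)"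
      using AE by (intro integrable_cong_AE; force)+
    then show ?thesis by simp
  next
    fix m s :: real assume s: "s > 0" and D: "distributed M lborel Y (normal_density m s)"
    have 1: "integrable M (\<lambda>w. Y w - m)"
      using distributed_integrable[OF D, of "\<lambda>x. x - m"] integrable_normal_moment[OF s, of m 1] s by simp
    have 2: "integrable M (\<lambda>w. (Y w - m)\<^sup>2)"
      using distributed_integrable[OF D, of "\<lambda>x. (x - m)\<^sup>2"] integrable_normal_moment[OF s, of m 2] s by simp
    have "integrable M (\<lambda>w. (Y w - m) + m)"
      by (intro Bochner_Integration.integrable_add 1 integrable_const)
    moreover have "integrable M (\<lambda>w. (Y w - m)\<^sup>2 + 2 * m * (Y w - m) + m\<^sup>2)"
      by (intro Bochner_Integration.integrable_add 1 2 integrable_const integrable_mult_right)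
    moreover have "(Y w - m)\<^sup>2 + 2 * m * (Y w - m) + m\<^sup>2 = (Y w)\<^sup>2" for w
      by (simp add: power2_eq_square algebra_simps)
    ultimately show ?thesis by simp
  qed
  then show "integrable M Y" "integrable M (\<lambda>w. (Y w)\<^sup>2)" by auto
qed

lemma gaussian_rv_char:
  assumes G: "gaussian_rv M Y" and mean: "expectation Y = 0"
  shows "(CLINT w|M. iexp (Y w)) = exp (- (expectation (\<lambda>w. (Y w)\<^sup>2) / 2))"
proof -
  have [measurable]: "Y \<in> borel_measurable M" using G by (simp add: gaussian_rv_def)
  from G show ?thesis unfolding gaussian_rv_def
  proof (elim conjE disjE exE)
    fix m assume AE: "AE w in M. Y w = m"
    have "expectation Y = expectation (\<lambda>_. m)" using AE by (intro integral_cong_AE) auto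
    with mean have "m = 0" using prob_space by simp
    have "expectation (\<lambda>w. (Y w)\<^sup>2) = expectation (\<lambda>_. 0)"
      using AE \<open>m = 0\<close> by (intro integral_cong_AE) auto
    moreover have "(CLINT w|M. iexp (Y w)) = (CLINT w|M. 1)"
      using AE \<open>m = 0\<close> by (intro integral_cong_AE) auto
    ultimately show ?thesis by (simp add: prob_space)
  next
    fix m s :: real assume s: "s > 0" and D: "distributed M lborel Y (normal_density m s)"
    have m0: "m = 0" using normal_distributed_expectation[OF s D] mean by linarith
    have v: "expectation (\<lambda>w. (Y w)\<^sup>2) = s\<^sup>2"
      using normal_distributed_variance[OF s D] mean by simp
    have D1: "distributed M lborel (\<lambda>w. Y w / s) std_normal_density"
      using normal_standard_normal_convert[OF s, of Y m] D m0 by simp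
    have "(CLINT w|M. iexp (Y w)) = (CLINT w|M. iexp (s * (Y w / s)))" using s by simp
    also have "\<dots> = (CLINT x|distr M lborel (\<lambda>w. Y w / s). iexp (s * x))"
      by (subst integral_distr) auto
    also have "\<dots> = char std_normal_distribution s"
      using distributed_distr_eq_density[OF D1] by (simp add: char_def)
    finally show ?thesis by (simp add: char_std_normal_distribution v)
  qed
qed

end

section \<open>Linear functionals and exponential moments of the Gaussian path\<close>

locale compact_gaussian_path = prob_space P for P :: "'w measure" +
  fixes X :: "'w \<Rightarrow> 'k::metric_space \<Rightarrow>\<^sub>C real"
  assumes compact_K: "compact (UNIV :: 'k set)"
    and X_borel [measurable]: "X \<in> borel_measurable P"
    and gauss: "centred_gaussian_process P (\<lambda>w. apply_bcontfun (X w))"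
begin

lemma X_coord [measurable]: "(\<lambda>w. apply_bcontfun (X w) t) \<in> borel_measurable P"
proof -
  have "continuous_on UNIV (\<lambda>x :: 'k \<Rightarrow>\<^sub>C real. apply_bcontfun x t)"
    unfolding continuous_on_iff using dist_fun_lt_imp_dist_val_lt by blast
  from borel_measurable_continuous_onI[OF this] show ?thesis by simp
qed

definition lin_comb :: "('w \<Rightarrow> real) set" where
  "lin_comb = {S. \<exists>F c. finite F \<and> S = (\<lambda>w. \<Sum>t\<in>F. c t * apply_bcontfun (X w) t)}"

lemma lin_comb_integrable:
  assumes "S \<in> lin_comb"
  shows "integrable P S" "integrable P (\<lambda>w. (S w)\<^sup>2)" "expectation S = 0"
proof -
  obtain F c where F: "finite F" and S: "S = (\<lambda>w. \<Sum>t\<in>F. c t * apply_bcontfun (X w) t)"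
    using assms unfolding lin_comb_def by blast
  have G: "gaussian_rv P (\<lambda>w. \<Sum>t\<in>F. c t * apply_bcontfun (X w) t)" if "finite F" for F c
    using gauss that unfolding centred_gaussian_process_def gaussian_process_def by blast
  show "integrable P S" "integrable P (\<lambda>w. (S w)\<^sup>2)"
    unfolding S using gaussian_rv_integrable[OF G[OF F]] by auto
  have "integrable P (\<lambda>w. apply_bcontfun (X w) t)" for t
    using gaussian_rv_integrable(1)[OF G[of "{t}" "\<lambda>_. 1"]] by simp
  then show "expectation S = 0"
    unfolding S using gauss by (subst Bochner_Integration.integral_sum)
      (auto simp: centred_gaussian_process_def)
qed

lemma lin_comb_char:
  assumes "S \<in> lin_comb"
  shows "(CLINT w|P. iexp (S w)) = exp (- (expectation (\<lambda>w. (S w)\<^sup>2) / 2))"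
  using assms lin_comb_integrable(3)[OF assms] gauss
  by (intro gaussian_rv_char) (auto simp: lin_comb_def centred_gaussian_process_def gaussian_process_def)

lemma lin_comb_scale:
  assumes "S \<in> lin_comb"
  shows "(\<lambda>w. a * S w) \<in> lin_comb"
proof -
  obtain F c where F: "finite F" and S: "S = (\<lambda>w. \<Sum>t\<in>F. c t * apply_bcontfun (X w) t)"
    using assms unfolding lin_comb_def by blast
  have "(\<lambda>w. a * S w) = (\<lambda>w. \<Sum>t\<in>F. (a * c t) * apply_bcontfun (X w) t)"
    unfolding S by (simp add: sum_distrib_left mult.assoc)
  then show ?thesis using F unfolding lin_comb_def by (intro CollectI exI[of _ F] exI[of _ "\<lambda>t. a * c t"]) simp
qed

lemma lin_comb_add:
  assumes "S \<in> lin_comb" "S' \<in> lin_comb"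
  shows "(\<lambda>w. S w + S' w) \<in> lin_comb"
proof -
  obtain F c where F: "finite F" and S: "S = (\<lambda>w. \<Sum>t\<in>F. c t * apply_bcontfun (X w) t)"
    using assms(1) unfolding lin_comb_def by blast
  obtain F' c' where F': "finite F'" and S': "S' = (\<lambda>w. \<Sum>t\<in>F'. c' t * apply_bcontfun (X w) t)"
    using assms(2) unfolding lin_comb_def by blast
  have "S w + S' w = (\<Sum>t\<in>F \<union> F'. ((if t \<in> F then c t else 0) + (if t \<in> F' then c' t else 0)) * apply_bcontfun (X w) t)" for w
  proof -
    have 1: "S w = (\<Sum>t\<in>F \<union> F'. (if t \<in> F then c t else 0) * apply_bcontfun (X w) t)"
      unfolding S using F F' by (intro sum.mono_neutral_cong_left) auto
    have 2: "S' w = (\<Sum>t\<in>F \<union> F'. (if t \<in> F' then c' t else 0) * apply_bcontfun (X w) t)"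
      unfolding S' using F F' by (intro sum.mono_neutral_cong_left) auto
    show ?thesis unfolding 1 2 by (simp only: distrib_right sum.distrib)
  qed
  then show ?thesis using F F' unfolding lin_comb_def
    by (intro CollectI exI[of _ "F \<union> F'"] exI[of _ "\<lambda>t. (if t \<in> F then c t else 0) + (if t \<in> F' then c' t else 0)"]) simp
qed

lemma lin_comb_sum: "finite F \<Longrightarrow> (\<lambda>w. \<Sum>t\<in>F. c t * apply_bcontfun (X w) t) \<in> lin_comb"
  unfolding lin_comb_def by blast

end

text \<open>Since \<open>b < 2\<close>, the exponent \<open>2 ^ n\<close> eventually dominates
  \<open>a * b ^ n\<close>. In the proof of exponential integrability \<open>b = 3/2\<close> is the
  growth rate of the norm levels and \<open>(1/3) ^ (2 ^ n)\<close> bounds the tail beyond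
  them.\<close>

lemma summable_exp_geometric_tower:
  fixes a b :: real
  assumes a: "a > 0" and b: "1 < b" "b < 2"
  shows "summable (\<lambda>n. exp (a * b ^ n) * (1 / 3) ^ (2 ^ n))"
proof (rule summable_comparison_test_bigo)
  show "summable (\<lambda>n. norm ((1 / 2 :: real) ^ n))" by simp
  have "(\<lambda>n. exp (a * b ^ n) * exp (- ln 3 * 2 ^ n)) \<in> O(\<lambda>n. (1 / 2 :: real) ^ n)"
    using a b by real_asymp
  moreover have "exp (- ln 3 * 2 ^ n) = (1 / 3 :: real) ^ (2 ^ n)" for n :: nat
  proof -
    have "exp (- ln 3 * 2 ^ n) = exp (- ln (3 :: real)) ^ (2 ^ n)"
      by (subst exp_of_nat_mult[symmetric]) (simp add: mult.commute)
    then show ?thesis by (simp add: exp_minus power_one_over inverse_eq_divide)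
  qed
  ultimately show "(\<lambda>n. exp (a * b ^ n) * (1 / 3) ^ (2 ^ n)) \<in> O(\<lambda>n. (1 / 2 :: real) ^ n)" by simp
qed

lemma integral_pair_product_complex:
  fixes f :: "'a \<Rightarrow> complex" and g :: "'b \<Rightarrow> complex"
  assumes P: "prob_space P" "prob_space P'"
    and [measurable]: "f \<in> borel_measurable P" "g \<in> borel_measurable P'"
    and bnd: "\<And>x. norm (f x) \<le> 1" "\<And>y. norm (g y) \<le> 1"
  shows "(CLINT z|P \<Otimes>\<^sub>M P'. f (fst z) * g (snd z)) = (CLINT x|P. f x) * (CLINT y|P'. g y)"
proof -
  interpret P: prob_space P by fact
  interpret P': prob_space P' by fact
  interpret PP: pair_prob_space P P' ..
  have "integrable (P \<Otimes>\<^sub>M P') (\<lambda>z. f (fst z) * g (snd z))"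
    using bnd by (intro PP.integrable_const_bound[of _ 1]) (auto simp: norm_mult intro!: mult_le_one)
  from PP.integral_fst'[OF this] show ?thesis by simp
qed

lemma (in prob_space) pair_char_gaussian:
  fixes a b :: real
  assumes [measurable]: "A \<in> borel_measurable M" "B \<in> borel_measurable M"
    and A: "(CLINT w|M. iexp (A w)) = exp (- (a / 2))" and B: "(CLINT w|M. iexp (B w)) = exp (- (b / 2))"
  shows "(CLINT z|M \<Otimes>\<^sub>M M. iexp (A (fst z) + B (snd z))) = exp (- ((a + b) / 2))"
proof -
  have "(CLINT z|M \<Otimes>\<^sub>M M. iexp (A (fst z) + B (snd z)))
      = (CLINT z|M \<Otimes>\<^sub>M M. iexp (A (fst z)) * iexp (B (snd z)))"
    by (simp add: exp_add distrib_left)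
  also have "\<dots> = (CLINT w|M. iexp (A w)) * (CLINT w|M. iexp (B w))"
    by (intro integral_pair_product_complex) (auto intro: prob_space_axioms)
  also have "\<dots> = exp (- ((a + b) / 2))"
    unfolding A B by (simp only: of_real_mult[symmetric] of_real_eq_iff exp_add[symmetric] add_divide_distrib minus_add_distrib)
  finally show ?thesis .
qed

context compact_gaussian_path
begin

lemma norm_X_measurable [measurable]: "(\<lambda>w. norm (X w)) \<in> borel_measurable P"
  by (rule norm_coordinate_measurable[OF compact_K]) simp

text \<open>Pairs of paths are measured through the disjoint union of their evaluations, which makes
  the law of a pair an instance of \<open>distr_coordinate_algebra_eqI\<close>.\<close>

definition pair_coord :: "'k + 'k \<Rightarrow> ('k \<Rightarrow>\<^sub>C real) \<times> ('k \<Rightarrow>\<^sub>C real) \<Rightarrow> real" where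
  "pair_coord i z = (case i of Inl t \<Rightarrow> apply_bcontfun (fst z) t | Inr t \<Rightarrow> apply_bcontfun (snd z) t)"

text \<open>A linear functional of the rotated pair, regrouped by the two independent copies, arises
  from the original one by the transposed rotation. This preserves the sum of the two squares, hence
  the total variance, which alone determines the Gaussian characteristic function.\<close>

lemma rotation_law:
  "distr (P \<Otimes>\<^sub>M P) (coordinate_algebra pair_coord) (\<lambda>(w, w'). (X w, X w'))
   = distr (P \<Otimes>\<^sub>M P) (coordinate_algebra pair_coord)
       (\<lambda>(w, w'). ((1 / sqrt 2) *\<^sub>R (X w - X w'), (1 / sqrt 2) *\<^sub>R (X w + X w')))"
proof (rule distr_coordinate_algebra_eqI)
  interpret PP: pair_prob_space P P ..
  show "prob_space (P \<Otimes>\<^sub>M P)" "prob_space (P \<Otimes>\<^sub>M P)" by (rule PP.prob_space_axioms)+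
  fix i show "(\<lambda>w. pair_coord i (case w of (w, w') \<Rightarrow> (X w, X w'))) \<in> borel_measurable (P \<Otimes>\<^sub>M P)"
    "(\<lambda>w. pair_coord i (case w of (w, w') \<Rightarrow> ((1 / sqrt 2) *\<^sub>R (X w - X w'), (1 / sqrt 2) *\<^sub>R (X w + X w'))))
        \<in> borel_measurable (P \<Otimes>\<^sub>M P)"
    by (cases i; simp add: pair_coord_def case_prod_beta; measurable)+
next
  fix J :: "('k + 'k) set" and c :: "'k + 'k \<Rightarrow> real" assume J: "finite J"
  define F where "F = Inl -` J" define G where "G = Inr -` J"
  have FG: "finite F" "finite G" "J = F <+> G"
    unfolding F_def G_def using J by (auto intro!: finite_vimageI simp: Plus_def) (metis sum.exhaust rangeI)+
  define A where "A w = (\<Sum>t\<in>F. c (Inl t) * apply_bcontfun (X w) t)" for w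
  define B where "B w = (\<Sum>t\<in>G. c (Inr t) * apply_bcontfun (X w) t)" for w
  define A' where "A' w = 1 / sqrt 2 * (A w + B w)" for w
  define B' where "B' w = 1 / sqrt 2 * (B w + (-1) * A w)" for w
  have AB: "A \<in> lin_comb" "B \<in> lin_comb"
    unfolding A_def B_def by (auto intro!: lin_comb_sum FG)
  have AB': "A' \<in> lin_comb" "B' \<in> lin_comb"
    unfolding A'_def B'_def by (intro lin_comb_scale lin_comb_add AB)+
  have "(CLINT z|P \<Otimes>\<^sub>M P. iexp (\<Sum>j\<in>J. c j * pair_coord j (case z of (w, w') \<Rightarrow> (X w, X w'))))
      = (CLINT z|P \<Otimes>\<^sub>M P. iexp (A (fst z) + B (snd z)))"
    by (simp add: FG sum.Plus pair_coord_def A_def B_def case_prod_beta)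
  also have "\<dots> = exp (- ((expectation (\<lambda>w. (A w)\<^sup>2) + expectation (\<lambda>w. (B w)\<^sup>2)) / 2))"
    by (rule pair_char_gaussian[of A B]) (auto intro!: AB lin_comb_char borel_measurable_integrable[OF lin_comb_integrable(1)])
  also have "expectation (\<lambda>w. (A w)\<^sup>2) + expectation (\<lambda>w. (B w)\<^sup>2)
      = expectation (\<lambda>w. (A' w)\<^sup>2) + expectation (\<lambda>w. (B' w)\<^sup>2)"
  proof -
    have "(A w)\<^sup>2 + (B w)\<^sup>2 = (A' w)\<^sup>2 + (B' w)\<^sup>2" for w
      unfolding A'_def B'_def power_mult_distrib power_divide by (simp add: power2_eq_square field_simps)
    then show ?thesis
      using AB[THEN lin_comb_integrable(2)] AB'[THEN lin_comb_integrable(2)]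
      by (simp flip: Bochner_Integration.integral_add)
  qed
  also have "complex_of_real (exp (- ((expectation (\<lambda>w. (A' w)\<^sup>2) + expectation (\<lambda>w. (B' w)\<^sup>2)) / 2)))
      = (CLINT z|P \<Otimes>\<^sub>M P. iexp (A' (fst z) + B' (snd z)))"
    by (rule pair_char_gaussian[of A' B', symmetric]) (auto intro!: AB' lin_comb_char borel_measurable_integrable[OF lin_comb_integrable(1)])
  also have "\<dots> = (CLINT z|P \<Otimes>\<^sub>M P. iexp (\<Sum>j\<in>J. c j * pair_coord j (case z of (w, w') \<Rightarrow>
      ((1 / sqrt 2) *\<^sub>R (X w - X w'), (1 / sqrt 2) *\<^sub>R (X w + X w')))))"
  proof -
    have "A' w + B' w' = (\<Sum>j\<in>J. c j * pair_coord j ((1 / sqrt 2) *\<^sub>R (X w - X w'), (1 / sqrt 2) *\<^sub>R (X w + X w')))" for w w'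
    proof -
      have "(\<Sum>t\<in>F. c (Inl t) * (1 / sqrt 2 * (apply_bcontfun (X w) t - apply_bcontfun (X w') t)))
          = 1 / sqrt 2 * (A w - A w')"
        unfolding A_def by (simp only: sum_distrib_left sum_subtractf[symmetric] right_diff_distrib mult.left_commute)
      moreover have "(\<Sum>t\<in>G. c (Inr t) * (1 / sqrt 2 * (apply_bcontfun (X w) t + apply_bcontfun (X w') t)))
          = 1 / sqrt 2 * (B w + B w')"
        unfolding B_def by (simp only: sum_distrib_left sum.distrib[symmetric] distrib_left mult.left_commute)
      ultimately have "(\<Sum>j\<in>J. c j * pair_coord j ((1 / sqrt 2) *\<^sub>R (X w - X w'), (1 / sqrt 2) *\<^sub>R (X w + X w')))
          = 1 / sqrt 2 * (A w - A w') + 1 / sqrt 2 * (B w + B w')"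
        by (simp only: FG(3) sum.Plus[OF FG(1,2)] pair_coord_def sum.case fst_conv snd_conv o_def
            scaleR_bcontfun.rep_eq minus_bcontfun.rep_eq plus_bcontfun.rep_eq real_scaleR_def)
      then show ?thesis unfolding A'_def B'_def by (simp add: field_simps)
    qed
    then show ?thesis by (simp only: case_prod_beta)
  qed
  finally show "(CLINT z|P \<Otimes>\<^sub>M P. iexp (\<Sum>j\<in>J. c j * pair_coord j (case z of (w, w') \<Rightarrow> (X w, X w'))))
      = (CLINT z|P \<Otimes>\<^sub>M P. iexp (\<Sum>j\<in>J. c j * pair_coord j (case z of (w, w') \<Rightarrow>
      ((1 / sqrt 2) *\<^sub>R (X w - X w'), (1 / sqrt 2) *\<^sub>R (X w + X w')))))" .
qed

text \<open>The left side is the probability that one of two independent copies is small and the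
  other large. After the rotation this event says that the difference is small and the sum large,
  and by the triangle inequality both copies must then be large.\<close>

lemma fernique_step:
  "prob {w\<in>space P. norm (X w) \<le> s} * prob {w\<in>space P. t < norm (X w)}
     \<le> (prob {w\<in>space P. (t - s) / sqrt 2 < norm (X w)})\<^sup>2"
proof -
  interpret PP: pair_prob_space P P ..
  let ?f = "\<lambda>(w, w'). (X w, X w')"
  let ?g = "\<lambda>(w, w'). ((1 / sqrt 2) *\<^sub>R (X w - X w'), (1 / sqrt 2) *\<^sub>R (X w + X w'))"
  let ?C = "{z. norm (fst z) \<le> s \<and> t < norm (snd z)} :: (('k \<Rightarrow>\<^sub>C real) \<times> ('k \<Rightarrow>\<^sub>C real)) set"
  have m: "(\<lambda>z. apply_bcontfun (fst z) r) \<in> borel_measurable (coordinate_algebra pair_coord)"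
    "(\<lambda>z. apply_bcontfun (snd z) r) \<in> borel_measurable (coordinate_algebra pair_coord)" for r
    using measurable_coordinate[of pair_coord "Inl r"] measurable_coordinate[of pair_coord "Inr r"]
    by (simp_all add: pair_coord_def[abs_def])
  have [measurable]: "(\<lambda>z. norm (fst z)) \<in> borel_measurable (coordinate_algebra pair_coord)"
    "(\<lambda>z. norm (snd z)) \<in> borel_measurable (coordinate_algebra pair_coord)"
    by (intro norm_coordinate_measurable[OF compact_K] m)+
  have "{z\<in>space (coordinate_algebra pair_coord). norm (fst z) \<le> s \<and> t < norm (snd z)} \<in> sets (coordinate_algebra pair_coord)"
    by measurable
  then have C: "?C \<in> sets (coordinate_algebra pair_coord)" by simp
  have f: "?f \<in> measurable (P \<Otimes>\<^sub>M P) (coordinate_algebra pair_coord)"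
    "?g \<in> measurable (P \<Otimes>\<^sub>M P) (coordinate_algebra pair_coord)"
    by (intro measurable_to_coordinate_algebra; rename_tac i; case_tac i; simp add: pair_coord_def case_prod_beta; measurable)+
  let ?A = "{w\<in>space P. norm (X w) \<le> s}" and ?B = "{w\<in>space P. t < norm (X w)}"
    and ?D = "{w\<in>space P. (t - s) / sqrt 2 < norm (X w)}"
  have "emeasure P ?A * emeasure P ?B = emeasure (P \<Otimes>\<^sub>M P) (?A \<times> ?B)"
    by (intro emeasure_pair_measure_Times[symmetric]) measurable
  also have "?A \<times> ?B = ?f -` ?C \<inter> space (P \<Otimes>\<^sub>M P)"
    by (auto simp: space_pair_measure)
  also have "emeasure (P \<Otimes>\<^sub>M P) (?f -` ?C \<inter> space (P \<Otimes>\<^sub>M P))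
      = emeasure (P \<Otimes>\<^sub>M P) (?g -` ?C \<inter> space (P \<Otimes>\<^sub>M P))"
    using emeasure_distr[OF f(1) C] emeasure_distr[OF f(2) C] rotation_law by simp
  also have "\<dots> \<le> emeasure (P \<Otimes>\<^sub>M P) (?D \<times> ?D)"
  proof (rule emeasure_mono)
    show "?g -` ?C \<inter> space (P \<Otimes>\<^sub>M P) \<subseteq> ?D \<times> ?D"
    proof (rule subsetI)
      fix z assume "z \<in> ?g -` ?C \<inter> space (P \<Otimes>\<^sub>M P)"
      then obtain w w' where z: "z = (w, w')" "w \<in> space P" "w' \<in> space P"
        and le: "norm (X w - X w') / sqrt 2 \<le> s" and gt: "t < norm (X w + X w') / sqrt 2"
        by (auto simp: space_pair_measure divide_inverse mult.commute)
      define r where "r = sqrt 2"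
      have r: "r > 0" "r * r = 2" by (auto simp: r_def)
      have "norm (X w - X w') \<le> s * r" "t * r < norm (X w + X w')"
        using le gt r unfolding r_def[symmetric] by (auto simp: field_simps)
      moreover have "norm (X w + X w') \<le> norm (X w - X w') + 2 * norm (X w')"
        using norm_triangle_ineq[of "X w - X w'" "2 *\<^sub>R X w'"] norm_scaleR[of 2 "X w'"] by (simp add: scaleR_2 algebra_simps)
      moreover have "norm (X w + X w') \<le> norm (X w - X w') + 2 * norm (X w)"
        using norm_triangle_ineq[of "X w' - X w" "2 *\<^sub>R X w"] norm_scaleR[of 2 "X w"] by (simp add: scaleR_2 algebra_simps norm_minus_commute)
      ultimately have "(t - s) * r < 2 * norm (X w)" "(t - s) * r < 2 * norm (X w')"
        by (auto simp: algebra_simps)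
      then have "(t - s) * r < r * r * norm (X w)" "(t - s) * r < r * r * norm (X w')" using r by auto
      then have "r * (t - s) < r * (r * norm (X w))" "r * (t - s) < r * (r * norm (X w'))"
        by (simp_all only: mult.commute[of "t - s" r] mult.assoc)
      then have "t - s < r * norm (X w)" "t - s < r * norm (X w')"
        using r(1) by simp_all
      then have "(t - s) / r < norm (X w)" "(t - s) / r < norm (X w')"
        using r(1) by (simp_all add: pos_divide_less_eq mult.commute)
      then show "z \<in> ?D \<times> ?D" using z by (simp add: r_def)
    qed
  qed measurable
  also have "\<dots> = emeasure P ?D * emeasure P ?D"
    by (intro emeasure_pair_measure_Times) measurable
  finally show ?thesis
    by (simp add: emeasure_eq_measure ennreal_mult[symmetric] power2_eq_square)
qed

text \<open>\<open>fernique_step\<close> is iterated with a fixed \<open>s\<close>: the thresholds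
  grow by \<open>3/2 > sqrt 2\<close>, which pays for the division by \<open>sqrt 2\<close>, and the
  tail is squared at each stage. The start succeeds because \<open>1 - q \<le> q / 3\<close> for
  \<open>q \<ge> 3/4\<close>.\<close>

lemma fernique:
  obtains s where "s > 0" "\<And>n. prob {w\<in>space P. 20 * s * (3/2) ^ n < norm (X w)} \<le> (1/3) ^ (2 ^ n)"
proof -
  have "(\<lambda>n. prob {w\<in>space P. norm (X w) \<le> real n}) \<longlonglongrightarrow> prob (\<Union>n. {w\<in>space P. norm (X w) \<le> real n})"
    by (rule finite_Lim_measure_incseq) (auto simp: incseq_def)
  also have "(\<Union>n. {w\<in>space P. norm (X w) \<le> real n}) = space P"
    using real_arch_simple by auto
  finally have "(\<lambda>n. prob {w\<in>space P. norm (X w) \<le> real n}) \<longlonglongrightarrow> 1" by (simp add: prob_space)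
  then have "\<forall>\<^sub>F n in sequentially. 3/4 < prob {w\<in>space P. norm (X w) \<le> real n}"
    by (rule order_tendstoD) simp
  then obtain n where n: "n \<ge> 1" "3/4 < prob {w\<in>space P. norm (X w) \<le> real n}"
    unfolding eventually_sequentially by (metis max.cobounded1 max.cobounded2)
  define s where "s = real n"
  define q where "q = prob {w\<in>space P. norm (X w) \<le> s}"
  have s: "s > 0" and q: "3/4 < q" "q \<le> 1" using n by (auto simp: s_def q_def)
  define p where "p n = prob {w\<in>space P. 20 * s * (3/2) ^ n < norm (X w)}" for n
  have p: "0 \<le> p n" for n by (simp add: p_def)
  \<comment> \<open>The factor \<open>q\<close> absorbs the division by \<open>q\<close> that the
    use of \<open>fernique_step\<close> entails.\<close>
  have "p n \<le> q * (1/3) ^ (2 ^ n)" for n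
  proof (induction n)
    case 0
    have "p 0 \<le> prob (space P - {w\<in>space P. norm (X w) \<le> s})"
      unfolding p_def using s by (intro finite_measure_mono) auto
    also have "\<dots> = 1 - q" unfolding q_def by (rule prob_compl) measurable
    finally show ?case using q by simp
  next
    case (Suc n)
    \<comment> \<open>With \<open>1.42\<close> in place of \<open>sqrt 2\<close> the condition on
      the thresholds reads \<open>28.4 * y \<le> 30 * y - s\<close>, which follows from
      \<open>s \<le> y\<close>.\<close>
    have sq: "sqrt 2 \<le> 1.42" by (rule real_le_lsqrt) (auto simp: power2_eq_square)
    have p1: "1 \<le> (3/2 :: real) ^ n" by simp
    define y where "y = s * (3/2) ^ n"
    have y: "20 * s * (3/2) ^ n = 20 * y" "20 * s * (3/2) ^ Suc n = 30 * y" "s \<le> y" "0 \<le> y"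
      using mult_left_mono[OF p1, of s] s by (simp_all add: y_def)
    have "20 * s * (3/2) ^ n * sqrt 2 \<le> 20 * y * 1.42"
      unfolding y(1) using y(4) by (intro mult_left_mono sq) auto
    also have "\<dots> \<le> 20 * s * (3/2) ^ Suc n - s"
      unfolding y(2) using y(3,4) by simp
    finally have le: "20 * s * (3/2) ^ n \<le> (20 * s * (3/2) ^ Suc n - s) / sqrt 2"
      by (simp add: field_simps)
    have "q * p (Suc n) \<le> (prob {w\<in>space P. (20 * s * (3/2) ^ Suc n - s) / sqrt 2 < norm (X w)})\<^sup>2"
      unfolding q_def p_def by (rule fernique_step)
    also have "\<dots> \<le> (p n)\<^sup>2"
      unfolding p_def using le by (intro power_mono finite_measure_mono) auto
    also have "\<dots> \<le> (q * (1/3) ^ (2 ^ n))\<^sup>2"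
      using Suc p by (intro power_mono) auto
    also have "\<dots> = q * (q * (1/3) ^ (2 ^ Suc n))"
      by (simp add: power2_eq_square power_add[symmetric] mult_2)
    finally show ?case using q by simp
  qed
  note le = this
  show ?thesis
  proof (rule that)
    show "s > 0" by fact
    fix n
    have "p n \<le> q * (1/3) ^ (2 ^ n)" by (rule le)
    also have "\<dots> \<le> 1 * (1/3) ^ (2 ^ n)" using q by (intro mult_right_mono) auto
    finally show "prob {w\<in>space P. 20 * s * (3/2) ^ n < norm (X w)} \<le> (1/3) ^ (2 ^ n)"
      by (simp add: p_def)
  qed
qed

text \<open>On the layer between two successive Fernique thresholds the exponential is at most its
  value at the upper one. Weighted with the tail probability at the lower one, these values form a
  convergent series.\<close>

lemma integrable_exp_norm: "integrable P (\<lambda>w. exp (a * norm (X w)))"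
proof -
  obtain s where s: "s > 0" and tail: "\<And>n. prob {w\<in>space P. 20 * s * (3/2) ^ n < norm (X w)} \<le> (1/3) ^ (2 ^ n)"
    using fernique by blast
  \<comment> \<open>\<open>a\<close> may be negative; a positive rate makes the exponential
    increasing in the norm.\<close>
  define l where "l = max a 1"
  define t where "t n = 20 * s * (3/2) ^ n" for n :: nat
  have "(\<integral>\<^sup>+ w. ennreal (exp (l * norm (X w))) \<partial>P)
      \<le> (\<integral>\<^sup>+ w. ennreal (exp (l * t 0)) + (\<Sum>n. ennreal (exp (l * t (Suc n))) * indicator {w\<in>space P. t n < norm (X w)} w) \<partial>P)"
  proof (rule nn_integral_mono)
    fix w assume w: "w \<in> space P"
    show "ennreal (exp (l * norm (X w))) \<le> ennreal (exp (l * t 0))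
        + (\<Sum>n. ennreal (exp (l * t (Suc n))) * indicator {w\<in>space P. t n < norm (X w)} w)"
    proof (cases "norm (X w) \<le> t 0")
      case True
      then have "ennreal (exp (l * norm (X w))) \<le> ennreal (exp (l * t 0))" by (auto simp: l_def intro!: ennreal_leI mult_left_mono)
      then show ?thesis by (rule order_trans) simp
    next
      case False
      obtain m :: nat where "norm (X w) / (20 * s) < (3/2) ^ m" using real_arch_pow[of "3/2"] by auto
      then have m: "norm (X w) \<le> t m" using s by (simp add: t_def field_simps)
      define j where "j = (LEAST m. norm (X w) \<le> t m)"
      have j: "norm (X w) \<le> t j" unfolding j_def using m by (rule LeastI)
      with False obtain i where i: "j = Suc i" by (cases j) auto
      have "\<not> norm (X w) \<le> t i" using not_less_Least[of i "\<lambda>m. norm (X w) \<le> t m"] i by (simp add: j_def)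
      then have "ennreal (exp (l * norm (X w)))
          \<le> ennreal (exp (l * t (Suc i))) * indicator {w\<in>space P. t i < norm (X w)} w"
        using j i w by (auto simp: l_def intro!: ennreal_leI mult_left_mono)
      also have "\<dots> \<le> (\<Sum>n. ennreal (exp (l * t (Suc n))) * indicator {w\<in>space P. t n < norm (X w)} w)"
      proof -
        define g where "g n = ennreal (exp (l * t (Suc n))) * indicator {w\<in>space P. t n < norm (X w)} w" for n
        have "g i \<le> (\<Sum>n. g n)" using sum_le_suminf[of g "{i}"] by simp
        then show ?thesis by (simp only: g_def)
      qed
      finally show ?thesis by (rule order_trans) simp
    qed
  qed
  also have "\<dots> = ennreal (exp (l * t 0)) + (\<Sum>n. ennreal (exp (l * t (Suc n))) * emeasure P {w\<in>space P. t n < norm (X w)})"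
    by (simp add: nn_integral_add nn_integral_suminf nn_integral_cmult emeasure_space_1)
  also have "(\<Sum>n. ennreal (exp (l * t (Suc n))) * emeasure P {w\<in>space P. t n < norm (X w)})
      \<le> (\<Sum>n. ennreal (exp (30 * l * s * (3/2) ^ n) * (1/3) ^ (2 ^ n)))"
  proof (intro suminf_le)
    fix n
    have "ennreal (exp (l * t (Suc n))) * emeasure P {w\<in>space P. t n < norm (X w)}
        = ennreal (exp (30 * l * s * (3/2) ^ n) * prob {w\<in>space P. t n < norm (X w)})"
      by (simp add: emeasure_eq_measure ennreal_mult t_def algebra_simps)
    also have "\<dots> \<le> ennreal (exp (30 * l * s * (3/2) ^ n) * (1/3) ^ (2 ^ n))"
      using tail[of n] by (intro ennreal_leI mult_left_mono) (auto simp: t_def)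
    finally show "ennreal (exp (l * t (Suc n))) * emeasure P {w\<in>space P. t n < norm (X w)}
        \<le> ennreal (exp (30 * l * s * (3/2) ^ n) * (1/3) ^ (2 ^ n))" .
  qed auto
  also have "(\<Sum>n. ennreal (exp (30 * l * s * (3/2) ^ n) * (1/3) ^ (2 ^ n))) < \<infinity>"
  proof -
    have "summable (\<lambda>n. exp (30 * l * s * (3/2) ^ n) * (1/3) ^ (2 ^ n))"
      using s by (intro summable_exp_geometric_tower) (auto simp: l_def)
    then show ?thesis by (subst suminf_ennreal2) auto
  qed
  finally have "(\<integral>\<^sup>+ w. ennreal (exp (l * norm (X w))) \<partial>P) < \<infinity>"
    by (auto simp: ennreal_add_less_top top_unique less_top)
  then have "integrable P (\<lambda>w. exp (l * norm (X w)))"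
    by (intro integrableI_nonneg) auto
  then show ?thesis
    by (rule Bochner_Integration.integrable_bound) (auto simp: l_def intro!: mult_right_mono)
qed

section \<open>Covariance kernel, averages and potentials\<close>

abbreviation R :: "'k \<Rightarrow> 'k \<Rightarrow> real" where
  "R \<equiv> cov_kernel P (\<lambda>w. apply_bcontfun (X w))"

lemma coord_le_norm: "\<bar>apply_bcontfun (X w) t\<bar> \<le> norm (X w)"
  using norm_bounded[of "X w" t] by simp

lemma integrable_exp_bound:
  fixes f :: "'w \<Rightarrow> real"
  assumes "f \<in> borel_measurable P" "\<And>w. w \<in> space P \<Longrightarrow> \<bar>f w\<bar> \<le> C * exp (a * norm (X w))"
  shows "integrable P f"
  using assms by (intro Bochner_Integration.integrable_bound[OF integrable_mult_right[OF integrable_exp_norm, of C a]])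
    (auto intro!: AE_I2 intro: order_trans[OF _ abs_ge_self])

lemma norm_le_exp: "norm (X w) \<le> exp (norm (X w))" "(norm (X w))\<^sup>2 \<le> exp (2 * norm (X w))"
proof -
  show 1: "norm (X w) \<le> exp (norm (X w))" using exp_ge_add_one_self[of "norm (X w)"] by linarith
  have "(norm (X w))\<^sup>2 \<le> (exp (norm (X w)))\<^sup>2" using 1 by (intro power_mono) auto
  then show "(norm (X w))\<^sup>2 \<le> exp (2 * norm (X w))" by (simp add: exp_double)
qed

lemma integrable_norm_sq: "integrable P (\<lambda>w. (norm (X w))\<^sup>2)"
  by (rule integrable_exp_bound[of _ 1 2]) (use norm_le_exp in auto)

lemma integrable_norm: "integrable P (\<lambda>w. norm (X w))"
  by (rule integrable_exp_bound[of _ 1 1]) (use norm_le_exp in auto)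

lemma integrable_norm_bound:
  assumes "f \<in> borel_measurable P" "\<And>w. w \<in> space P \<Longrightarrow> \<bar>f w :: real\<bar> \<le> C * norm (X w)"
  shows "integrable P f"
  using assms by (intro Bochner_Integration.integrable_bound[OF integrable_mult_right[OF integrable_norm, of C]])
    (auto intro!: AE_I2 intro: order_trans[OF _ abs_ge_self])

lemma integrable_norm_sq_bound:
  assumes "f \<in> borel_measurable P" "\<And>w. w \<in> space P \<Longrightarrow> \<bar>f w :: real\<bar> \<le> C * (norm (X w))\<^sup>2"
  shows "integrable P f"
  using assms by (intro Bochner_Integration.integrable_bound[OF integrable_mult_right[OF integrable_norm_sq, of C]])
    (auto intro!: AE_I2 intro: order_trans[OF _ abs_ge_self])

lemma abs_mult_coord_le:
  assumes "\<bar>y\<bar> \<le> norm (X w)"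
  shows "\<bar>y * apply_bcontfun (X w) t\<bar> \<le> (norm (X w))\<^sup>2"
  unfolding abs_mult power2_eq_square by (intro mult_mono assms coord_le_norm) auto

lemma R_sym: "R s t = R t s"
  by (simp add: cov_kernel_def mult.commute)

definition R_bound :: real where "R_bound = expectation (\<lambda>w. (norm (X w))\<^sup>2)"

lemma expectation_mult_coord_le:
  assumes [measurable]: "G \<in> borel_measurable P" and "\<And>w. \<bar>G w\<bar> \<le> norm (X w)"
  shows "\<bar>expectation (\<lambda>w. G w * apply_bcontfun (X w) t)\<bar> \<le> R_bound"
proof -
  have "\<bar>expectation (\<lambda>w. G w * apply_bcontfun (X w) t)\<bar> \<le> expectation (\<lambda>w. \<bar>G w * apply_bcontfun (X w) t\<bar>)"
    by (rule integral_abs_bound)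
  also have "\<dots> \<le> R_bound" unfolding R_bound_def using assms(2)
    by (intro integral_mono integrable_norm_sq integrable_norm_sq_bound[of _ 1]) (auto simp: abs_mult_coord_le)
  finally show ?thesis .
qed

lemma R_le: "\<bar>R s t\<bar> \<le> R_bound"
  unfolding cov_kernel_def by (rule expectation_mult_coord_le) (auto simp: coord_le_norm)

text \<open>Dominated convergence with majorant \<open>(norm (X w))\<^sup>2\<close>. The factor
  \<open>G\<close> is an evaluation for the kernel and an average for the potentials.\<close>

lemma continuous_expectation_mult_coord:
  assumes [measurable]: "G \<in> borel_measurable P" and G: "\<And>w. \<bar>G w\<bar> \<le> norm (X w)"
  shows "continuous_on UNIV (\<lambda>t. expectation (\<lambda>w. G w * apply_bcontfun (X w) t))"
  unfolding continuous_on_sequentially o_def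
proof (intro allI ballI impI, elim conjE)
  fix a :: 'k and s :: "nat \<Rightarrow> 'k" assume s: "s \<longlonglongrightarrow> a"
  show "(\<lambda>n. expectation (\<lambda>w. G w * apply_bcontfun (X w) (s n))) \<longlonglongrightarrow> expectation (\<lambda>w. G w * apply_bcontfun (X w) a)"
  proof (rule integral_dominated_convergence[where w = "\<lambda>w. (norm (X w))\<^sup>2"])
    show "AE w in P. (\<lambda>n. G w * apply_bcontfun (X w) (s n)) \<longlonglongrightarrow> G w * apply_bcontfun (X w) a"
      by (intro AE_I2 tendsto_intros continuous_on_tendsto_compose[OF continuous_on_apply_bcontfun[of UNIV]] s) auto
  qed (auto simp: integrable_norm_sq abs_mult_coord_le G)
qed

lemma R_continuous: "continuous_on UNIV (R s)"
  unfolding cov_kernel_def by (rule continuous_expectation_mult_coord) (auto simp: coord_le_norm)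

lemma R_measurable [measurable]: "(\<lambda>(s, t). R s t) \<in> borel_measurable (borel \<Otimes>\<^sub>M borel)"
proof (rule caratheodory_measurable[OF compact_K])
  show "continuous_on UNIV (\<lambda>s. R s t)" for t using R_continuous[of t] by (simp add: R_sym)
  show "R s \<in> borel_measurable borel" for s by (rule borel_measurable_continuous_onI[OF R_continuous])
qed

lemma R_measurable1 [measurable]: "R s \<in> borel_measurable borel" "(\<lambda>s. R s t) \<in> borel_measurable borel"
  using borel_measurable_continuous_onI[OF R_continuous[of s]] borel_measurable_continuous_onI[OF R_continuous[of t]]
  by (auto simp: R_sym)

lemma X_jointly_measurable: "(\<lambda>(t, w). apply_bcontfun (X w) t) \<in> borel_measurable (borel \<Otimes>\<^sub>M P)"
  by (rule caratheodory_measurable[OF compact_K]) auto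

definition averaged :: "'k measure \<Rightarrow> 'w \<Rightarrow> real" where
  "averaged \<eta> w = (\<integral>t. apply_bcontfun (X w) t \<partial>\<eta>)"

lemma prob_measuresD:
  assumes "\<eta> \<in> prob_measures" shows "prob_space \<eta>" "sets \<eta> = sets borel" "space \<eta> = UNIV"
  using assms sets_eq_imp_space_eq[of \<eta> borel] by (auto simp: prob_measures_def)

lemma bcontfun_integrable:
  assumes "\<eta> \<in> prob_measures" shows "integrable \<eta> (apply_bcontfun (f :: 'k \<Rightarrow>\<^sub>C real))"
proof -
  interpret \<eta>: prob_space \<eta> using prob_measuresD[OF assms] by blast
  have [measurable_cong]: "sets \<eta> = sets borel" using prob_measuresD[OF assms] by blast
  have "apply_bcontfun f \<in> borel_measurable borel" by (intro borel_measurable_continuous_onI) simp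
  then show ?thesis
    using norm_bounded[of f] by (intro \<eta>.integrable_const_bound[of _ "norm f"]) auto
qed

lemma averaged_le_norm:
  assumes "\<eta> \<in> prob_measures" shows "\<bar>averaged \<eta> w\<bar> \<le> norm (X w)"
proof -
  interpret \<eta>: prob_space \<eta> using prob_measuresD[OF assms] by blast
  have "\<bar>averaged \<eta> w\<bar> \<le> (\<integral>t. \<bar>apply_bcontfun (X w) t\<bar> \<partial>\<eta>)"
    unfolding averaged_def by (rule integral_abs_bound)
  also have "\<dots> \<le> (\<integral>t. norm (X w) \<partial>\<eta>)"
    by (intro integral_mono bcontfun_integrable integrable_abs assms coord_le_norm) auto
  finally show ?thesis by (simp add: \<eta>.prob_space)
qed

lemma path_min_le_averaged:
  assumes "\<eta> \<in> prob_measures" shows "path_min (X w) \<le> averaged \<eta> w"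
proof -
  interpret \<eta>: prob_space \<eta> using prob_measuresD[OF assms] by blast
  have "(\<integral>t. path_min (X w) \<partial>\<eta>) \<le> averaged \<eta> w"
    unfolding averaged_def by (intro integral_mono bcontfun_integrable assms path_min_le) auto
  then show ?thesis by (simp add: \<eta>.prob_space)
qed

lemma averaged_measurable [measurable]:
  assumes "\<eta> \<in> prob_measures" shows "averaged \<eta> \<in> borel_measurable P"
proof -
  interpret \<eta>: prob_space \<eta> using prob_measuresD[OF assms] by blast
  have s[measurable_cong]: "sets \<eta> = sets borel" using prob_measuresD[OF assms] by blast
  have "(\<lambda>(w, t). apply_bcontfun (X w) t) \<in> borel_measurable (P \<Otimes>\<^sub>M \<eta>)"
    using measurable_compose[OF measurable_pair_swap' X_jointly_measurable]
    by (simp add: case_prod_beta cong: measurable_cong_sets)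
  then show ?thesis unfolding averaged_def[abs_def] by (rule \<eta>.borel_measurable_lebesgue_integral)
qed

text \<open>Fubini, justified by the uniform bound \<open>R_bound\<close>. With \<open>G\<close> an
  evaluation it represents the potential as a covariance, and with \<open>G\<close> the average
  itself it represents the energy as a second moment.\<close>

lemma integral_expectation_mult:
  assumes \<eta>: "\<eta> \<in> prob_measures" and [measurable]: "G \<in> borel_measurable P" and G: "\<And>w. \<bar>G w\<bar> \<le> norm (X w)"
  shows "(\<integral>t. expectation (\<lambda>w. G w * apply_bcontfun (X w) t) \<partial>\<eta>) = expectation (\<lambda>w. G w * averaged \<eta> w)"
proof -
  interpret \<eta>: prob_space \<eta> using prob_measuresD[OF \<eta>] by blast
  have s[measurable_cong]: "sets \<eta> = sets borel" using prob_measuresD[OF \<eta>] by blast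
  interpret PP: pair_prob_space \<eta> P ..
  have [measurable]: "(\<lambda>(t, w). apply_bcontfun (X w) t) \<in> borel_measurable (\<eta> \<Otimes>\<^sub>M P)"
    using X_jointly_measurable by (simp cong: measurable_cong_sets)
  have m: "(\<lambda>(t, w). G w * apply_bcontfun (X w) t) \<in> borel_measurable (\<eta> \<Otimes>\<^sub>M P)" by measurable
  have "integrable (\<eta> \<Otimes>\<^sub>M P) (\<lambda>(t, w). G w * apply_bcontfun (X w) t)"
  proof (rule PP.Fubini_integrable[OF m])
    have i: "integrable P (\<lambda>w. G w * apply_bcontfun (X w) t)" for t
      by (rule integrable_norm_sq_bound[of _ 1]) (auto simp: abs_mult_coord_le G)
    then show "AE t in \<eta>. integrable P (\<lambda>w. case (t, w) of (t, w) \<Rightarrow> G w * apply_bcontfun (X w) t)" by simp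
    have "expectation (\<lambda>w. norm (G w * apply_bcontfun (X w) t)) \<le> R_bound" for t
      unfolding R_bound_def using i[of t]
      by (intro integral_mono integrable_norm_sq) (auto simp: abs_mult_coord_le G)
    moreover have "(\<lambda>t. expectation (\<lambda>w. norm (G w * apply_bcontfun (X w) t))) \<in> borel_measurable \<eta>"
      using m by measurable
    ultimately show "integrable \<eta> (\<lambda>t. expectation (\<lambda>w. norm (case (t, w) of (t, w) \<Rightarrow> G w * apply_bcontfun (X w) t)))"
      by (intro \<eta>.integrable_const_bound[of _ R_bound]) auto
  qed
  then have "(\<integral>t. expectation (\<lambda>w. G w * apply_bcontfun (X w) t) \<partial>\<eta>)
      = expectation (\<lambda>w. \<integral>t. G w * apply_bcontfun (X w) t \<partial>\<eta>)"
    by (rule PP.Fubini_integral[symmetric])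
  then show ?thesis by (simp add: averaged_def)
qed

lemma potential_eq:
  assumes \<eta>: "\<eta> \<in> prob_measures"
  shows "potential R \<eta> t = expectation (\<lambda>w. averaged \<eta> w * apply_bcontfun (X w) t)"
proof -
  have "R s t = expectation (\<lambda>w. apply_bcontfun (X w) t * apply_bcontfun (X w) s)" for s
    by (simp add: cov_kernel_def mult.commute)
  then have "potential R \<eta> t = expectation (\<lambda>w. apply_bcontfun (X w) t * averaged \<eta> w)"
    unfolding potential_def
    using integral_expectation_mult[OF \<eta>, of "\<lambda>w. apply_bcontfun (X w) t"] by (simp add: coord_le_norm)
  then show ?thesis by (simp add: mult.commute)
qed

lemma energy_eq_integral_potential:
  assumes \<eta>: "\<eta> \<in> prob_measures"
  shows "energy R \<eta> = (\<integral>t. potential R \<eta> t \<partial>\<eta>)"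
proof -
  interpret \<eta>: prob_space \<eta> using prob_measuresD[OF \<eta>] by blast
  have s[measurable_cong]: "sets \<eta> = sets borel" using prob_measuresD[OF \<eta>] by blast
  interpret PP: pair_prob_space \<eta> \<eta> ..
  have "(\<lambda>(s, t). R s t) \<in> borel_measurable (\<eta> \<Otimes>\<^sub>M \<eta>)"
    using R_measurable by (simp cong: measurable_cong_sets sets_pair_measure_cong)
  then have "integrable (\<eta> \<Otimes>\<^sub>M \<eta>) (\<lambda>(s, t). R s t)"
    using R_le by (intro PP.integrable_const_bound[of _ R_bound]) auto
  from PP.integral_snd[OF this] show ?thesis unfolding energy_def potential_def by simp
qed

text \<open>As a second moment the energy is nonnegative, and it becomes the variance in the normal
  law of the average.\<close>

lemma energy_eq:
  assumes \<eta>: "\<eta> \<in> prob_measures"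
  shows "energy R \<eta> = expectation (\<lambda>w. (averaged \<eta> w)\<^sup>2)"
  unfolding energy_eq_integral_potential[OF \<eta>] potential_eq[OF \<eta>]
  using integral_expectation_mult[OF \<eta> averaged_measurable[OF \<eta>] averaged_le_norm[OF \<eta>]]
  by (simp add: power2_eq_square)

lemma potential_continuous:
  assumes "\<eta> \<in> prob_measures" shows "continuous_on UNIV (potential R \<eta>)"
  unfolding potential_eq[OF assms, abs_def]
  by (intro continuous_expectation_mult_coord averaged_measurable averaged_le_norm assms)

lemma potential_le:
  assumes "\<eta> \<in> prob_measures" shows "\<bar>potential R \<eta> t\<bar> \<le> R_bound"
  unfolding potential_eq[OF assms]
  by (intro expectation_mult_coord_le averaged_measurable averaged_le_norm assms)

text \<open>The potential as an element of the path space, so that paths can be shifted along it;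
  \<open>pot_apply\<close> justifies the coercion for probability measures.\<close>

definition pot :: "'k measure \<Rightarrow> 'k \<Rightarrow>\<^sub>C real" where
  "pot \<eta> = Bcontfun (potential R \<eta>)"

lemma pot_apply:
  assumes "\<eta> \<in> prob_measures" shows "apply_bcontfun (pot \<eta>) = potential R \<eta>"
  unfolding pot_def using potential_continuous[OF assms] potential_le[OF assms]
  by (intro Bcontfun_inverse bcontfun_normI[of _ R_bound]) auto

text \<open>Pointwise limits with a common bound by a multiple of the norm: strong enough for
  dominated convergence of second moments and characteristic functions, so Gaussianity passes from
  finite combinations to averages.\<close>

definition gaussian_closure :: "('w \<Rightarrow> real) set" where
  "gaussian_closure = {S. \<exists>Sn C. (\<forall>n :: nat. Sn n \<in> lin_comb) \<and> (\<forall>n w. \<bar>Sn n w\<bar> \<le> C * norm (X w))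
      \<and> (\<forall>w. (\<lambda>n. Sn n w) \<longlonglongrightarrow> S w)}"

lemma lin_comb_bound:
  assumes "S \<in> lin_comb" obtains C where "\<And>w. \<bar>S w\<bar> \<le> C * norm (X w)"
proof -
  obtain F c where F: "finite F" and S: "S = (\<lambda>w. \<Sum>t\<in>F. c t * apply_bcontfun (X w) t)"
    using assms unfolding lin_comb_def by blast
  have "\<bar>S w\<bar> \<le> (\<Sum>t\<in>F. \<bar>c t\<bar>) * norm (X w)" for w
    unfolding S sum_distrib_right using coord_le_norm
    by (intro order_trans[OF sum_abs] sum_mono) (auto simp: abs_mult intro!: mult_left_mono)
  then show ?thesis by (rule that)
qed

lemma gaussian_closure_lin_comb:
  assumes "S \<in> lin_comb" shows "S \<in> gaussian_closure"
proof -
  obtain C where "\<And>w. \<bar>S w\<bar> \<le> C * norm (X w)" using lin_comb_bound[OF assms] by blast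
  then show ?thesis using assms unfolding gaussian_closure_def
    by (intro CollectI exI[of _ "\<lambda>_. S"] exI[of _ C]) auto
qed

lemma gaussian_closure_add:
  assumes "S \<in> gaussian_closure" "S' \<in> gaussian_closure"
  shows "(\<lambda>w. S w + S' w) \<in> gaussian_closure"
proof -
  obtain Sn C where 1: "\<And>n. Sn n \<in> lin_comb" "\<And>n w. \<bar>Sn n w\<bar> \<le> C * norm (X w)" "\<And>w. (\<lambda>n. Sn n w) \<longlonglongrightarrow> S w"
    using assms(1) unfolding gaussian_closure_def by blast
  obtain Sn' C' where 2: "\<And>n. Sn' n \<in> lin_comb" "\<And>n w. \<bar>Sn' n w\<bar> \<le> C' * norm (X w)" "\<And>w. (\<lambda>n. Sn' n w) \<longlonglongrightarrow> S' w"
    using assms(2) unfolding gaussian_closure_def by blast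
  have "\<bar>Sn n w + Sn' n w\<bar> \<le> (C + C') * norm (X w)" for n w
    using 1(2)[of n w] 2(2)[of n w] by (simp add: distrib_right)
  then show ?thesis unfolding gaussian_closure_def using 1 2
    by (intro CollectI exI[of _ "\<lambda>n w. Sn n w + Sn' n w"] exI[of _ "C + C'"])
      (auto intro!: lin_comb_add tendsto_add)
qed

lemma gaussian_closure_scale:
  assumes "S \<in> gaussian_closure" shows "(\<lambda>w. a * S w) \<in> gaussian_closure"
proof -
  obtain Sn C where 1: "\<And>n. Sn n \<in> lin_comb" "\<And>n w. \<bar>Sn n w\<bar> \<le> C * norm (X w)" "\<And>w. (\<lambda>n. Sn n w) \<longlonglongrightarrow> S w"
    using assms(1) unfolding gaussian_closure_def by blast
  have "\<bar>a * Sn n w\<bar> \<le> (\<bar>a\<bar> * C) * norm (X w)" for n w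
    using mult_left_mono[OF 1(2)[of n w], of "\<bar>a\<bar>"] by (simp add: abs_mult mult.assoc)
  then show ?thesis unfolding gaussian_closure_def using 1
    by (intro CollectI exI[of _ "\<lambda>n w. a * Sn n w"] exI[of _ "\<bar>a\<bar> * C"])
      (auto intro!: lin_comb_scale tendsto_mult)
qed

lemma gaussian_closure_measurable: "S \<in> gaussian_closure \<Longrightarrow> S \<in> borel_measurable P"
proof -
  assume "S \<in> gaussian_closure"
  then obtain Sn where S: "\<And>n :: nat. Sn n \<in> lin_comb" "\<And>w. (\<lambda>n. Sn n w) \<longlonglongrightarrow> S w"
    unfolding gaussian_closure_def by blast
  show ?thesis
    by (rule borel_measurable_LIMSEQ_real[where u = Sn])
      (auto intro: S borel_measurable_integrable[OF lin_comb_integrable(1)])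
qed

lemma gaussian_closure_char:
  assumes "S \<in> gaussian_closure"
  shows "integrable P (\<lambda>w. (S w)\<^sup>2)"
    and "(CLINT w|P. iexp (S w)) = exp (- (expectation (\<lambda>w. (S w)\<^sup>2) / 2))"
proof -
  obtain Sn C where S: "\<And>n. Sn n \<in> lin_comb" "\<And>n w. \<bar>Sn n w\<bar> \<le> C * norm (X w)" "\<And>w. (\<lambda>n. Sn n w) \<longlonglongrightarrow> S w"
    using assms(1) unfolding gaussian_closure_def by blast
  have [measurable]: "Sn n \<in> borel_measurable P" "S \<in> borel_measurable P" for n
    using lin_comb_integrable(1)[OF S(1)] gaussian_closure_measurable[OF assms] by auto
  have sq: "(Sn n w)\<^sup>2 \<le> C\<^sup>2 * (norm (X w))\<^sup>2" for n w
    using power_mono[OF S(2)[of n w], of 2] by (simp add: power_mult_distrib)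
  have i: "integrable P (\<lambda>w. C\<^sup>2 * (norm (X w))\<^sup>2)" using integrable_norm_sq by simp
  show "integrable P (\<lambda>w. (S w)\<^sup>2)"
    by (rule integrable_dominated_convergence[where s = "\<lambda>n w. (Sn n w)\<^sup>2" and w = "\<lambda>w. C\<^sup>2 * (norm (X w))\<^sup>2"])
      (use i sq S(3) in \<open>auto intro!: tendsto_power\<close>)
  have lim: "(\<lambda>n. expectation (\<lambda>w. (Sn n w)\<^sup>2)) \<longlonglongrightarrow> expectation (\<lambda>w. (S w)\<^sup>2)"
    by (rule integral_dominated_convergence[where w = "\<lambda>w. C\<^sup>2 * (norm (X w))\<^sup>2"])
      (use i sq S(3) in \<open>auto intro!: tendsto_power\<close>)
  have "(\<lambda>n. CLINT w|P. iexp (Sn n w)) \<longlonglongrightarrow> (CLINT w|P. iexp (S w))"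
    by (rule integral_dominated_convergence[where w = "\<lambda>_. 1"])
      (use S(3) in \<open>auto intro!: tendsto_intros\<close>)
  moreover have "(\<lambda>n. CLINT w|P. iexp (Sn n w)) \<longlonglongrightarrow> exp (- (expectation (\<lambda>w. (S w)\<^sup>2) / 2))"
    unfolding lin_comb_char[OF S(1)] by (intro tendsto_intros lim) simp
  ultimately show "(CLINT w|P. iexp (S w)) = exp (- (expectation (\<lambda>w. (S w)\<^sup>2) / 2))"
    by (rule LIMSEQ_unique)
qed

text \<open>The approximants are Riemann sums: with the integration variable rounded to finitely
  many points, the average is a finite linear combination of evaluations, and continuity of the path
  gives convergence.\<close>

lemma averaged_gaussian_closure:
  assumes \<eta>: "\<eta> \<in> prob_measures" shows "averaged \<eta> \<in> gaussian_closure"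
proof -
  interpret \<eta>: prob_space \<eta> using prob_measuresD[OF \<eta>] by blast
  have s[measurable_cong]: "sets \<eta> = sets borel" using prob_measuresD[OF \<eta>] by blast
  obtain p :: "nat \<Rightarrow> 'k \<Rightarrow> 'k" where p: "\<And>n. p n \<in> measurable borel (count_space UNIV)"
      "\<And>n. finite (range (p n))" "\<And>t. (\<lambda>n. p n t) \<longlonglongrightarrow> t"
    by (rule compact_discretizations[OF compact_K]) blast
  note [measurable] = p(1)
  define Sn where "Sn n w = (\<Sum>x\<in>range (p n). measure \<eta> {s\<in>space \<eta>. p n s = x} * apply_bcontfun (X w) x)" for n w
  have Sn: "Sn n w = (\<integral>s. apply_bcontfun (X w) (p n s) \<partial>\<eta>)" for n w
  proof -
    have "(\<integral>s. apply_bcontfun (X w) (p n s) \<partial>\<eta>)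
        = (\<integral>s. (\<Sum>x\<in>range (p n). apply_bcontfun (X w) x * indicator {s\<in>space \<eta>. p n s = x} s) \<partial>\<eta>)"
    proof (rule Bochner_Integration.integral_cong)
      fix s assume "s \<in> space \<eta>"
      then have "(\<Sum>x\<in>range (p n). apply_bcontfun (X w) x * indicator {s\<in>space \<eta>. p n s = x} s)
          = (\<Sum>x\<in>range (p n). if p n s = x then apply_bcontfun (X w) x else 0)"
        by (intro sum.cong) auto
      then show "apply_bcontfun (X w) (p n s)
          = (\<Sum>x\<in>range (p n). apply_bcontfun (X w) x * indicator {s\<in>space \<eta>. p n s = x} s)"
        using p(2)[of n] by (simp add: sum.delta')
    qed simp
    also have "\<dots> = Sn n w" unfolding Sn_def
      by (subst Bochner_Integration.integral_sum) (auto simp: mult.commute intro!: \<eta>.integrable_const_bound[of _ "1"] sum.cong)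
    finally show ?thesis by simp
  qed
  have m: "(\<lambda>s. apply_bcontfun (X w) (p n s)) \<in> borel_measurable \<eta>" for n w
    unfolding measurable_cong_sets[OF s refl] by (rule measurable_compose[OF p(1)]) simp
  have "Sn n \<in> lin_comb" for n unfolding Sn_def by (rule lin_comb_sum[OF p(2)])
  moreover have "\<bar>Sn n w\<bar> \<le> 1 * norm (X w)" for n w
  proof -
    have "\<bar>Sn n w\<bar> \<le> (\<integral>s. \<bar>apply_bcontfun (X w) (p n s)\<bar> \<partial>\<eta>)" unfolding Sn by (rule integral_abs_bound)
    also have "\<dots> \<le> (\<integral>s. norm (X w) \<partial>\<eta>)"
      using m coord_le_norm by (intro integral_mono \<eta>.integrable_const_bound[of _ "norm (X w)"]) auto
    finally show ?thesis by (simp add: \<eta>.prob_space)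
  qed
  moreover have "(\<lambda>n. Sn n w) \<longlonglongrightarrow> averaged \<eta> w" for w
    unfolding Sn averaged_def
  proof (rule integral_dominated_convergence[where w = "\<lambda>_. norm (X w)"])
    show "AE s in \<eta>. (\<lambda>n. apply_bcontfun (X w) (p n s)) \<longlonglongrightarrow> apply_bcontfun (X w) s"
      by (intro AE_I2 continuous_on_tendsto_compose[OF continuous_on_apply_bcontfun[of UNIV]] p) auto
    show "apply_bcontfun (X w) \<in> borel_measurable \<eta>"
      using bcontfun_integrable[OF \<eta>] by auto
  qed (use m coord_le_norm in auto)
  ultimately show ?thesis unfolding gaussian_closure_def by blast
qed

end

section \<open>The Cameron-Martin formula in the direction of a potential\<close>

lemma (in prob_space) cameron_martin_real:
  fixes g :: "real \<Rightarrow> ennreal"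
  assumes s: "s > 0" and D: "distributed M lborel Y (normal_density 0 s)"
    and [measurable]: "g \<in> borel_measurable borel"
  shows "(\<integral>\<^sup>+ w. g (Y w) * ennreal (exp (h * Y w - h\<^sup>2 * s\<^sup>2 / 2)) \<partial>M) = (\<integral>\<^sup>+ w. g (Y w + h * s\<^sup>2) \<partial>M)"
proof -
  \<comment> \<open>Completing the square: the weight converts the density at the shifted point into
    the density at the original one.\<close>
  have dens: "normal_density 0 s (y + h * s\<^sup>2) * exp (h * (y + h * s\<^sup>2) - h\<^sup>2 * s\<^sup>2 / 2) = normal_density 0 s y" for y
  proof -
    have "- (y + h * s\<^sup>2)\<^sup>2 / (2 * s\<^sup>2) + (h * (y + h * s\<^sup>2) - h\<^sup>2 * s\<^sup>2 / 2) = - y\<^sup>2 / (2 * s\<^sup>2)"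
      using s by (simp add: field_simps power2_eq_square)
    then show ?thesis unfolding normal_density_def
      by (simp add: exp_add[symmetric] mult.assoc)
  qed
  have "(\<integral>\<^sup>+ w. g (Y w) * ennreal (exp (h * Y w - h\<^sup>2 * s\<^sup>2 / 2)) \<partial>M)
      = (\<integral>\<^sup>+ y. ennreal (normal_density 0 s y) * (g y * ennreal (exp (h * y - h\<^sup>2 * s\<^sup>2 / 2))) \<partial>lborel)"
    by (rule distributed_nn_integral[OF D, symmetric]) measurable
  also have "\<dots> = (\<integral>\<^sup>+ y. ennreal (normal_density 0 s (h * s\<^sup>2 + 1 * y)) * (g (h * s\<^sup>2 + 1 * y)
      * ennreal (exp (h * (h * s\<^sup>2 + 1 * y) - h\<^sup>2 * s\<^sup>2 / 2))) \<partial>lborel)"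
    by (subst nn_integral_real_affine[where c = 1 and t = "h * s\<^sup>2"]) simp_all
  also have "\<dots> = (\<integral>\<^sup>+ y. ennreal (normal_density 0 s y) * g (y + h * s\<^sup>2) \<partial>lborel)"
  proof (rule nn_integral_cong)
    fix y
    have "ennreal (normal_density 0 s y) = ennreal (normal_density 0 s (h * s\<^sup>2 + 1 * y))
        * ennreal (exp (h * (h * s\<^sup>2 + 1 * y) - h\<^sup>2 * s\<^sup>2 / 2))"
      unfolding dens[of y, symmetric] by (simp add: ennreal_mult add.commute)
    then show "ennreal (normal_density 0 s (h * s\<^sup>2 + 1 * y)) * (g (h * s\<^sup>2 + 1 * y)
      * ennreal (exp (h * (h * s\<^sup>2 + 1 * y) - h\<^sup>2 * s\<^sup>2 / 2))) = ennreal (normal_density 0 s y) * g (y + h * s\<^sup>2)"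
      by (simp add: ac_simps)
  qed
  also have "\<dots> = (\<integral>\<^sup>+ w. g (Y w + h * s\<^sup>2) \<partial>M)"
    by (rule distributed_nn_integral[OF D]) measurable
  finally show ?thesis .
qed

text \<open>The average is carried as an extra real coordinate beside the path, so that weights in
  the average and functions of the path are measurable for one sigma-algebra.\<close>

definition joint_coord :: "unit + 'k \<Rightarrow> real \<times> ('k::topological_space \<Rightarrow>\<^sub>C real) \<Rightarrow> real" where
  "joint_coord i z = (case i of Inl _ \<Rightarrow> fst z | Inr t \<Rightarrow> apply_bcontfun (snd z) t)"

lemma joint_coord_measurable:
  "fst \<in> borel_measurable (coordinate_algebra joint_coord)"
  "(\<lambda>z. apply_bcontfun (snd z) t) \<in> borel_measurable (coordinate_algebra joint_coord)"
  using measurable_coordinate[of joint_coord "Inl ()"] measurable_coordinate[of joint_coord "Inr t"]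
  by (simp_all add: joint_coord_def[abs_def] fst_def[abs_def])

lemma measurable_to_joint:
  assumes "f \<in> borel_measurable N" "\<And>t. (\<lambda>w. apply_bcontfun (g w) t) \<in> borel_measurable N"
  shows "(\<lambda>w. (f w, g w)) \<in> measurable N (coordinate_algebra joint_coord)"
  using assms by (intro measurable_to_coordinate_algebra, rename_tac i, case_tac i) (simp_all add: joint_coord_def)

context compact_gaussian_path
begin

lemma averaged_scaled_char:
  assumes \<eta>: "\<eta> \<in> prob_measures"
  shows "(CLINT w|P. iexp (a * averaged \<eta> w)) = exp (- (a\<^sup>2 * energy R \<eta> / 2))"
  using gaussian_closure_char(2)[OF gaussian_closure_scale[OF averaged_gaussian_closure[OF \<eta>], of a]]
  by (simp add: energy_eq[OF \<eta>] power_mult_distrib)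

lemma averaged_distributed:
  assumes \<eta>: "\<eta> \<in> prob_measures" and v: "energy R \<eta> > 0"
  shows "distributed P lborel (averaged \<eta>) (normal_density 0 (sqrt (energy R \<eta>)))"
proof -
  let ?s = "sqrt (energy R \<eta>)"
  have s: "?s > 0" using v by simp
  note [measurable] = averaged_measurable[OF \<eta>]
  have "distr P borel (\<lambda>w. averaged \<eta> w / ?s) = std_normal_distribution"
  proof (rule Levy_uniqueness)
    show "real_distribution (distr P borel (\<lambda>w. averaged \<eta> w / ?s))"
      by (rule real_distribution_distr) measurable
    show "real_distribution std_normal_distribution" by (rule real_dist_normal_dist)
    show "char (distr P borel (\<lambda>w. averaged \<eta> w / ?s)) = char std_normal_distribution"
    proof
      fix a
      have "char (distr P borel (\<lambda>w. averaged \<eta> w / ?s)) a = (CLINT w|P. iexp ((a / ?s) * averaged \<eta> w))"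
        unfolding char_def by (subst integral_distr) auto
      also have "\<dots> = exp (- (a\<^sup>2 / 2))"
        unfolding averaged_scaled_char[OF \<eta>] using v by (simp add: power_divide)
      finally show "char (distr P borel (\<lambda>w. averaged \<eta> w / ?s)) a = char std_normal_distribution a"
        by (simp add: char_std_normal_distribution)
    qed
  qed
  then have "distributed P lborel (\<lambda>w. (averaged \<eta> w - 0) / ?s) std_normal_density"
    unfolding distributed_def by (simp cong: distr_cong)
  then show ?thesis using normal_standard_normal_convert[OF s, of "averaged \<eta>" 0] by simp
qed

text \<open>The residual \<open>X - (Y / v) k\<close> is uncorrelated with the average \<open>Y\<close>, so an independent
  copy of \<open>Y\<close> can be put in its place.\<close>

lemma decomposition_law:
  assumes \<eta>: "\<eta> \<in> prob_measures" and v: "energy R \<eta> > 0"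
  defines "v \<equiv> energy R \<eta>"
  shows "distr P (coordinate_algebra joint_coord) (\<lambda>w. (averaged \<eta> w, X w))
   = distr (P \<Otimes>\<^sub>M P) (coordinate_algebra joint_coord)
       (\<lambda>(w, w'). (averaged \<eta> w, X w' + ((averaged \<eta> w - averaged \<eta> w') / v) *\<^sub>R pot \<eta>))"
proof (rule distr_coordinate_algebra_eqI)
  interpret PP: pair_prob_space P P ..
  note [measurable] = averaged_measurable[OF \<eta>]
  show "prob_space P" "prob_space (P \<Otimes>\<^sub>M P)" by (rule prob_space_axioms PP.prob_space_axioms)+
  fix i show "(\<lambda>w. joint_coord i (averaged \<eta> w, X w)) \<in> borel_measurable P"
    "(\<lambda>w. joint_coord i (case w of (w, w') \<Rightarrow> (averaged \<eta> w, X w' + ((averaged \<eta> w - averaged \<eta> w') / v) *\<^sub>R pot \<eta>)))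
        \<in> borel_measurable (P \<Otimes>\<^sub>M P)"
    by (cases i; simp add: joint_coord_def case_prod_beta; measurable)+
next
  note [measurable] = averaged_measurable[OF \<eta>]
  have v: "v > 0" using v by (simp add: v_def)
  fix J :: "(unit + 'k) set" and c :: "unit + 'k \<Rightarrow> real" assume J: "finite J"
  define F where "F = Inl -` J" define G where "G = Inr -` J"
  have FG: "finite F" "finite G" "J = F <+> G"
    unfolding F_def G_def using J by (auto intro!: finite_vimageI simp: Plus_def) (metis sum.exhaust rangeI)+
  let ?Y = "averaged \<eta>"
  define a where "a = (\<Sum>x\<in>F. c (Inl x))"
  \<comment> \<open>The regression coefficient of \<open>A\<close> on the average: \<open>A\<close>
    has covariance \<open>b * v\<close> with it, so that \<open>A - b * ?Y\<close> is uncorrelated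
    with \<open>?Y\<close>.\<close>
  define b where "b = (\<Sum>t\<in>G. c (Inr t) * potential R \<eta> t) / v"
  define A where "A w = (\<Sum>t\<in>G. c (Inr t) * apply_bcontfun (X w) t)" for w
  have Acl: "A \<in> gaussian_closure"
    unfolding A_def by (intro gaussian_closure_lin_comb lin_comb_sum FG)
  note Ycl = averaged_gaussian_closure[OF \<eta>]
  have [measurable]: "A \<in> borel_measurable P" by (rule gaussian_closure_measurable[OF Acl])
  have i: "integrable P (\<lambda>w. ?Y w * apply_bcontfun (X w) t)" for t
    by (rule integrable_norm_sq_bound[of _ 1]) (auto simp: abs_mult_coord_le averaged_le_norm[OF \<eta>])
  have iYA: "integrable P (\<lambda>w. ?Y w * A w)"
    unfolding A_def sum_distrib_left using i by (auto simp: mult.left_commute)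
  have YA: "expectation (\<lambda>w. ?Y w * A w) = b * v"
  proof -
    have "expectation (\<lambda>w. ?Y w * A w) = (\<Sum>t\<in>G. c (Inr t) * expectation (\<lambda>w. ?Y w * apply_bcontfun (X w) t))"
      unfolding A_def sum_distrib_left using i by (subst Bochner_Integration.integral_sum) (auto simp: mult.left_commute)
    then show ?thesis using v by (simp add: b_def potential_eq[OF \<eta>])
  qed
  have iYY: "integrable P (\<lambda>w. (?Y w)\<^sup>2)" "integrable P (\<lambda>w. (A w)\<^sup>2)"
    by (rule gaussian_closure_char(1), fact)+
  have sq: "expectation (\<lambda>w. (p * ?Y w + A w)\<^sup>2) = p\<^sup>2 * v + 2 * p * (b * v) + expectation (\<lambda>w. (A w)\<^sup>2)" for p
  proof -
    have "(p * ?Y w + A w)\<^sup>2 = p\<^sup>2 * (?Y w)\<^sup>2 + 2 * p * (?Y w * A w) + (A w)\<^sup>2" for w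
      by (simp add: power2_eq_square algebra_simps)
    then show ?thesis using iYY iYA by (simp add: YA v_def energy_eq[OF \<eta>])
  qed
  have char: "(CLINT w|P. iexp (p * ?Y w + A w))
      = exp (- ((p\<^sup>2 * v + 2 * p * (b * v) + expectation (\<lambda>w. (A w)\<^sup>2)) / 2))" for p
    unfolding sq[symmetric]
    by (rule gaussian_closure_char(2)) (intro gaussian_closure_add gaussian_closure_scale Acl Ycl)
  have "(\<Sum>j\<in>J. c j * joint_coord j (y, x)) = a * y + (\<Sum>t\<in>G. c (Inr t) * apply_bcontfun x t)" for y x
    by (simp add: FG sum.Plus joint_coord_def a_def sum_distrib_right)
  note J_sum = this
  \<comment> \<open>The functional of the substituted pair splits into a part in \<open>w\<close>
    and a residual part in \<open>w'\<close>, to which independence on the product space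
    applies.\<close>
  have J_sum': "(\<Sum>j\<in>J. c j * joint_coord j (?Y w, X w' + ((?Y w - ?Y w') / v) *\<^sub>R pot \<eta>))
      = (a + b) * ?Y w + ((- b) * ?Y w' + A w')" for w w'
  proof -
    have "(\<Sum>t\<in>G. c (Inr t) * (apply_bcontfun (X w') t + (?Y w - ?Y w') / v * potential R \<eta> t))
        = A w' + (?Y w - ?Y w') / v * (\<Sum>t\<in>G. c (Inr t) * potential R \<eta> t)"
      unfolding A_def sum_distrib_left by (simp add: distrib_left sum.distrib mult.left_commute)
    also have "\<dots> = A w' + (?Y w - ?Y w') * b" by (simp add: b_def)
    finally show ?thesis unfolding J_sum by (simp add: pot_apply[OF \<eta>] algebra_simps)
  qed
  have "(CLINT z|P \<Otimes>\<^sub>M P. iexp ((a + b) * ?Y (fst z) + ((- b) * ?Y (snd z) + A (snd z))))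
      = exp (- (((a + b)\<^sup>2 * v + ((- b)\<^sup>2 * v + 2 * (- b) * (b * v) + expectation (\<lambda>w. (A w)\<^sup>2))) / 2))"
    by (rule pair_char_gaussian[of "\<lambda>w. (a + b) * ?Y w" "\<lambda>w. (- b) * ?Y w + A w"])
      (simp_all only: char averaged_scaled_char[OF \<eta>] v_def, measurable)
  moreover have "(a + b)\<^sup>2 * v + ((- b)\<^sup>2 * v + 2 * (- b) * (b * v) + expectation (\<lambda>w. (A w)\<^sup>2))
      = a\<^sup>2 * v + 2 * a * (b * v) + expectation (\<lambda>w. (A w)\<^sup>2)"
    by (simp add: power2_eq_square algebra_simps)
  ultimately have "(CLINT w|P. iexp (a * ?Y w + A w))
      = (CLINT z|P \<Otimes>\<^sub>M P. iexp ((a + b) * ?Y (fst z) + ((- b) * ?Y (snd z) + A (snd z))))"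
    by (simp only: char)
  then show "(CLINT w|P. iexp (\<Sum>j\<in>J. c j * joint_coord j (?Y w, X w)))
      = (CLINT z|P \<Otimes>\<^sub>M P. iexp (\<Sum>j\<in>J. c j * joint_coord j (case z of (w, w') \<Rightarrow>
          (?Y w, X w' + ((?Y w - ?Y w') / v) *\<^sub>R pot \<eta>))))"
    by (simp only: case_prod_beta J_sum' J_sum A_def[symmetric])
qed

text \<open>The decomposition places the average and the residual on independent factors. With the
  residual fixed, the path is an affine function of the average; the one-dimensional formula moves
  the average by \<open>h * v\<close> and thereby the path by \<open>h\<close> times the
  potential.\<close>

lemma cameron_martin:
  assumes \<eta>: "\<eta> \<in> prob_measures" and v: "energy R \<eta> > 0"
    and G: "G \<in> borel_measurable (coordinate_algebra joint_coord)"
  defines "v \<equiv> energy R \<eta>"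
  shows "(\<integral>\<^sup>+ w. G (averaged \<eta> w, X w) * ennreal (exp (h * averaged \<eta> w - h\<^sup>2 * v / 2)) \<partial>P)
    = (\<integral>\<^sup>+ w. G (averaged \<eta> w + h * v, X w + h *\<^sub>R pot \<eta>) \<partial>P)"
proof -
  interpret PP: pair_prob_space P P ..
  note [measurable] = averaged_measurable[OF \<eta>]
  let ?C = "coordinate_algebra joint_coord" and ?Y = "averaged \<eta>"
  let ?g = "\<lambda>(w, w'). (?Y w, X w' + ((?Y w - ?Y w') / v) *\<^sub>R pot \<eta>)"
  have v': "v > 0" and sv: "(sqrt v)\<^sup>2 = v" "sqrt v > 0" using v by (auto simp: v_def)
  have f: "(\<lambda>w. (?Y w, X w)) \<in> measurable P ?C"
    by (rule measurable_to_joint) measurable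
  have g: "?g \<in> measurable (P \<Otimes>\<^sub>M P) ?C"
    unfolding case_prod_beta by (rule measurable_to_joint) (simp_all, measurable)
  have law: "(\<integral>\<^sup>+ w. H (?Y w, X w) \<partial>P) = (\<integral>\<^sup>+ w'. \<integral>\<^sup>+ w. H (?g (w, w')) \<partial>P \<partial>P)"
    if H: "H \<in> borel_measurable ?C" for H :: "real \<times> ('k \<Rightarrow>\<^sub>C real) \<Rightarrow> ennreal"
  proof -
    have "(\<integral>\<^sup>+ w. H (?Y w, X w) \<partial>P) = (\<integral>\<^sup>+ z. H z \<partial>distr P ?C (\<lambda>w. (?Y w, X w)))"
      by (rule nn_integral_distr[OF f, symmetric]) (simp add: H)
    also have "\<dots> = (\<integral>\<^sup>+ z. H (?g z) \<partial>(P \<Otimes>\<^sub>M P))"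
      unfolding decomposition_law[OF \<eta> v, folded v_def] by (rule nn_integral_distr[OF g]) (simp add: H)
    also have "\<dots> = (\<integral>\<^sup>+ w'. \<integral>\<^sup>+ w. H (?g (w, w')) \<partial>P \<partial>P)"
      by (rule PP.nn_integral_snd[symmetric]) (rule measurable_compose[OF g H])
    finally show ?thesis .
  qed
  have ex: "(\<lambda>z. ennreal (exp (h * fst z - h\<^sup>2 * v / 2))) \<in> borel_measurable ?C"
    using joint_coord_measurable(1) by measurable
  have sh: "(\<lambda>z. (fst z + h * v, snd z + h *\<^sub>R pot \<eta>)) \<in> measurable ?C ?C"
    by (intro measurable_to_joint) (auto intro!: borel_measurable_add joint_coord_measurable)
  have "(\<integral>\<^sup>+ w. G (?Y w, X w) * ennreal (exp (h * ?Y w - h\<^sup>2 * v / 2)) \<partial>P)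
      = (\<integral>\<^sup>+ w'. \<integral>\<^sup>+ w. G (?g (w, w')) * ennreal (exp (h * ?Y w - h\<^sup>2 * v / 2)) \<partial>P \<partial>P)"
    using law[OF borel_measurable_times_ennreal[OF G ex]] by simp
  also have "\<dots> = (\<integral>\<^sup>+ w'. \<integral>\<^sup>+ w. G (?Y w + h * v, X w' + ((?Y w + h * v - ?Y w') / v) *\<^sub>R pot \<eta>) \<partial>P \<partial>P)"
  proof (rule nn_integral_cong)
    fix w'
    have "(\<lambda>y. (y, X w' + ((y - ?Y w') / v) *\<^sub>R pot \<eta>)) \<in> measurable borel ?C"
      by (rule measurable_to_joint) (simp_all, measurable)
    from measurable_compose[OF this G]
    show "(\<integral>\<^sup>+ w. G (?g (w, w')) * ennreal (exp (h * ?Y w - h\<^sup>2 * v / 2)) \<partial>P)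
        = (\<integral>\<^sup>+ w. G (?Y w + h * v, X w' + ((?Y w + h * v - ?Y w') / v) *\<^sub>R pot \<eta>) \<partial>P)"
      using cameron_martin_real[OF sv(2) averaged_distributed[OF \<eta> v, folded v_def], of _ h]
      unfolding sv by simp
  qed
  also have "\<dots> = (\<integral>\<^sup>+ w'. \<integral>\<^sup>+ w. G (fst (?g (w, w')) + h * v, snd (?g (w, w')) + h *\<^sub>R pot \<eta>) \<partial>P \<partial>P)"
  proof -
    have "X w' + ((?Y w + h * v - ?Y w') / v) *\<^sub>R pot \<eta> = X w' + ((?Y w - ?Y w') / v) *\<^sub>R pot \<eta> + h *\<^sub>R pot \<eta>" for w w'
      using v' by (simp add: add_divide_distrib diff_divide_distrib scaleR_add_left scaleR_diff_left)
    then show ?thesis by (simp add: add.assoc)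
  qed
  also have "\<dots> = (\<integral>\<^sup>+ w. G (?Y w + h * v, X w + h *\<^sub>R pot \<eta>) \<partial>P)"
    using law[OF measurable_compose[OF sh G]] by simp
  finally show ?thesis .
qed

end

section \<open>Integration by parts for the minimum\<close>

text \<open>The convex combination of the point mass at \<open>t\<close> and \<open>\<nu>\<close> is
  realized as the law of a point selected by an independent coin with bias \<open>e\<close>.\<close>

lemma bernoulli_mixture:
  fixes \<nu> :: "'k::metric_space measure"
  assumes \<nu>: "\<nu> \<in> prob_measures" and e: "0 \<le> e" "e \<le> 1"
  obtains \<eta> where "\<eta> \<in> prob_measures"
    "\<And>f :: 'k \<Rightarrow> real. f \<in> borel_measurable borel \<Longrightarrow> bounded (range f) \<Longrightarrow> (\<integral>s. f s \<partial>\<eta>) = e * f t + (1 - e) * (\<integral>s. f s \<partial>\<nu>)"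
proof -
  have s[measurable_cong]: "sets \<nu> = sets borel" using \<nu> by (simp add: prob_measures_def)
  interpret \<nu>: prob_space \<nu> using \<nu> by (simp add: prob_measures_def)
  interpret PP: pair_prob_space "measure_pmf (bernoulli_pmf e)" \<nu> ..
  let ?f = "\<lambda>z :: bool \<times> 'k. if fst z then t else snd z"
  have [measurable]: "?f \<in> measurable (measure_pmf (bernoulli_pmf e) \<Otimes>\<^sub>M \<nu>) borel" by measurable
  let ?\<eta> = "distr (measure_pmf (bernoulli_pmf e) \<Otimes>\<^sub>M \<nu>) borel ?f"
  show ?thesis
  proof (rule that)
    show "?\<eta> \<in> prob_measures" unfolding prob_measures_def by (auto intro: PP.prob_space_distr)
    fix f :: "'k \<Rightarrow> real" assume [measurable]: "f \<in> borel_measurable borel" and "bounded (range f)"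
    then obtain C where C: "\<And>s. \<bar>f s\<bar> \<le> C" by (auto simp: bounded_iff)
    have "(\<integral>s. f s \<partial>?\<eta>) = (\<integral>z. f (?f z) \<partial>(measure_pmf (bernoulli_pmf e) \<Otimes>\<^sub>M \<nu>))"
      by (rule integral_distr) measurable
    also have "\<dots> = (\<integral>b. \<integral>s. f (?f (b, s)) \<partial>\<nu> \<partial>measure_pmf (bernoulli_pmf e))"
      by (rule PP.integral_fst'[symmetric], rule PP.integrable_const_bound[of _ C]) (use C in auto)
    also have "\<dots> = e * f t + (1 - e) * (\<integral>s. f s \<partial>\<nu>)" using e by (simp add: \<nu>.prob_space)
    finally show "(\<integral>s. f s \<partial>?\<eta>) = e * f t + (1 - e) * (\<integral>s. f s \<partial>\<nu>)" .
  qed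
qed

section \<open>First-order optimality of the energy minimizer\<close>

context compact_gaussian_path
begin

lemma potential_measurable [measurable]:
  "\<eta> \<in> prob_measures \<Longrightarrow> potential R \<eta> \<in> borel_measurable borel"
  by (intro borel_measurable_continuous_onI potential_continuous)

lemma min_energy_le:
  assumes "\<eta> \<in> prob_measures" shows "min_energy R \<le> energy R \<eta>"
  unfolding min_energy_def
proof (rule cINF_lower[OF _ assms])
  show "bdd_below (energy R ` prob_measures)"
    by (rule bdd_belowI[of _ 0]) (auto simp: energy_eq)
qed

text \<open>First-order optimality: the energy does not decrease when mass moves from \<open>\<nu>\<close> to \<open>t\<close>.\<close>

lemma optimal_potential_ge:
  assumes opt: "optimal_measure R \<nu>"
  shows "min_energy R \<le> potential R \<nu> t"
proof (rule ccontr)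
  assume "\<not> min_energy R \<le> potential R \<nu> t"
  define v where "v = min_energy R"
  define k where "k = potential R \<nu> t"
  define d where "d = v - k"
  \<comment> \<open>Moving mass \<open>e\<close> to \<open>t\<close> changes the energy by
    \<open>- 2 * e * d + e\<^sup>2 * c\<close>. The choice of \<open>e\<close> below keeps
    \<open>e * c \<le> d\<close>, so the change would be negative.\<close>
  define c where "c = v + R t t - 2 * k"
  define e where "e = min 1 (d / (\<bar>c\<bar> + 1))"
  have d: "d > 0" using \<open>\<not> _\<close> by (simp add: d_def v_def k_def)
  then have e: "0 < e" "e \<le> 1" by (auto simp: e_def)
  have \<nu>: "\<nu> \<in> prob_measures" and v: "energy R \<nu> = v" using opt by (auto simp: optimal_measure_def v_def)
  obtain \<eta> where \<eta>: "\<eta> \<in> prob_measures" and I: "\<And>f :: 'k \<Rightarrow> real. f \<in> borel_measurable borel \<Longrightarrow> bounded (range f)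
      \<Longrightarrow> (\<integral>s. f s \<partial>\<eta>) = e * f t + (1 - e) * (\<integral>s. f s \<partial>\<nu>)"
    using bernoulli_mixture[OF \<nu>, of e t] e by (metis less_imp_le)
  have pot: "potential R \<eta> r = e * R t r + (1 - e) * potential R \<nu> r" for r
    unfolding potential_def by (rule I) (auto intro!: boundedI R_le)
  have int: "integrable \<nu> (R t)" "integrable \<nu> (potential R \<nu>)"
    using bcontfun_integrable[OF \<nu>, of "pot \<nu>"] bcontfun_integrable[OF \<nu>, of "Bcontfun (R t)"]
    by (simp_all add: pot_apply[OF \<nu>] Bcontfun_inverse bcontfun_normI[OF R_continuous, of _ R_bound] R_le)
  have "(\<integral>r. R t r \<partial>\<nu>) = k" unfolding k_def potential_def by (subst R_sym) simp
  then have kint: "(\<integral>r. potential R \<eta> r \<partial>\<nu>) = e * k + (1 - e) * v"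
    unfolding pot using int v[unfolded energy_eq_integral_potential[OF \<nu>]] by simp
  have "energy R \<eta> = e * potential R \<eta> t + (1 - e) * (\<integral>r. potential R \<eta> r \<partial>\<nu>)"
    unfolding energy_eq_integral_potential[OF \<eta>]
    by (rule I) (auto intro!: boundedI potential_le potential_measurable \<eta>)
  also have "\<dots> = e * (e * R t t + (1 - e) * k) + (1 - e) * (e * k + (1 - e) * v)"
    unfolding kint by (simp only: pot k_def)
  finally have "v \<le> e * (e * R t t + (1 - e) * k) + (1 - e) * (e * k + (1 - e) * v)"
    using min_energy_le[OF \<eta>] by (simp add: v_def)
  then have "e * (2 * d) \<le> e * (e * c)"
    by (simp add: d_def c_def algebra_simps)
  then have "2 * d \<le> e * c" using e by simp
  also have "\<dots> \<le> e * (\<bar>c\<bar> + 1)" using e by (intro mult_left_mono) auto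
  also have "\<dots> \<le> d / (\<bar>c\<bar> + 1) * (\<bar>c\<bar> + 1)" unfolding e_def by (intro mult_right_mono) auto
  also have "\<dots> = d" by (simp add: field_simps)
  finally show False using d by simp
qed

end

section \<open>Absence of atoms of the minimum\<close>

locale minimizer_setup = compact_gaussian_path P X
  for P :: "'w measure" and X :: "'w \<Rightarrow> 'k::metric_space \<Rightarrow>\<^sub>C real" +
  fixes T :: "'w \<Rightarrow> 'k" and \<nu> :: "'k measure"
  assumes T_sel: "minimizer_selection P X T"
    and pos: "min_energy R > 0"
    and opt: "optimal_measure R \<nu>"
begin

abbreviation M :: "'w \<Rightarrow> real" where "M w \<equiv> path_min (X w)"

lemma nu_prob_measure: "\<nu> \<in> prob_measures" and energy_\<nu>: "energy R \<nu> = min_energy R"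
  using opt by (auto simp: optimal_measure_def)

lemma T_measurable [measurable]: "T \<in> borel_measurable P"
  using T_sel by (simp add: minimizer_selection_def)

lemma M_eq: "w \<in> space P \<Longrightarrow> M w = apply_bcontfun (X w) (T w)"
  using T_sel by (auto simp: minimizer_selection_def intro: path_min_eq)

lemma energy_pos: "\<eta> \<in> prob_measures \<Longrightarrow> energy R \<eta> > 0"
  using min_energy_le pos by force

lemma M_measurable [measurable]: "M \<in> borel_measurable P"
  by (rule path_min_coordinate_measurable[OF compact_K]) measurable

lemma path_min_shift_measurable [measurable]: "(\<lambda>w. path_min (X w + z)) \<in> borel_measurable P"
  by (rule path_min_coordinate_measurable[OF compact_K]) (simp, measurable)

lemma cameron_martin_min:
  assumes \<eta>: "\<eta> \<in> prob_measures" and [measurable]: "f \<in> borel_measurable borel"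
  shows "(\<integral>\<^sup>+ w. f (M w) * ennreal (exp (h * averaged \<eta> w - h\<^sup>2 * energy R \<eta> / 2)) \<partial>P)
      = (\<integral>\<^sup>+ w. f (path_min (X w + h *\<^sub>R pot \<eta>)) \<partial>P)"
proof -
  have "(\<lambda>z :: real \<times> ('k \<Rightarrow>\<^sub>C real). path_min (snd z)) \<in> borel_measurable (coordinate_algebra joint_coord)"
    by (rule path_min_coordinate_measurable[OF compact_K joint_coord_measurable(2)])
  then have "(\<lambda>z :: real \<times> ('k \<Rightarrow>\<^sub>C real). f (path_min (snd z))) \<in> borel_measurable (coordinate_algebra joint_coord)"
    by measurable
  from cameron_martin[OF \<eta> energy_pos[OF \<eta>] this, of h] show ?thesis by simp
qed

text \<open>The potential of \<open>\<nu>\<close> is at least the minimal energy, so raising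
  \<open>h\<close> to \<open>h'\<close> raises the whole path, and its minimum, by at least
  \<open>(h' - h) * min_energy R > 0\<close>.\<close>

lemma path_min_pot_strict:
  assumes "h < h'" shows "path_min (x + h *\<^sub>R pot \<nu>) < path_min (x + h' *\<^sub>R pot \<nu>)"
proof -
  have "path_min (x + h *\<^sub>R pot \<nu>) + (h' - h) * min_energy R \<le> path_min (x + h' *\<^sub>R pot \<nu>)"
    unfolding path_min_ge_iff
  proof
    fix t
    have "(h' - h) * min_energy R \<le> (h' - h) * potential R \<nu> t"
      using assms by (intro mult_left_mono optimal_potential_ge opt) auto
    then show "path_min (x + h *\<^sub>R pot \<nu>) + (h' - h) * min_energy R \<le> apply_bcontfun (x + h' *\<^sub>R pot \<nu>) t"
      using path_min_le[of "x + h *\<^sub>R pot \<nu>" t] by (simp add: pot_apply[OF nu_prob_measure] algebra_simps)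
  qed
  moreover have "0 < (h' - h) * min_energy R" using assms pos by simp
  ultimately show ?thesis by linarith
qed

text \<open>The Cameron-Martin images of \<open>{M = u}\<close> under distinct shifts along the potential of \<open>\<nu>\<close> are
  disjoint, and their probabilities are bounded below by a multiple of that of \<open>{M = u}\<close>.\<close>

lemma M_no_atom:
  assumes u: "u > 0" shows "AE w in P. M w \<noteq> u"
proof -
  define A where "A n = {w\<in>space P. path_min (X w + (1 / real (Suc n)) *\<^sub>R pot \<nu>) = u}" for n
  define p where "p = exp (- min_energy R / 2) * prob {w\<in>space P. M w = u}"
  have [measurable]: "A n \<in> sets P" for n unfolding A_def by measurable
  note [measurable] = averaged_measurable[OF nu_prob_measure]
  have le: "p \<le> prob (A n)" for n
  proof -
    let ?h = "1 / real (Suc n)"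
    have h: "0 < ?h" "?h \<le> 1" by auto
    have "ennreal p = (\<integral>\<^sup>+ w. ennreal (exp (- min_energy R / 2)) * indicator {w\<in>space P. M w = u} w \<partial>P)"
      by (simp add: p_def nn_integral_cmult emeasure_eq_measure ennreal_mult)
    also have "\<dots> \<le> (\<integral>\<^sup>+ w. indicator {u} (M w) * ennreal (exp (?h * averaged \<nu> w - ?h\<^sup>2 * energy R \<nu> / 2)) \<partial>P)"
    proof (rule nn_integral_mono)
      fix w assume w: "w \<in> space P"
      \<comment> \<open>The sign of \<open>u\<close> enters here: on \<open>M = u\<close> the
        average is at least \<open>u\<close>, hence nonnegative, and one lower bound for the weight
        works for all shifts \<open>?h \<le> 1\<close>.\<close>
      have "exp (- min_energy R / 2) \<le> exp (?h * averaged \<nu> w - ?h\<^sup>2 * energy R \<nu> / 2)" if "M w = u"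
      proof -
        have "0 \<le> averaged \<nu> w" using path_min_le_averaged[OF nu_prob_measure, of w] that u by linarith
        then have "0 \<le> ?h * averaged \<nu> w" by simp
        moreover have "?h\<^sup>2 * min_energy R \<le> 1 * min_energy R"
          using pos h by (intro mult_right_mono power_le_one) auto
        ultimately show ?thesis by (simp add: energy_\<nu> del: of_nat_Suc)
      qed
      then show "ennreal (exp (- min_energy R / 2)) * indicator {w\<in>space P. M w = u} w
          \<le> indicator {u} (M w) * ennreal (exp (?h * averaged \<nu> w - ?h\<^sup>2 * energy R \<nu> / 2))"
        using w by (auto simp: indicator_def intro!: ennreal_leI simp del: of_nat_Suc)
    qed
    also have "\<dots> = (\<integral>\<^sup>+ w. indicator {u} (path_min (X w + ?h *\<^sub>R pot \<nu>)) \<partial>P)"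
      by (rule cameron_martin_min[OF nu_prob_measure]) simp
    also have "\<dots> = (\<integral>\<^sup>+ w. indicator (A n) w \<partial>P)"
      by (intro nn_integral_cong) (auto simp: A_def indicator_def)
    finally show ?thesis by (simp add: emeasure_eq_measure)
  qed
  have disj: "disjoint_family A"
  proof -
    have "1 / real (Suc m) < 1 / real (Suc n)" if "n < m" for n m using that by (simp add: frac_less2)
    then have "A n \<inter> A m = {}" if "n < m" for n m
      using path_min_pot_strict that unfolding A_def by (auto simp del: of_nat_Suc) (metis less_irrefl)
    then show ?thesis unfolding disjoint_family_on_def by (metis Int_commute neqE)
  qed
  have "real N * p \<le> 1" for N
  proof -
    have "real N * p = (\<Sum>n<N. p)" by simp
    also have "\<dots> \<le> (\<Sum>n<N. prob (A n))" by (intro sum_mono le)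
    also have "\<dots> = prob (\<Union>n<N. A n)"
      using disj by (intro finite_measure_finite_Union[symmetric]) (auto simp: disjoint_family_on_def)
    also have "\<dots> \<le> 1" by simp
    finally show ?thesis .
  qed
  then have "p \<le> 0" using reals_Archimedean3[of p] by (metis not_less)
  then have "prob {w\<in>space P. M w = u} = 0"
    unfolding p_def by (simp add: mult_le_0_iff measure_nonneg antisym)
  then show ?thesis
    by (intro AE_I[of _ _ "{w\<in>space P. M w = u}"]) (auto simp: emeasure_eq_measure)
qed

end

section \<open>Differentiation of the Cameron-Martin formula\<close>

lemma abs_exp_minus_one_le: "\<bar>exp a - 1\<bar> \<le> \<bar>a\<bar> * exp \<bar>a\<bar>" for a :: real
proof (cases "a \<ge> 0")
  case True
  have "1 - a \<le> exp (- a)" using exp_ge_add_one_self[of "- a"] by simp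
  then have "(1 - a) * exp a \<le> exp (- a) * exp a" by (intro mult_right_mono) auto
  then have "exp a - 1 \<le> a * exp a" by (simp add: exp_add[symmetric] algebra_simps)
  then show ?thesis using True by simp
next
  case False
  have 1: "- a * 1 \<le> - a * exp (- a)" using False by (intro mult_left_mono) auto
  have 2: "1 + a \<le> exp a" "exp a \<le> 1" using exp_ge_add_one_self[of a] False by auto
  have "\<bar>exp a - 1\<bar> = 1 - exp a" "\<bar>a\<bar> = - a" using 2 False by auto
  moreover have "1 - exp a \<le> - a * exp (- a)" using 1 2 by linarith
  ultimately show ?thesis by (simp only:)
qed

lemma mult_one_plus_le_exp: "0 \<le> x \<Longrightarrow> x * (1 + x) \<le> exp (2 * x)" for x :: real
proof -
  assume x: "0 \<le> x"
  have "x * (1 + x) \<le> (1 + x) * (1 + x)" using x by (intro mult_right_mono) auto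
  also have "\<dots> \<le> exp x * exp x" using x exp_ge_add_one_self[of x] by (intro mult_mono) auto
  finally show ?thesis by (simp add: exp_add[symmetric])
qed

lemma tendsto_difference_quotient_exp:
  fixes y v \<sigma> :: real
  shows "(\<lambda>n. (exp (\<sigma> / real (Suc n) * y - (\<sigma> / real (Suc n))\<^sup>2 * v / 2) - 1) / (1 / real (Suc n))) \<longlonglongrightarrow> \<sigma> * y"
proof -
  let ?f = "\<lambda>h :: real. exp (\<sigma> * h * y - (\<sigma> * h)\<^sup>2 * v / 2)"
  have "(?f has_field_derivative \<sigma> * y) (at 0)"
    by (auto intro!: derivative_eq_intros)
  then have "(\<lambda>h. (?f (0 + h) - ?f 0) / h) \<midarrow>0\<rightarrow> \<sigma> * y" by (simp only: DERIV_def)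
  moreover have "filterlim (\<lambda>n. 1 / real (Suc n)) (at 0) sequentially"
    by (intro filterlim_atI) (auto simp: LIMSEQ_inverse_real_of_nat[simplified inverse_eq_divide] simp del: of_nat_Suc)
  ultimately have "(\<lambda>n. (?f (0 + 1 / real (Suc n)) - ?f 0) / (1 / real (Suc n))) \<longlonglongrightarrow> \<sigma> * y"
    by (rule filterlim_compose)
  then show ?thesis by (simp del: of_nat_Suc)
qed

context minimizer_setup
begin

text \<open>The positive part is an antiderivative of the indicator of the half-line:
  differentiating it along a shift of the path produces the event \<open>M > u\<close>.\<close>

definition excess :: "real \<Rightarrow> 'w \<Rightarrow> real" where "excess u w = max 0 (M w - u)"

lemma excess_measurable [measurable]: "excess u \<in> borel_measurable P"
  unfolding excess_def[abs_def] by measurable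

lemma excess_nonneg: "0 \<le> excess u w" by (simp add: excess_def)

lemma excess_le_norm: "0 \<le> u \<Longrightarrow> excess u w \<le> norm (X w)"
  using abs_path_min_le[of "X w"] by (auto simp: excess_def)

lemma integrable_cameron_martin_weight:
  assumes \<eta>: "\<eta> \<in> prob_measures" and u: "0 \<le> u"
  shows "integrable P (\<lambda>w. excess u w * exp (h * averaged \<eta> w - h\<^sup>2 * energy R \<eta> / 2))"
    and "integrable P (\<lambda>w. max 0 (path_min (X w + h *\<^sub>R pot \<eta>) - u))"
    and "integrable P (excess u)"
    and "expectation (\<lambda>w. excess u w * exp (h * averaged \<eta> w - h\<^sup>2 * energy R \<eta> / 2))
      = expectation (\<lambda>w. max 0 (path_min (X w + h *\<^sub>R pot \<eta>) - u))"
proof -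
  note [measurable] = averaged_measurable[OF \<eta>]
  have b1: "\<bar>excess u w * exp (h * averaged \<eta> w - h\<^sup>2 * energy R \<eta> / 2)\<bar> \<le> 1 * exp ((1 + \<bar>h\<bar>) * norm (X w))" for w
  proof -
    have "h * averaged \<eta> w \<le> \<bar>h\<bar> * norm (X w)"
      using mult_left_mono[OF averaged_le_norm[OF \<eta>, of w], of "\<bar>h\<bar>"] abs_ge_self[of "h * averaged \<eta> w"]
      by (simp add: abs_mult)
    moreover have "0 \<le> h\<^sup>2 * energy R \<eta>" using energy_pos[OF \<eta>] by simp
    ultimately have "h * averaged \<eta> w - h\<^sup>2 * energy R \<eta> / 2 \<le> \<bar>h\<bar> * norm (X w)" by simp
    then have "excess u w * exp (h * averaged \<eta> w - h\<^sup>2 * energy R \<eta> / 2) \<le> exp (norm (X w)) * exp (\<bar>h\<bar> * norm (X w))"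
      using order_trans[OF excess_le_norm[OF u] norm_le_exp(1)] by (intro mult_mono) auto
    then show ?thesis by (simp add: abs_mult excess_nonneg exp_add[symmetric] distrib_right)
  qed
  show i1: "integrable P (\<lambda>w. excess u w * exp (h * averaged \<eta> w - h\<^sup>2 * energy R \<eta> / 2))"
    by (rule integrable_exp_bound[OF _ b1]) measurable
  have b2: "\<bar>max 0 (path_min (X w + h *\<^sub>R pot \<eta>) - u)\<bar> \<le> norm (X w) + \<bar>h\<bar> * norm (pot \<eta>)" for w
    using abs_path_min_le[of "X w + h *\<^sub>R pot \<eta>"] norm_triangle_ineq[of "X w" "h *\<^sub>R pot \<eta>"] u by simp
  show i2: "integrable P (\<lambda>w. max 0 (path_min (X w + h *\<^sub>R pot \<eta>) - u))"
    by (rule Bochner_Integration.integrable_bound[where f = "\<lambda>w. norm (X w) + \<bar>h\<bar> * norm (pot \<eta>)"])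
      (use b2 in \<open>auto intro!: Bochner_Integration.integrable_add integrable_norm AE_I2 intro: order_trans[OF _ abs_ge_self]\<close>)
  show "integrable P (excess u)"
    using excess_le_norm[OF u] by (intro integrable_norm_bound[of _ 1]) (auto simp: excess_nonneg)
  have "(\<integral>\<^sup>+ w. ennreal (excess u w * exp (h * averaged \<eta> w - h\<^sup>2 * energy R \<eta> / 2)) \<partial>P)
      = (\<integral>\<^sup>+ w. ennreal (max 0 (path_min (X w + h *\<^sub>R pot \<eta>) - u)) \<partial>P)"
    using cameron_martin_min[OF \<eta>, of "\<lambda>m. ennreal (max 0 (m - u))" h]
    by (simp add: ennreal_mult excess_def)
  then show "expectation (\<lambda>w. excess u w * exp (h * averaged \<eta> w - h\<^sup>2 * energy R \<eta> / 2))
      = expectation (\<lambda>w. max 0 (path_min (X w + h *\<^sub>R pot \<eta>) - u))"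
    using i1 i2 by (simp add: integral_eq_nn_integral excess_nonneg)
qed

text \<open>\<open>L n\<close> is the difference quotient of the Cameron-Martin weight, and
  \<open>U n\<close> majorizes the quotient of the shifted excess by evaluating the shifted path at
  \<open>T\<close>. Both pass to the limit by dominated convergence. The sign
  \<open>\<sigma>\<close> chooses the direction of the shift; the two choices together give
  equality.\<close>

lemma integration_by_parts_le:
  assumes \<eta>: "\<eta> \<in> prob_measures" and u: "u > 0" and \<sigma>: "\<bar>\<sigma>\<bar> = 1"
  shows "\<sigma> * expectation (\<lambda>w. averaged \<eta> w * excess u w)
    \<le> \<sigma> * expectation (\<lambda>w. potential R \<eta> (T w) * indicator {w\<in>space P. M w > u} w)"
proof -
  note [measurable] = averaged_measurable[OF \<eta>] potential_measurable[OF \<eta>]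
  let ?v = "energy R \<eta>"
  define h where "h n = 1 / real (Suc n)" for n
  have h: "0 < h n" "h n \<le> 1" for n by (auto simp: h_def)
  have h_lim: "h \<longlonglongrightarrow> 0" unfolding h_def by (rule LIMSEQ_inverse_real_of_nat[unfolded inverse_eq_divide])
  define L where "L n w = excess u w * ((exp (\<sigma> * h n * averaged \<eta> w - (\<sigma> * h n)\<^sup>2 * ?v / 2) - 1) / h n)" for n w
  define U where "U n w = (max 0 (M w + \<sigma> * h n * potential R \<eta> (T w) - u) - excess u w) / h n" for n w
  have v: "?v > 0" by (rule energy_pos[OF \<eta>])
  have [measurable]: "L n \<in> borel_measurable P" "U n \<in> borel_measurable P" for n
    unfolding L_def[abs_def] U_def[abs_def] by measurable
  \<comment> \<open>The exponent is at most \<open>h n * ?b\<close> in absolute value, so the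
    quotient is at most \<open>?b * exp ?b \<le> exp (2 * ?b)\<close>; the excess contributes one
    more factor \<open>exp (norm (X w))\<close>.\<close>
  have Lbound: "\<bar>L n w\<bar> \<le> exp (2 * ?v) * exp (3 * norm (X w))" for n w
  proof -
    let ?a = "\<sigma> * h n * averaged \<eta> w - (\<sigma> * h n)\<^sup>2 * ?v / 2"
    let ?b = "norm (X w) + ?v"
    have s2: "\<sigma>\<^sup>2 = 1" using \<sigma> by (metis power2_abs one_power2)
    have a: "\<bar>?a\<bar> \<le> h n * ?b"
    proof -
      have "\<bar>\<sigma> * h n * averaged \<eta> w\<bar> \<le> h n * norm (X w)"
        using \<sigma> h[of n] averaged_le_norm[OF \<eta>, of w] by (simp add: abs_mult mult_left_mono)
      moreover have "(\<sigma> * h n)\<^sup>2 * ?v / 2 \<le> h n * ?v"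
      proof -
        have "(h n)\<^sup>2 \<le> h n" using h[of n] by (simp add: power2_eq_square mult_left_le)
        then have "(h n)\<^sup>2 * ?v \<le> h n * ?v" using v by (intro mult_right_mono) auto
        moreover have "0 \<le> h n * ?v" using h[of n] v by simp
        ultimately show ?thesis by (simp add: power_mult_distrib s2)
      qed
      moreover have "0 \<le> (\<sigma> * h n)\<^sup>2 * ?v / 2" using v by simp
      ultimately show ?thesis by (auto simp: distrib_left abs_le_iff)
    qed
    have b0: "0 \<le> ?b" using v by (simp add: add_nonneg_nonneg)
    have "h n * ?b \<le> 1 * ?b" using h[of n] b0 by (intro mult_right_mono) auto
    then have "\<bar>?a\<bar> \<le> ?b" using a by simp
    then have "\<bar>exp ?a - 1\<bar> \<le> (h n * ?b) * exp ?b"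
      using abs_exp_minus_one_le[of ?a] a b0 h[of n]
      by (elim order_trans) (intro mult_mono, auto)
    then have "\<bar>(exp ?a - 1) / h n\<bar> \<le> ?b * exp ?b"
      using h[of n] by (simp add: pos_divide_le_eq mult.commute mult.left_commute)
    also have "\<dots> \<le> exp ?b * exp ?b" using exp_ge_add_one_self[of ?b]
      by (intro mult_right_mono) (linarith, simp)
    finally have "\<bar>(exp ?a - 1) / h n\<bar> \<le> exp ?b * exp ?b" .
    then have "\<bar>L n w\<bar> \<le> exp (norm (X w)) * (exp ?b * exp ?b)"
      unfolding L_def abs_mult using excess_nonneg[of u w] order_trans[OF excess_le_norm norm_le_exp(1), of u w] u
      by (intro mult_mono) auto
    also have "\<dots> = exp (2 * ?v) * exp (3 * norm (X w))"
      by (simp add: exp_add[symmetric] algebra_simps)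
    finally show ?thesis .
  qed
  have Llim: "(\<lambda>n. expectation (L n)) \<longlonglongrightarrow> expectation (\<lambda>w. excess u w * (\<sigma> * averaged \<eta> w))"
  proof (rule integral_dominated_convergence[where w = "\<lambda>w. exp (2 * ?v) * exp (3 * norm (X w))"])
    show "AE w in P. (\<lambda>n. L n w) \<longlonglongrightarrow> excess u w * (\<sigma> * averaged \<eta> w)"
      unfolding L_def h_def using tendsto_difference_quotient_exp[of \<sigma> _ ?v]
      by (intro AE_I2 tendsto_mult tendsto_const) simp
  qed (use Lbound integrable_exp_norm in auto)
  have Ubound: "\<bar>U n w\<bar> \<le> R_bound" for n w
  proof -
    have "\<bar>max 0 (M w + \<sigma> * h n * potential R \<eta> (T w) - u) - excess u w\<bar> \<le> \<bar>\<sigma> * h n * potential R \<eta> (T w)\<bar>"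
      by (auto simp: excess_def max_def)
    also have "\<dots> \<le> h n * R_bound"
      using \<sigma> h[of n] potential_le[OF \<eta>, of "T w"] by (simp add: abs_mult mult_left_mono)
    finally show ?thesis using h[of n] by (simp add: U_def pos_divide_le_eq mult.commute)
  qed
  have Ulim: "(\<lambda>n. expectation (U n)) \<longlonglongrightarrow> expectation (\<lambda>w. \<sigma> * (potential R \<eta> (T w) * indicator {w\<in>space P. M w > u} w))"
  proof (rule integral_dominated_convergence[where w = "\<lambda>_. R_bound"])
    show "AE w in P. (\<lambda>n. U n w) \<longlonglongrightarrow> \<sigma> * (potential R \<eta> (T w) * indicator {w\<in>space P. M w > u} w)"
      \<comment> \<open>The positive part has a kink at zero, so the quotient is followed only where
        \<open>M w \<noteq> u\<close>; there it is eventually constant.\<close>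
      using M_no_atom[OF u] AE_space
    proof eventually_elim
      case (elim w)
      let ?k = "potential R \<eta> (T w)"
      have lim: "(\<lambda>n. M w + \<sigma> * h n * ?k - u) \<longlonglongrightarrow> M w + \<sigma> * 0 * ?k - u"
        by (intro tendsto_intros h_lim)
      consider "M w > u" | "M w < u" using elim by linarith
      then show ?case
      proof cases
        case 1
        then have "\<forall>\<^sub>F n in sequentially. 0 < M w + \<sigma> * h n * ?k - u"
          by (intro order_tendstoD(1)[OF lim]) simp
        then have "\<forall>\<^sub>F n in sequentially. U n w = \<sigma> * ?k"
          by eventually_elim (use 1 h in \<open>auto simp: U_def excess_def max_def less_imp_neq[OF h(1)] order_less_imp_not_eq2\<close>)
        then show ?thesis using 1 elim by (simp add: tendsto_eventually)
      next
        case 2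
        then have "\<forall>\<^sub>F n in sequentially. M w + \<sigma> * h n * ?k - u < 0"
          by (intro order_tendstoD(2)[OF lim]) simp
        then have "\<forall>\<^sub>F n in sequentially. U n w = 0"
          by eventually_elim (use 2 in \<open>auto simp: U_def excess_def\<close>)
        then show ?thesis using 2 elim by (simp add: tendsto_eventually)
      qed
    qed
    show "AE w in P. norm (U n w) \<le> R_bound" for n using Ubound by simp
  qed auto
  have LU: "expectation (L n) \<le> expectation (U n)" for n
  proof -
    let ?S = "\<lambda>w. max 0 (path_min (X w + (\<sigma> * h n) *\<^sub>R pot \<eta>) - u)"
    note I = integrable_cameron_martin_weight(1,2,4)[OF \<eta> less_imp_le[OF u], where h = "\<sigma> * h n"]
      integrable_cameron_martin_weight(3)[OF \<eta> less_imp_le[OF u]]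
    have "expectation (L n) = expectation (\<lambda>w. (excess u w * exp (\<sigma> * h n * averaged \<eta> w - (\<sigma> * h n)\<^sup>2 * ?v / 2) - excess u w) / h n)"
      unfolding L_def by (simp add: right_diff_distrib)
    also have "\<dots> = expectation (\<lambda>w. (?S w - excess u w) / h n)"
      using I by simp
    also have "\<dots> \<le> expectation (U n)"
    proof (rule integral_mono)
      show "integrable P (\<lambda>w. (?S w - excess u w) / h n)" using I by simp
      show "integrable P (U n)" using Ubound by (intro integrable_const_bound[of _ R_bound]) auto
      fix w assume w: "w \<in> space P"
      have "path_min (X w + (\<sigma> * h n) *\<^sub>R pot \<eta>) \<le> M w + \<sigma> * h n * potential R \<eta> (T w)"
        using path_min_le[of "X w + (\<sigma> * h n) *\<^sub>R pot \<eta>" "T w"] by (simp add: M_eq[OF w] pot_apply[OF \<eta>])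
      then show "(?S w - excess u w) / h n \<le> U n w"
        unfolding U_def using h[of n] by (intro divide_right_mono) auto
    qed
    finally show ?thesis .
  qed
  have "expectation (\<lambda>w. excess u w * (\<sigma> * averaged \<eta> w))
      \<le> expectation (\<lambda>w. \<sigma> * (potential R \<eta> (T w) * indicator {w\<in>space P. M w > u} w))"
    by (rule LIMSEQ_le[OF Llim Ulim]) (use LU in auto)
  then show ?thesis by (simp add: mult.commute mult.left_commute)
qed

lemma integration_by_parts:
  assumes "\<eta> \<in> prob_measures" "u > 0"
  shows "expectation (\<lambda>w. averaged \<eta> w * excess u w)
    = expectation (\<lambda>w. potential R \<eta> (T w) * indicator {w\<in>space P. M w > u} w)"
  using integration_by_parts_le[OF assms, of 1] integration_by_parts_le[OF assms, of "-1"] by simp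

section \<open>Tilting along the optimal potential and a lower bound for the probability of a high
  minimum\<close>

abbreviation Y :: "'w \<Rightarrow> real" where "Y \<equiv> averaged \<nu>"
abbreviation v :: real where "v \<equiv> min_energy R"
abbreviation k :: "'k \<Rightarrow> real" where "k \<equiv> potential R \<nu>"

lemma Y_measurable [measurable]: "Y \<in> borel_measurable P"
  by (rule averaged_measurable[OF nu_prob_measure])

definition upper :: "real \<Rightarrow> 'w set" where "upper u = {w\<in>space P. M w > u}"

lemma upper_sets [measurable]: "upper u \<in> sets P" unfolding upper_def by measurable

text \<open>The Cameron-Martin formula solved for the unweighted expectation: shifting by
  \<open>h\<close> moves a rare event into the bulk of the law, at the price of the explicit weight
  on the right.\<close>

lemma cameron_martin_tilt:
  assumes G: "G \<in> borel_measurable (coordinate_algebra joint_coord)"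
  shows "(\<integral>\<^sup>+ w. G (Y w, X w) \<partial>P)
    = (\<integral>\<^sup>+ w. G (Y w + h * v, X w + h *\<^sub>R pot \<nu>) * ennreal (exp (- h * Y w - h\<^sup>2 * v / 2)) \<partial>P)"
proof -
  let ?H = "\<lambda>z. G z * ennreal (exp (- h * fst z + h\<^sup>2 * v / 2))"
  have ex: "(\<lambda>z :: real \<times> ('k \<Rightarrow>\<^sub>C real). ennreal (exp (- h * fst z + h\<^sup>2 * v / 2))) \<in> borel_measurable (coordinate_algebra joint_coord)"
    using joint_coord_measurable(1) by measurable
  have "(\<integral>\<^sup>+ w. ?H (Y w, X w) * ennreal (exp (h * Y w - h\<^sup>2 * energy R \<nu> / 2)) \<partial>P)
      = (\<integral>\<^sup>+ w. ?H (Y w + h * energy R \<nu>, X w + h *\<^sub>R pot \<nu>) \<partial>P)"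
    by (rule cameron_martin[OF nu_prob_measure energy_pos[OF nu_prob_measure]]) (rule borel_measurable_times_ennreal[OF G ex])
  moreover have "?H (Y w, X w) * ennreal (exp (h * Y w - h\<^sup>2 * energy R \<nu> / 2)) = G (Y w, X w)" for w
    by (simp add: energy_\<nu> mult.assoc exp_add[symmetric] flip: ennreal_mult)
  moreover have "- h * (Y w + h * v) + h\<^sup>2 * v / 2 = - h * Y w - h\<^sup>2 * v / 2" for w
    by (simp add: power2_eq_square field_simps)
  ultimately show ?thesis by (simp only: fst_conv snd_conv energy_\<nu>)
qed

text \<open>Since the potential is at least \<open>v\<close>, the shift by
  \<open>h = (u + r + 1) / v\<close> lifts every path of norm at most \<open>r\<close> above
  \<open>u\<close>, while the weight there is at least
  \<open>exp (- h * r - h\<^sup>2 * v / 2)\<close>. Expanding the square gives the rate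
  \<open>c\<close> and the constant \<open>p\<close>.\<close>

lemma upper_lower_bound:
  obtains p c where "p > 0" "c > 0" "\<And>u. u \<ge> 0 \<Longrightarrow> p * exp (- u\<^sup>2 / (2 * v) - c * u) \<le> prob (upper u)"
proof -
  obtain s where s: "s > 0" "\<And>n. prob {w\<in>space P. 20 * s * (3/2) ^ n < norm (X w)} \<le> (1/3) ^ (2 ^ n)"
    using fernique by blast
  define r where "r = 20 * s"
  define B where "B = {w\<in>space P. norm (X w) \<le> r}"
  have [measurable]: "B \<in> sets P" unfolding B_def by measurable
  \<comment> \<open>The Fernique threshold at \<open>n = 0\<close> supplies a ball of positive
    probability.\<close>
  have "prob (space P - B) \<le> 1/3"
    using s(2)[of 0] by (simp add: r_def B_def set_diff_eq not_le conj_commute cong: conj_cong)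
  then have B: "prob B \<ge> 2/3" using prob_compl[of B] by simp
  have r: "r > 0" using s by (simp add: r_def)
  define p where "p = prob B * exp (- (r + 1) * r / v - (r + 1)\<^sup>2 / (2 * v))"
  define c where "c = (2 * r + 1) / v"
  show ?thesis
  proof (rule that)
    show "p > 0" unfolding p_def using B by (intro mult_pos_pos) auto
    show "c > 0" unfolding c_def using r pos by simp
    fix u :: real assume u: "u \<ge> 0"
    define h where "h = (u + r + 1) / v"
    have h: "h \<ge> 0" "h * v = u + r + 1" using u r pos by (auto simp: h_def)
    have me: "- h * r - h\<^sup>2 * v / 2 = (- u\<^sup>2 / (2 * v) - c * u) + (- (r + 1) * r / v - (r + 1)\<^sup>2 / (2 * v))"
      unfolding h_def c_def using pos by (simp add: field_simps power2_eq_square)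
    have pm: "(\<lambda>z :: real \<times> ('k \<Rightarrow>\<^sub>C real). path_min (snd z)) \<in> borel_measurable (coordinate_algebra joint_coord)"
      by (rule path_min_coordinate_measurable[OF compact_K joint_coord_measurable(2)])
    then have Gm: "(\<lambda>z :: real \<times> ('k \<Rightarrow>\<^sub>C real). indicator {u<..} (path_min (snd z)) :: ennreal) \<in> borel_measurable (coordinate_algebra joint_coord)"
      by measurable
    have "ennreal (p * exp (- u\<^sup>2 / (2 * v) - c * u)) = (\<integral>\<^sup>+ w. ennreal (exp (- h * r - h\<^sup>2 * v / 2)) * indicator B w \<partial>P)"
    proof -
      have "p * exp (- u\<^sup>2 / (2 * v) - c * u) = exp (- h * r - h\<^sup>2 * v / 2) * prob B"
        unfolding me exp_add p_def by (simp only: ac_simps)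
      then show ?thesis by (simp add: nn_integral_cmult emeasure_eq_measure ennreal_mult)
    qed
    also have "\<dots> \<le> (\<integral>\<^sup>+ w. indicator {u<..} (path_min (X w + h *\<^sub>R pot \<nu>)) * ennreal (exp (- h * Y w - h\<^sup>2 * v / 2)) \<partial>P)"
    proof (rule nn_integral_mono)
      fix w assume "w \<in> space P"
      show "ennreal (exp (- h * r - h\<^sup>2 * v / 2)) * indicator B w
          \<le> indicator {u<..} (path_min (X w + h *\<^sub>R pot \<nu>)) * ennreal (exp (- h * Y w - h\<^sup>2 * v / 2))"
      proof (cases "w \<in> B")
        case True
        then have nX: "norm (X w) \<le> r" by (simp add: B_def)
        have "u + 1 \<le> path_min (X w + h *\<^sub>R pot \<nu>)"
          unfolding path_min_ge_iff
        proof
          fix t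
          have "- r \<le> apply_bcontfun (X w) t" using nX coord_le_norm[of w t] by linarith
          moreover have "h * v \<le> h * k t" using h by (intro mult_left_mono optimal_potential_ge opt) auto
          ultimately show "u + 1 \<le> apply_bcontfun (X w + h *\<^sub>R pot \<nu>) t"
            using h by (simp add: pot_apply[OF nu_prob_measure])
        qed
        moreover have "exp (- h * r - h\<^sup>2 * v / 2) \<le> exp (- h * Y w - h\<^sup>2 * v / 2)"
          using h(1) mult_left_mono[of "Y w" r h] averaged_le_norm[OF nu_prob_measure, of w] nX by simp
        ultimately show ?thesis using True by (simp add: ennreal_leI)
      qed simp
    qed
    also have "\<dots> = (\<integral>\<^sup>+ w. indicator {u<..} (M w) \<partial>P)"
      using cameron_martin_tilt[OF Gm, of h] by simp
    also have "\<dots> = (\<integral>\<^sup>+ w. indicator (upper u) w \<partial>P)"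
      by (intro nn_integral_cong) (auto simp: upper_def indicator_def)
    finally show "p * exp (- u\<^sup>2 / (2 * v) - c * u) \<le> prob (upper u)"
      by (simp add: emeasure_eq_measure)
  qed
qed

lemma upper_pos: "u \<ge> 0 \<Longrightarrow> prob (upper u) > 0"
  by (rule upper_lower_bound) (metis exp_gt_zero less_le_trans mult_pos_pos)

section \<open>Exponential smallness of the residual part\<close>

definition residual :: "'w \<Rightarrow> real" where "residual w = norm (X w - (Y w / v) *\<^sub>R pot \<nu>)"

definition resid_const :: real where "resid_const = 1 + norm (pot \<nu>) / v"

lemma resid_const: "resid_const \<ge> 1" using pos by (simp add: resid_const_def)

lemma residual_le: "residual w \<le> resid_const * norm (X w)"
proof -
  have "norm ((Y w / v) *\<^sub>R pot \<nu>) \<le> norm (X w) / v * norm (pot \<nu>)"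
    using averaged_le_norm[OF nu_prob_measure, of w] pos by (simp add: mult_right_mono divide_right_mono)
  then show ?thesis using norm_triangle_ineq4[of "X w" "(Y w / v) *\<^sub>R pot \<nu>"]
    by (simp add: residual_def resid_const_def algebra_simps)
qed

lemma residual_nonneg: "0 \<le> residual w" by (simp add: residual_def)

lemma residual_measurable [measurable]: "residual \<in> borel_measurable P"
  unfolding residual_def[abs_def]
  by (rule norm_coordinate_measurable[OF compact_K]) (simp, measurable)

text \<open>One majorant for the bad event \<open>residual w > e * u\<close>: the factor
  \<open>1 + max 0 (Y w - u)\<close> dominates both \<open>1\<close>, for the bound on
  \<open>k (T w)\<close>, and \<open>M w - u\<close>, for the covariance error. It involves only
  \<open>Y\<close> and the residual, on which a shift acts explicitly.\<close>

definition remainder :: "real \<Rightarrow> real \<Rightarrow> 'w \<Rightarrow> real" where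
  "remainder e u w = (if Y w > u \<and> residual w > e * u then residual w * (1 + max 0 (Y w - u)) else 0)"

lemma remainder_measurable [measurable]: "remainder e u \<in> borel_measurable P"
  unfolding remainder_def[abs_def] by measurable

lemma remainder_nonneg: "0 \<le> remainder e u w"
  by (simp add: remainder_def residual_nonneg)

lemma remainder_integrable: "u \<ge> 0 \<Longrightarrow> integrable P (remainder e u)"
proof (rule integrable_exp_bound[of _ resid_const 2])
  fix w assume u: "u \<ge> 0"
  have "max 0 (Y w - u) \<le> norm (X w)" using averaged_le_norm[OF nu_prob_measure, of w] u by auto
  then have "remainder e u w \<le> (resid_const * norm (X w)) * (1 + norm (X w))"
    unfolding remainder_def using residual_le[of w] residual_nonneg[of w] resid_const
    by (auto intro!: mult_mono)
  also have "\<dots> \<le> resid_const * exp (2 * norm (X w))"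
    unfolding mult.assoc using resid_const mult_one_plus_le_exp[of "norm (X w)"] by (intro mult_left_mono) auto
  finally show "\<bar>remainder e u w\<bar> \<le> resid_const * exp (2 * norm (X w))" using remainder_nonneg by simp
qed simp

text \<open>A shift by \<open>u / v\<close> leaves the residual unchanged and extracts the factor \<open>exp (- u\<^sup>2 / (2 v))\<close>.
  By Fernique's theorem the residual has exponential moments of all orders.\<close>

lemma remainder_upper_bound:
  assumes e: "e > 0"
  obtains C where "\<And>u. u \<ge> 0 \<Longrightarrow> expectation (remainder e u) \<le> C * exp (- u\<^sup>2 / (2 * v) - l * u)"
proof -
  \<comment> \<open>\<open>l\<close> may be negative, while the comparison of exponentials needs a
    rate for which they increase with the residual.\<close>
  define L where "L = max l 0"
  \<comment> \<open>On the bad event \<open>u < residual w / e\<close>, so a factor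
    \<open>exp (l * u)\<close> is dominated by \<open>exp (L * (residual w / e))\<close>; this is
    how the arbitrary rate \<open>l\<close> is obtained.\<close>
  define W where "W w = residual w * (1 + norm (X w)) * exp (L * (residual w / e))" for w
  have [measurable]: "W \<in> borel_measurable P" unfolding W_def[abs_def] by measurable
  have W0: "0 \<le> W w" for w unfolding W_def using residual_nonneg by simp
  have iW: "integrable P W"
  proof (rule integrable_exp_bound[of _ resid_const "2 + L * resid_const / e"])
    fix w
    have "W w \<le> (resid_const * norm (X w)) * (1 + norm (X w)) * exp (L * ((resid_const * norm (X w)) / e))"
      unfolding W_def using residual_le[of w] residual_nonneg[of w] resid_const e
      by (intro mult_mono iffD2[OF exp_le_cancel_iff] mult_left_mono divide_right_mono) (auto simp: L_def)
    also have "\<dots> = resid_const * (norm (X w) * (1 + norm (X w))) * exp (L * resid_const / e * norm (X w))"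
      by simp
    also have "\<dots> \<le> resid_const * exp (2 * norm (X w)) * exp (L * resid_const / e * norm (X w))"
      using resid_const mult_one_plus_le_exp[of "norm (X w)"] by (intro mult_right_mono mult_left_mono) auto
    also have "\<dots> = resid_const * exp ((2 + L * resid_const / e) * norm (X w))"
      by (simp add: exp_add[symmetric] distrib_right)
    finally show "\<bar>W w\<bar> \<le> resid_const * exp ((2 + L * resid_const / e) * norm (X w))" using W0 by simp
  qed simp
  show ?thesis
  proof (rule that)
    fix u :: real assume u: "u \<ge> 0"
    let ?h = "u / v"
    let ?res = "\<lambda>z :: real \<times> ('k \<Rightarrow>\<^sub>C real). norm (snd z - (fst z / v) *\<^sub>R pot \<nu>)"
    let ?G = "\<lambda>z :: real \<times> ('k \<Rightarrow>\<^sub>C real). ennreal (if fst z > u \<and> ?res z > e * u then ?res z * (1 + max 0 (fst z - u)) else 0)"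
    have fm: "(\<lambda>z :: real \<times> ('k \<Rightarrow>\<^sub>C real). fst z) \<in> borel_measurable (coordinate_algebra joint_coord)"
      by (rule joint_coord_measurable)
    have rm: "?res \<in> borel_measurable (coordinate_algebra joint_coord)"
      by (rule norm_coordinate_measurable[OF compact_K])
        (auto intro!: borel_measurable_diff borel_measurable_times borel_measurable_divide joint_coord_measurable)
    have Gm: "?G \<in> borel_measurable (coordinate_algebra joint_coord)"
      using fm rm by measurable
    have "ennreal (expectation (remainder e u)) = (\<integral>\<^sup>+ w. ennreal (remainder e u w) \<partial>P)"
      using remainder_integrable[OF u] remainder_nonneg by (intro nn_integral_eq_integral[symmetric]) auto
    also have "\<dots> = (\<integral>\<^sup>+ w. ?G (Y w, X w) \<partial>P)"
      by (simp only: remainder_def residual_def fst_conv snd_conv)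
    also have "\<dots> = (\<integral>\<^sup>+ w. ?G (Y w + ?h * v, X w + ?h *\<^sub>R pot \<nu>) * ennreal (exp (- ?h * Y w - ?h\<^sup>2 * v / 2)) \<partial>P)"
      by (rule cameron_martin_tilt[OF Gm])
    also have "\<dots> \<le> (\<integral>\<^sup>+ w. ennreal (exp (- u\<^sup>2 / (2 * v) - l * u) * W w) \<partial>P)"
    proof (rule nn_integral_mono)
      fix w
      have hv: "?h * v = u" "?h\<^sup>2 * v / 2 = u\<^sup>2 / (2 * v)" using pos by (auto simp: field_simps power2_eq_square)
      have res: "X w + ?h *\<^sub>R pot \<nu> - ((Y w + u) / v) *\<^sub>R pot \<nu> = X w - (Y w / v) *\<^sub>R pot \<nu>"
        by (simp add: add_divide_distrib scaleR_add_left)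
      have "(if Y w + u > u \<and> residual w > e * u then residual w * (1 + max 0 (Y w)) else 0) * exp (- ?h * Y w - ?h\<^sup>2 * v / 2)
          \<le> exp (- u\<^sup>2 / (2 * v) - l * u) * W w"
      proof (cases "Y w > 0 \<and> residual w > e * u")
        case True
        have "0 \<le> ?h * Y w" using True u pos by simp
        then have "exp (- ?h * Y w - ?h\<^sup>2 * v / 2) \<le> exp (- u\<^sup>2 / (2 * v))" unfolding hv by simp
        moreover have "residual w * (1 + max 0 (Y w)) \<le> residual w * (1 + norm (X w))"
          using averaged_le_norm[OF nu_prob_measure, of w] residual_nonneg[of w] by (intro mult_left_mono) auto
        moreover have "1 \<le> exp (L * (residual w / e) - l * u)"
        proof -
          have "u \<le> residual w / e" using True e by (simp add: pos_le_divide_eq mult.commute)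
          then have "L * u \<le> L * (residual w / e)" by (intro mult_left_mono) (auto simp: L_def)
          moreover have "l * u \<le> L * u" using u by (intro mult_right_mono) (auto simp: L_def)
          ultimately show ?thesis by simp
        qed
        ultimately have "(residual w * (1 + max 0 (Y w))) * exp (- ?h * Y w - ?h\<^sup>2 * v / 2) * 1
            \<le> (residual w * (1 + norm (X w))) * exp (- u\<^sup>2 / (2 * v)) * exp (L * (residual w / e) - l * u)"
          using residual_nonneg[of w] averaged_le_norm[OF nu_prob_measure, of w] by (intro mult_mono) auto
        also have "\<dots> = exp (- u\<^sup>2 / (2 * v) - l * u) * W w"
          unfolding W_def exp_diff by (simp add: field_simps)
        finally show ?thesis using True by simp
      next
        case False
        then show ?thesis using W0[of w] by auto
      qed
      then show "?G (Y w + ?h * v, X w + ?h *\<^sub>R pot \<nu>) * ennreal (exp (- ?h * Y w - ?h\<^sup>2 * v / 2))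
          \<le> ennreal (exp (- u\<^sup>2 / (2 * v) - l * u) * W w)"
        unfolding fst_conv snd_conv hv(1) res residual_def[symmetric]
        by (subst ennreal_mult[symmetric]) (auto intro!: ennreal_leI mult_nonneg_nonneg residual_nonneg)
    qed
    also have "\<dots> = ennreal (exp (- u\<^sup>2 / (2 * v) - l * u) * expectation W)"
      using iW W0 by (subst nn_integral_eq_integral) auto
    finally show "expectation (remainder e u) \<le> expectation W * exp (- u\<^sup>2 / (2 * v) - l * u)"
      using W0 by (subst (asm) ennreal_le_iff) (auto simp: mult.commute)
  qed
qed

text \<open>The upper bound is taken with rate \<open>c + 1\<close>, one more than the rate
  \<open>c\<close> lost in the lower bound. The Gaussian factors cancel and the quotient is at most
  a constant times \<open>exp (- u)\<close>.\<close>

lemma remainder_negligible: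
  assumes e: "e > 0"
  shows "((\<lambda>u. expectation (remainder e u) / prob (upper u)) \<longlongrightarrow> 0) at_top"
proof -
  obtain p c where p: "p > 0" "c > 0" and lo: "\<And>u. u \<ge> 0 \<Longrightarrow> p * exp (- u\<^sup>2 / (2 * v) - c * u) \<le> prob (upper u)"
    using upper_lower_bound by blast
  obtain C where hi: "\<And>u. u \<ge> 0 \<Longrightarrow> expectation (remainder e u) \<le> C * exp (- u\<^sup>2 / (2 * v) - (c + 1) * u)"
    using remainder_upper_bound[OF e] by blast
  have nn: "0 \<le> expectation (remainder e u)" for u
    by (intro integral_nonneg_AE) (simp add: remainder_nonneg)
  show ?thesis
  proof (rule tendsto_sandwich)
    show "\<forall>\<^sub>F u in at_top. 0 \<le> expectation (remainder e u) / prob (upper u)" using nn by simp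
    show "\<forall>\<^sub>F u in at_top. expectation (remainder e u) / prob (upper u) \<le> C / p * exp (- u)"
      using eventually_ge_at_top[of 0]
    proof eventually_elim
      case (elim u)
      have "expectation (remainder e u) / prob (upper u)
          \<le> (C * exp (- u\<^sup>2 / (2 * v) - (c + 1) * u)) / (p * exp (- u\<^sup>2 / (2 * v) - c * u))"
        using p nn by (intro frac_le hi lo elim order_trans[OF nn hi[OF elim]]) auto
      also have "\<dots> = C / p * (exp (- u\<^sup>2 / (2 * v) - (c + 1) * u) / exp (- u\<^sup>2 / (2 * v) - c * u))" by simp
      also have "exp (- u\<^sup>2 / (2 * v) - (c + 1) * u) / exp (- u\<^sup>2 / (2 * v) - c * u) = exp (- u)"
        unfolding exp_diff[symmetric] by (simp add: algebra_simps)
      finally show ?case .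
    qed
    show "((\<lambda>u. C / p * exp (- u)) \<longlongrightarrow> 0) at_top" by real_asymp
  qed simp
qed

section \<open>Conditional laws of the minimizer\<close>

definition cond_exp_T :: "real \<Rightarrow> ('k \<Rightarrow> real) \<Rightarrow> real" where
  "cond_exp_T u f = expectation (\<lambda>w. f (T w) * indicator (upper u) w) / prob (upper u)"

lemma integral_cond_law:
  assumes [measurable]: "f \<in> borel_measurable borel" and u: "u \<ge> 0"
  shows "(\<integral>t. f t \<partial>cond_law P T (upper u)) = cond_exp_T u f"
proof -
  have p: "prob (upper u) > 0" by (rule upper_pos[OF u])
  have "uniform_measure P (upper u) = density P (\<lambda>w. ennreal (indicator (upper u) w / prob (upper u)))"
    unfolding uniform_measure_def using p
    by (intro density_cong) (auto simp: emeasure_eq_measure divide_ennreal ennreal_indicator[symmetric])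
  moreover have "(\<integral>t. f t \<partial>distr (density P (\<lambda>w. ennreal (indicator (upper u) w / prob (upper u)))) borel T)
      = (\<integral>w. f (T w) \<partial>density P (\<lambda>w. ennreal (indicator (upper u) w / prob (upper u))))"
    by (rule integral_distr) measurable
  moreover have "\<dots> = expectation (\<lambda>w. (indicator (upper u) w / prob (upper u)) *\<^sub>R f (T w))"
    by (rule integral_density) (use p in \<open>auto intro!: AE_I2\<close>)
  ultimately show ?thesis by (simp add: cond_law_def cond_exp_T_def mult.commute)
qed

lemma prob_measures_cond_law:
  assumes "u \<ge> 0" shows "cond_law P T (upper u) \<in> prob_measures"
proof -
  have "prob_space (uniform_measure P (upper u))"
    using upper_pos[OF assms] by (intro prob_space_uniform_measure) (auto simp: emeasure_eq_measure)
  then show ?thesis unfolding prob_measures_def cond_law_def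
    by (auto intro!: prob_space.prob_space_distr simp: measurable_def[of "uniform_measure P _"] T_measurable[unfolded measurable_def, simplified])
qed

lemma conditional_parts:
  assumes \<eta>: "\<eta> \<in> prob_measures" and u: "u > 0"
  shows "cond_exp_T u (potential R \<eta>) = expectation (\<lambda>w. averaged \<eta> w * excess u w) / prob (upper u)"
  unfolding cond_exp_T_def integration_by_parts[OF assms] upper_def by simp

text \<open>A point mass turns averages into evaluations and potentials into sections of the kernel,
  so integration by parts specializes from measures to \<open>X\<close> at a single point.\<close>

lemma point_mass:
  "return borel t \<in> prob_measures" "averaged (return borel t) w = apply_bcontfun (X w) t"
  "potential R (return borel t) = R t"
proof -
  show "return borel t \<in> prob_measures" by (simp add: prob_measures_def prob_space_return)
  have "apply_bcontfun (X w) \<in> borel_measurable borel" by (intro borel_measurable_continuous_onI) simp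
  then show "averaged (return borel t) w = apply_bcontfun (X w) t"
    unfolding averaged_def by (intro integral_return) auto
  show "potential R (return borel t) = R t"
    unfolding potential_def by (intro ext integral_return) auto
qed

lemma excess_le_averaged: "u \<ge> 0 \<Longrightarrow> M w > u \<Longrightarrow> excess u w = M w - u \<and> M w \<le> Y w"
  using path_min_le_averaged[OF nu_prob_measure, of w] by (simp add: excess_def)

text \<open>The bound splits at \<open>residual w = e * u\<close>. Below it the factor
  \<open>u\<close> remains, to be absorbed later by \<open>u \<le> Y w\<close> on the event; above
  it \<open>M w \<le> Y w\<close> puts the product under \<open>remainder\<close>.\<close>

lemma residual_excess_le:
  assumes u: "u \<ge> 0" and e: "e > 0"
  shows "residual w * excess u w \<le> e * u * excess u w + remainder e u w"
proof (cases "M w > u \<and> residual w > e * u")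
  case True
  then have "excess u w \<le> Y w - u" "u < Y w" using excess_le_averaged[OF u, of w] by auto
  then have "residual w * excess u w \<le> residual w * (1 + max 0 (Y w - u))"
    using residual_nonneg by (intro mult_left_mono) auto
  also have "\<dots> = remainder e u w" using True \<open>u < Y w\<close> by (simp add: remainder_def)
  finally show ?thesis using u e excess_nonneg[of u w] by (smt (verit) mult_nonneg_nonneg)
next
  case False
  then have "residual w * excess u w \<le> e * u * excess u w"
    using excess_nonneg[of u w] by (cases "M w > u") (auto intro!: mult_right_mono simp: excess_def)
  then show ?thesis using remainder_nonneg[of e u w] by linarith
qed

lemma residual_coord: "\<bar>apply_bcontfun (X w) t - Y w / v * k t\<bar> \<le> residual w"
  using norm_bounded[of "X w - (Y w / v) *\<^sub>R pot \<nu>" t] by (simp add: residual_def pot_apply[OF nu_prob_measure])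

text \<open>At the minimizer, \<open>Y \<ge> M = (Y / v) k(T) + Z(T)\<close>, which bounds \<open>k(T) - v\<close> by \<open>v \<bar>Z(T)\<bar> / Y\<close>.\<close>

lemma potential_at_minimizer:
  assumes w: "w \<in> upper u" and u: "u \<ge> 1" and e: "e > 0"
  shows "k (T w) - v \<le> v * (e + remainder e u w)"
proof -
  have wP: "w \<in> space P" and Mu: "M w > u" using w by (auto simp: upper_def)
  have Yu: "Y w > u" "M w \<le> Y w" using excess_le_averaged[of u w] Mu u by auto
  have kv: "0 \<le> k (T w) - v" using optimal_potential_ge[OF opt, of "T w"] by simp
  \<comment> \<open>The factor \<open>k (T w) - v\<close> is nonnegative by optimality, so
    \<open>Y w\<close> may be lowered to \<open>u\<close>.\<close>
  have "u * (k (T w) - v) \<le> Y w * (k (T w) - v)" using Yu kv by (intro mult_right_mono) auto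
  also have "\<dots> = v * (Y w / v * k (T w) - Y w)" using pos by (simp add: field_simps)
  also have "\<dots> \<le> v * residual w"
    using residual_coord[of w "T w"] Yu M_eq[OF wP] pos by (intro mult_left_mono) auto
  finally have le: "u * (k (T w) - v) \<le> v * residual w" .
  show ?thesis
  proof (cases "residual w > e * u")
    case True
    have "1 * (k (T w) - v) \<le> u * (k (T w) - v)" using u kv by (intro mult_right_mono) auto
    also have "\<dots> \<le> v * (residual w * (1 + max 0 (Y w - u)))"
      using le pos residual_nonneg[of w] mult_left_mono[of 1 "1 + max 0 (Y w - u)" "residual w"]
      by (elim order_trans) (intro mult_left_mono, auto)
    also have "\<dots> \<le> v * (e + remainder e u w)"
      using True Yu e pos by (intro mult_left_mono) (auto simp: remainder_def)
    finally show ?thesis by simp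
  next
    case False
    then have "v * residual w \<le> v * (e * u)" using pos by (intro mult_left_mono) auto
    with le have "u * (k (T w) - v) \<le> u * (v * e)" by (simp add: mult.commute mult.left_commute)
    then have "k (T w) - v \<le> v * e" using u by simp
    moreover have "0 \<le> v * remainder e u w" using pos remainder_nonneg by simp
    ultimately show ?thesis by (simp add: distrib_left)
  qed
qed

lemma cond_exp_T_bounds:
  assumes [measurable]: "f \<in> borel_measurable borel" and "\<And>t. a \<le> f t" "\<And>t. f t \<le> b" and u: "u \<ge> 0"
  shows "a \<le> cond_exp_T u f" "cond_exp_T u f \<le> b"
proof -
  have p: "prob (upper u) > 0" by (rule upper_pos[OF u])
  have i: "integrable P (\<lambda>w. f (T w) * indicator (upper u) w)"
    using assms(2,3) by (intro integrable_const_bound[of _ "max \<bar>a\<bar> \<bar>b\<bar>"])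
      (auto intro!: AE_I2 simp: indicator_def, smt (verit, ccfv_threshold))
  have iu: "integrable P (indicator (upper u) :: 'w \<Rightarrow> real)"
    by (intro integrable_const_bound[of _ 1]) auto
  have "expectation (\<lambda>w. a * indicator (upper u) w) \<le> expectation (\<lambda>w. f (T w) * indicator (upper u) w)"
    using assms(2) by (intro integral_mono i integrable_mult_right iu) (auto simp: indicator_def)
  then show "a \<le> cond_exp_T u f" using p by (simp add: cond_exp_T_def pos_le_divide_eq)
  have "expectation (\<lambda>w. f (T w) * indicator (upper u) w) \<le> expectation (\<lambda>w. b * indicator (upper u) w)"
    using assms(3) by (intro integral_mono i integrable_mult_right iu) (auto simp: indicator_def)
  then show "cond_exp_T u f \<le> b" using p by (simp add: cond_exp_T_def pos_divide_le_eq)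
qed

lemma cond_potential_ge: "u \<ge> 0 \<Longrightarrow> v \<le> cond_exp_T u k"
  and cond_potential_le_bound: "u \<ge> 0 \<Longrightarrow> cond_exp_T u k \<le> R_bound"
  using cond_exp_T_bounds[OF potential_measurable[OF nu_prob_measure], of v R_bound u]
    optimal_potential_ge[OF opt] potential_le[OF nu_prob_measure] by (auto simp: abs_le_iff)

lemma cond_potential_le:
  assumes u: "u \<ge> 1" and e: "e > 0"
  shows "cond_exp_T u k - v \<le> v * (e + expectation (remainder e u) / prob (upper u))"
proof -
  have p: "prob (upper u) > 0" using upper_pos u by simp
  have [measurable]: "k \<in> borel_measurable borel" by (rule potential_measurable[OF nu_prob_measure])
  have ik: "integrable P (\<lambda>w. k (T w) * indicator (upper u) w)"
    using potential_le[OF nu_prob_measure] by (intro integrable_const_bound[of _ R_bound])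
      (auto intro!: AE_I2 simp: indicator_def R_bound_def intro: integral_nonneg_AE)
  have ir: "integrable P (remainder e u)" using remainder_integrable u by simp
  have "expectation (\<lambda>w. k (T w) * indicator (upper u) w - v * indicator (upper u) w)
      \<le> expectation (\<lambda>w. v * e * indicator (upper u) w + v * remainder e u w)"
  proof (rule integral_mono)
    fix w
    show "k (T w) * indicator (upper u) w - v * indicator (upper u) w \<le> v * e * indicator (upper u) w + v * remainder e u w"
      using potential_at_minimizer[of w u e] u e pos remainder_nonneg[of e u w]
      by (cases "w \<in> upper u") (auto simp: distrib_left)
  qed (use ik ir in \<open>auto simp: emeasure_eq_measure\<close>)
  also have "expectation (\<lambda>w. k (T w) * indicator (upper u) w - v * indicator (upper u) w)
      = (cond_exp_T u k - v) * prob (upper u)"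
    using ik p by (simp add: cond_exp_T_def emeasure_eq_measure field_simps)
  also have "expectation (\<lambda>w. v * e * indicator (upper u) w + v * remainder e u w)
      = v * (e + expectation (remainder e u) / prob (upper u)) * prob (upper u)"
    using ir p by (simp add: emeasure_eq_measure field_simps)
  finally show ?thesis using p by simp
qed

text \<open>Integration by parts, for a point mass at \<open>t\<close> and for \<open>\<nu>\<close>,
  turns the difference into a conditional mean of the residual at \<open>t\<close> times the excess.
  The main error is relative to \<open>cond_exp_T u k\<close>, which stays bounded although the
  level \<open>u\<close> grows.\<close>

lemma cond_covariance_le:
  assumes u: "u > 0" and e: "e > 0"
  shows "\<bar>cond_exp_T u (R t) - cond_exp_T u k * (k t / v)\<bar>
    \<le> e * cond_exp_T u k + expectation (remainder e u) / prob (upper u)"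
proof -
  have p: "prob (upper u) > 0" using upper_pos u by simp
  let ?x = "\<lambda>w. apply_bcontfun (X w) t"
  have [measurable]: "averaged \<nu> \<in> borel_measurable P" by (rule averaged_measurable[OF nu_prob_measure])
  have ex: "\<bar>y * excess u w\<bar> \<le> (norm (X w))\<^sup>2" if "\<bar>y\<bar> \<le> norm (X w)" for y w
    unfolding abs_mult power2_eq_square using that excess_le_norm[of u w] excess_nonneg[of u w] u by (intro mult_mono) auto
  have i1: "integrable P (\<lambda>w. ?x w * excess u w)" "integrable P (\<lambda>w. Y w * excess u w)"
    by (rule integrable_norm_sq_bound[of _ 1]; simp add: ex coord_le_norm averaged_le_norm[OF nu_prob_measure])+
  have i2: "integrable P (\<lambda>w. residual w * excess u w)"
  proof (rule integrable_norm_sq_bound[of _ resid_const])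
    fix w
    have "residual w * excess u w \<le> (resid_const * norm (X w)) * norm (X w)"
      using residual_le[of w] excess_le_norm[of u w] excess_nonneg[of u w] residual_nonneg[of w] resid_const u
      by (intro mult_mono) auto
    then show "\<bar>residual w * excess u w\<bar> \<le> resid_const * (norm (X w))\<^sup>2"
      by (simp add: residual_nonneg excess_nonneg power2_eq_square mult.assoc)
  qed simp
  have i3: "integrable P (excess u)" "integrable P (remainder e u)"
    using integrable_cameron_martin_weight(3)[OF nu_prob_measure, of u] remainder_integrable[of u e] u by auto
  have "expectation (\<lambda>w. ?x w * excess u w) - k t / v * expectation (\<lambda>w. Y w * excess u w)
      = expectation (\<lambda>w. (?x w - Y w / v * k t) * excess u w)"
  proof -
    have "expectation (\<lambda>w. (?x w - Y w / v * k t) * excess u w)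
        = expectation (\<lambda>w. ?x w * excess u w - k t / v * (Y w * excess u w))"
      by (intro Bochner_Integration.integral_cong) (auto simp: algebra_simps)
    then show ?thesis using i1 by simp
  qed
  also have "\<bar>\<dots>\<bar> \<le> expectation (\<lambda>w. residual w * excess u w)"
  proof (rule order_trans[OF integral_abs_bound integral_mono])
    show b: "\<bar>(?x w - Y w / v * k t) * excess u w\<bar> \<le> residual w * excess u w" for w
      unfolding abs_mult using excess_nonneg[of u w] by (auto intro!: mult_right_mono residual_coord simp del: times_divide_eq_left)
    have "integrable P (\<lambda>w. (?x w - Y w / v * k t) * excess u w)"
      by (rule Bochner_Integration.integrable_bound[OF i2], measurable, rule AE_I2, unfold real_norm_def)
        (rule order_trans[OF b abs_ge_self])
    then show "integrable P (\<lambda>w. \<bar>(?x w - Y w / v * k t) * excess u w\<bar>)" by (rule integrable_abs)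
  qed (rule i2)
  also have "\<dots> \<le> expectation (\<lambda>w. e * u * excess u w + remainder e u w)"
    using residual_excess_le[of u e] u e i2 i3 by (intro integral_mono) auto
  also have "\<dots> = e * (u * expectation (excess u)) + expectation (remainder e u)"
    using i3 by simp
  \<comment> \<open>Where the excess is positive, \<open>Y\<close> exceeds \<open>u\<close>. The
    growing level is thus absorbed into an expectation that integration by parts identifies with the
    conditional mean of \<open>k\<close>.\<close>
  also have "u * expectation (excess u) \<le> expectation (\<lambda>w. Y w * excess u w)"
  proof -
    have "expectation (\<lambda>w. u * excess u w) \<le> expectation (\<lambda>w. Y w * excess u w)"
    proof (rule integral_mono)
      fix w show "u * excess u w \<le> Y w * excess u w"
        using excess_le_averaged[of u w] u excess_nonneg[of u w]
        by (cases "M w > u") (auto intro!: mult_right_mono simp: excess_def)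
    qed (use i1 i3 in auto)
    then show ?thesis by simp
  qed
  finally have main: "\<bar>expectation (\<lambda>w. ?x w * excess u w) - k t / v * expectation (\<lambda>w. Y w * excess u w)\<bar>
      \<le> e * expectation (\<lambda>w. Y w * excess u w) + expectation (remainder e u)"
    using e by (simp add: mult_left_mono)
  have c1: "cond_exp_T u k = expectation (\<lambda>w. Y w * excess u w) / prob (upper u)"
    by (rule conditional_parts[OF nu_prob_measure u])
  have c2: "cond_exp_T u (R t) = expectation (\<lambda>w. ?x w * excess u w) / prob (upper u)"
    using conditional_parts[OF point_mass(1)[of t] u] by (simp add: point_mass)
  have "cond_exp_T u (R t) - cond_exp_T u k * (k t / v)
      = (expectation (\<lambda>w. ?x w * excess u w) - k t / v * expectation (\<lambda>w. Y w * excess u w)) / prob (upper u)"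
    unfolding c1 c2 by (simp add: diff_divide_distrib mult.commute)
  then have "\<bar>cond_exp_T u (R t) - cond_exp_T u k * (k t / v)\<bar>
      = \<bar>expectation (\<lambda>w. ?x w * excess u w) - k t / v * expectation (\<lambda>w. Y w * excess u w)\<bar> / prob (upper u)"
    by simp
  also have "\<dots> \<le> (e * expectation (\<lambda>w. Y w * excess u w) + expectation (remainder e u)) / prob (upper u)"
    using main by (intro divide_right_mono) auto
  finally show ?thesis unfolding c1 by (simp add: add_divide_distrib)
qed

section \<open>Limits of the conditional potentials and identification of the weak limits\<close>

lemma cond_potential_tendsto: "((\<lambda>u. cond_exp_T u k) \<longlongrightarrow> v) at_top"
proof (rule tendstoI)
  fix r :: real assume r: "r > 0"
  \<comment> \<open>This makes the upper bound \<open>v * (e + e)\<close> equal to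
    \<open>r / 2\<close>; the lower bound holds without error because \<open>k \<ge> v\<close>
    everywhere.\<close>
  define e where "e = r / (4 * v)"
  have e: "e > 0" using r pos by (simp add: e_def)
  have "\<forall>\<^sub>F u in at_top. expectation (remainder e u) / prob (upper u) < e"
    by (rule order_tendstoD(2)[OF remainder_negligible[OF e] e])
  then show "\<forall>\<^sub>F u in at_top. dist (cond_exp_T u k) v < r"
    using eventually_ge_at_top[of 1]
  proof eventually_elim
    case (elim u)
    have "cond_exp_T u k - v \<le> v * (e + e)"
      using cond_potential_le[OF elim(2) e] elim(1) pos
      by (elim order_trans) (intro mult_left_mono, auto)
    also have "\<dots> < r" using r pos by (simp add: e_def)
    finally show ?case using cond_potential_ge[of u] elim(2) by (simp add: dist_real_def)
  qed
qed

text \<open>The comparison term has the coefficient \<open>cond_exp_T u k / v\<close>, which tends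
  to one, so a vanishing difference leaves exactly \<open>k t\<close> in the limit.\<close>

lemma cond_covariance_tendsto: "((\<lambda>u. cond_exp_T u (R t)) \<longlongrightarrow> k t) at_top"
proof -
  have "((\<lambda>u. cond_exp_T u (R t) - cond_exp_T u k * (k t / v)) \<longlongrightarrow> 0) at_top"
  proof (rule tendstoI)
    fix r :: real assume r: "r > 0"
    have B: "R_bound \<ge> 0" unfolding R_bound_def by (intro integral_nonneg_AE) simp
    \<comment> \<open>The total error becomes \<open>e * (R_bound + 1) = r / 2\<close>; the summand
      \<open>1\<close> accounts for the quotient of \<open>remainder\<close>.\<close>
    define e where "e = r / (2 * (R_bound + 1))"
    have e: "e > 0" using r B by (simp add: e_def)
    have "\<forall>\<^sub>F u in at_top. expectation (remainder e u) / prob (upper u) < e"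
      by (rule order_tendstoD(2)[OF remainder_negligible[OF e] e])
    then show "\<forall>\<^sub>F u in at_top. dist (cond_exp_T u (R t) - cond_exp_T u k * (k t / v)) 0 < r"
      using eventually_ge_at_top[of 1]
    proof eventually_elim
      case (elim u)
      have "e * cond_exp_T u k \<le> e * R_bound"
        using cond_potential_le_bound[of u] elim(2) e by (intro mult_left_mono) auto
      then have "\<bar>cond_exp_T u (R t) - cond_exp_T u k * (k t / v)\<bar> < e * R_bound + e"
        using cond_covariance_le[of u e t] elim e by linarith
      also have "\<dots> = e * (R_bound + 1)" by (simp add: distrib_left)
      also have "\<dots> = r / 2" unfolding e_def using B by (simp add: divide_simps)
      finally show ?case using r by simp
    qed
  qed
  moreover have "((\<lambda>u. cond_exp_T u k * (k t / v)) \<longlongrightarrow> v * (k t / v)) at_top"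
    by (intro tendsto_intros cond_potential_tendsto)
  ultimately have "((\<lambda>u. cond_exp_T u (R t) - cond_exp_T u k * (k t / v) + cond_exp_T u k * (k t / v)) \<longlongrightarrow> 0 + v * (k t / v)) at_top"
    by (rule tendsto_add)
  then show ?thesis using pos by simp
qed

text \<open>\<open>R t\<close> and \<open>k\<close> are bounded and continuous, hence admissible
  test functions. The first identifies the potential of \<open>\<mu>\<close> with \<open>k\<close>;
  the second gives \<open>v\<close> as the integral of \<open>k\<close> under \<open>\<mu>\<close>,
  which by the first is the energy of \<open>\<mu>\<close>.\<close>

lemma weak_limit_optimal:
  assumes \<mu>: "\<mu> \<in> prob_measures" and u: "filterlim u at_top sequentially"
    and conv: "weak_conv_to (\<lambda>n. cond_law P T {w \<in> space P. M w > u n}) \<mu> sequentially"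
  shows "potential R \<mu> t = k t" "energy R \<mu> = v"
proof -
  have ev: "\<forall>\<^sub>F n in sequentially. 0 \<le> u n"
    using u unfolding filterlim_at_top by blast
  have lim: "(\<lambda>n. cond_exp_T (u n) (apply_bcontfun f)) \<longlonglongrightarrow> (\<integral>t. apply_bcontfun f t \<partial>\<mu>)" for f :: "'k \<Rightarrow>\<^sub>C real"
  proof (rule Lim_transform_eventually)
    show "(\<lambda>n. \<integral>t. apply_bcontfun f t \<partial>cond_law P T (upper (u n))) \<longlonglongrightarrow> (\<integral>t. apply_bcontfun f t \<partial>\<mu>)"
      using conv unfolding weak_conv_to_def upper_def by blast
    have "apply_bcontfun f \<in> borel_measurable borel" by (intro borel_measurable_continuous_onI) simp
    then show "\<forall>\<^sub>F n in sequentially. (\<integral>t. apply_bcontfun f t \<partial>cond_law P T (upper (u n))) = cond_exp_T (u n) (apply_bcontfun f)"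
      using ev by (auto elim!: eventually_mono simp: integral_cond_law)
  qed
  have k: "potential R \<mu> t = k t" for t
  proof -
    have f: "apply_bcontfun (Bcontfun (R t)) = R t"
      using R_le by (intro Bcontfun_inverse bcontfun_normI[OF R_continuous, of _ R_bound]) simp
    have "(\<lambda>n. cond_exp_T (u n) (R t)) \<longlonglongrightarrow> (\<integral>s. R t s \<partial>\<mu>)"
      using lim[of "Bcontfun (R t)"] by (simp add: f)
    moreover have "(\<lambda>n. cond_exp_T (u n) (R t)) \<longlonglongrightarrow> k t"
      by (rule filterlim_compose[OF cond_covariance_tendsto u])
    ultimately have "(\<integral>s. R t s \<partial>\<mu>) = k t" by (rule LIMSEQ_unique)
    then show ?thesis unfolding potential_def by (subst R_sym) simp
  qed
  then show "potential R \<mu> t = k t" .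
  have "(\<lambda>n. cond_exp_T (u n) k) \<longlonglongrightarrow> (\<integral>t. k t \<partial>\<mu>)"
    using lim[of "pot \<nu>"] by (simp add: pot_apply[OF nu_prob_measure])
  moreover have "(\<lambda>n. cond_exp_T (u n) k) \<longlonglongrightarrow> v"
    by (rule filterlim_compose[OF cond_potential_tendsto u])
  ultimately have "(\<integral>t. k t \<partial>\<mu>) = v" by (rule LIMSEQ_unique)
  then show "energy R \<mu> = v" by (simp add: energy_eq_integral_potential[OF \<mu>] k)
qed

end

theorem theorem2p3:
  fixes P :: "'w measure"
    and X :: "'w \<Rightarrow> ('k::metric_space \<Rightarrow>\<^sub>C real)"
    and T :: "'w \<Rightarrow> 'k"
    and R :: "'k \<Rightarrow> 'k \<Rightarrow> real"
    and M :: "'w \<Rightarrow> real"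
    and \<nu> :: "'k measure"
  assumes compact_K: "compact (UNIV :: 'k set)"
    and prob: "prob_space P"
    and X_meas: "X \<in> borel_measurable P"
    and X_gauss: "centred_gaussian_process P (\<lambda>w. apply_bcontfun (X w))"
    and R_def: "R = cov_kernel P (\<lambda>w. apply_bcontfun (X w))"
    and M_def: "M = (\<lambda>w. path_min (X w))"
    and T_sel: "minimizer_selection P X T"
    and pos: "min_energy R > 0"
    and opt: "optimal_measure R \<nu>"
  shows "(\<forall>\<mu> \<in> prob_measures. \<forall>u :: nat \<Rightarrow> real.
            filterlim u at_top sequentially \<longrightarrow>
            weak_conv_to (\<lambda>n. cond_law P T {w \<in> space P. M w > u n}) \<mu> sequentially \<longrightarrow>
            (\<forall>t. potential R \<mu> t = potential R \<nu> t) \<and> energy R \<mu> = min_energy R)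
       \<and> ((\<forall>\<nu>'. optimal_measure R \<nu>' \<longrightarrow> \<nu>' = \<nu>) \<longrightarrow>
            weak_conv_to (\<lambda>u. cond_law P T {w \<in> space P. M w > u}) \<nu> at_top)"
proof -
  interpret S: minimizer_setup P X T \<nu>
    using compact_K prob X_meas X_gauss T_sel pos opt unfolding R_def
    by (intro minimizer_setup.intro compact_gaussian_path.intro
        compact_gaussian_path_axioms.intro minimizer_setup_axioms.intro)
  have limit: "(\<forall>t. potential R \<mu> t = potential R \<nu> t) \<and> energy R \<mu> = min_energy R"
    if "\<mu> \<in> prob_measures" "filterlim u at_top sequentially"
      "weak_conv_to (\<lambda>n. cond_law P T {w \<in> space P. M w > u n}) \<mu> sequentially"
    for \<mu> and u :: "nat \<Rightarrow> real"
    using S.weak_limit_optimal[OF that(1,2) that(3)[unfolded M_def]] unfolding R_def by blast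
  have "weak_conv_to (\<lambda>u. cond_law P T {w \<in> space P. M w > u}) \<nu> at_top"
    if unique: "\<forall>\<nu>'. optimal_measure R \<nu>' \<longrightarrow> \<nu>' = \<nu>"
    unfolding weak_conv_to_def
  proof (rule allI, rule ccontr)
    fix f :: "'k \<Rightarrow>\<^sub>C real"
    define I where "I u = (\<integral>t. apply_bcontfun f t \<partial>cond_law P T {w \<in> space P. M w > u})" for u
    define L where "L = (\<integral>t. apply_bcontfun f t \<partial>\<nu>)"
    assume "\<not> ((\<lambda>u. \<integral>t. apply_bcontfun f t \<partial>cond_law P T {w \<in> space P. M w > u}) \<longlongrightarrow> (\<integral>t. apply_bcontfun f t \<partial>\<nu>)) at_top"
    then have "\<not> (I \<longlongrightarrow> L) at_top" unfolding I_def L_def .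
    then obtain e where e: "e > 0" "\<not> (\<forall>\<^sub>F u in at_top. dist (I u) L < e)"
      unfolding tendsto_iff by blast
    \<comment> \<open>A failure of convergence supplies bad levels beyond every \<open>n\<close>.
      The bound \<open>real n \<le> u n\<close> makes the sequence diverge and keeps all levels
      nonnegative, so that every conditional law is a probability measure.\<close>
    have "\<exists>u \<ge> real n. e \<le> dist (I u) L" for n
      using e(2) unfolding eventually_at_top_linorder by (meson not_less)
    then obtain u where u: "\<And>n. real n \<le> u n" "\<And>n. e \<le> dist (I (u n)) L" by metis
    have "cond_law P T {w \<in> space P. M w > u n} \<in> prob_measures" for n
      using S.prob_measures_cond_law[of "u n"] u(1)[of n] by (simp add: S.upper_def M_def)
    then obtain r \<mu> where r: "strict_mono r" and \<mu>: "\<mu> \<in> prob_measures"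
      and conv: "weak_conv_to ((\<lambda>n. cond_law P T {w \<in> space P. M w > u n}) \<circ> r) \<mu> sequentially"
      using prob_measures_convergent_subsequence[OF compact_K, of "\<lambda>n. cond_law P T {w \<in> space P. M w > u n}"] by blast
    have "filterlim u at_top sequentially"
      by (rule filterlim_at_top_mono[OF filterlim_real_sequentially]) (use u(1) in simp)
    then have "filterlim (\<lambda>n. u (r n)) at_top sequentially"
      by (rule filterlim_compose[OF _ filterlim_subseq[OF r]])
    then have "energy R \<mu> = min_energy R"
      using limit[OF \<mu>, of "\<lambda>n. u (r n)"] conv by (simp add: o_def)
    \<comment> \<open>The limit along the subsequence is optimal, so uniqueness forces the integrals
      of \<open>f\<close> towards \<open>L\<close>, although they stay at distance at least
      \<open>e\<close> from it.\<close>
    then have "\<mu> = \<nu>" using unique \<mu> by (simp add: optimal_measure_def)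
    with conv have "(\<lambda>n. I (u (r n))) \<longlonglongrightarrow> L"
      unfolding weak_conv_to_def I_def L_def o_def by blast
    then have "\<forall>\<^sub>F n in sequentially. dist (I (u (r n))) L < e" using e(1) by (rule tendstoD)
    then show False using u(2) by (auto simp: eventually_sequentially not_less[symmetric])
  qed
  with limit show ?thesis by blast
qed

end
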